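(* There exists an efficient (polynomial-time in $n$) algorithm that, given a non-negative symmetric submodular function $f\colon 2^{\mathcal{N}} \to \mathbb{R}^+$ (accessed via a value oracle) and an integer cardinality parameter $1 \leq k \leq n/2$, achieves an approximation ratio of $\tfrac{1}{2}\left[1 - (1 - k/n)^{2n/k}\right] - o(1)$ for the problem $\max\{f(S) : S\subseteq\mathcal{N},\ |S| = k\}$. If $k > n/2$, then the same result holds with the cardinality parameter $k$ in the approximation ratio replaced by $n - k$, i.e., the ratio is $\tfrac12\left[1-(1-(n-k)/n)^{2n/(n-k)}\right]-o(1)$.
   Context: $\mathcal{N}$ is a finite ground set with $n=|\mathcal{N}|$. $f$ is submodular if $f(A)+f(B)\ge f(A\cup B)+f(A\cap B)$ for all $A,B\subseteq\mathcal{N}$ and symmetric if $f(S)=f(\mathcal{N}\setminus S)$ for all $S$. A value oracle returns $f(S)$ for a queried $S$. An approximation ratio $\alpha$ means the (expected) value of the output feasible set is at least $\alpha$ times the optimum. The $o(1)$ term tends to $0$ as $n\to\infty$. *)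

theory Defs
  imports
    "HOL-Probability.SPMF"
    "HOL-Library.Log_Nat"
    "HOL-Computational_Algebra.Polynomial"
begin

subsection \<open>Symmetric submodular functions\<close>

definition submodular_on :: "'a set \<Rightarrow> ('a set \<Rightarrow> real) \<Rightarrow> bool" where
  "submodular_on N f \<longleftrightarrow>
     (\<forall>A B. A \<subseteq> N \<and> B \<subseteq> N \<longrightarrow> f A + f B \<ge> f (A \<union> B) + f (A \<inter> B))"

definition symmetric_on :: "'a set \<Rightarrow> ('a set \<Rightarrow> real) \<Rightarrow> bool" where
  "symmetric_on N f \<longleftrightarrow> (\<forall>S. S \<subseteq> N \<longrightarrow> f S = f (N - S))"

definition nonneg_on :: "'a set \<Rightarrow> ('a set \<Rightarrow> real) \<Rightarrow> bool" where
  "nonneg_on N f \<longleftrightarrow> (\<forall>S. S \<subseteq> N \<longrightarrow> 0 \<le> f S)"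

subsection \<open>Randomized value-oracle algorithms and their running time\<close>

text \<open>
  Algorithms are programs of a random access while language. The memory consists of named,
  unbounded arrays of natural numbers and of reals; a scalar is an array used at index 0.
  Natural-number arithmetic is charged by bit length (logarithmic cost), so that multiplication
  cannot be exploited to do more than polynomial work. Reals come from oracle answers only and
  can be added, subtracted and compared at unit cost; there is no real multiplication, division or
  rounding, which would be unrealistically powerful at unit cost.
  The text of a program is finite and does not depend on the instance.
\<close>

type_synonym vname = string

record state =
  nmem :: "vname \<Rightarrow> nat \<Rightarrow> nat"
  rmem :: "vname \<Rightarrow> nat \<Rightarrow> real"
  clock :: nat

datatype nexp =
    Num nat
  | NGet vname nexp
  | NAdd nexp nexp
  | NSub nexp nexp
  | NMul nexp nexp
  | NDiv nexp nexp
  | NMod nexp nexp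

datatype rexp =
    RZero
  | RGet vname nexp
  | RAdd rexp rexp
  | RSub rexp rexp

datatype bexp =
    NLess nexp nexp
  | RLess rexp rexp
  | BNot bexp
  | BAnd bexp bexp

primrec nval :: "state \<Rightarrow> nexp \<Rightarrow> nat" where
  "nval s (Num m) = m"
| "nval s (NGet x i) = nmem s x (nval s i)"
| "nval s (NAdd a b) = nval s a + nval s b"
| "nval s (NSub a b) = nval s a - nval s b"
| "nval s (NMul a b) = nval s a * nval s b"
| "nval s (NDiv a b) = nval s a div nval s b"
| "nval s (NMod a b) = nval s a mod nval s b"

primrec rval :: "state \<Rightarrow> rexp \<Rightarrow> real" where
  "rval s RZero = 0"
| "rval s (RGet x i) = rmem s x (nval s i)"
| "rval s (RAdd a b) = rval s a + rval s b"
| "rval s (RSub a b) = rval s a - rval s b"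

primrec bval :: "state \<Rightarrow> bexp \<Rightarrow> bool" where
  "bval s (NLess a b) \<longleftrightarrow> nval s a < nval s b"
| "bval s (RLess a b) \<longleftrightarrow> rval s a < rval s b"
| "bval s (BNot b) \<longleftrightarrow> \<not> bval s b"
| "bval s (BAnd a b) \<longleftrightarrow> bval s a \<and> bval s b"

abbreviation bits :: "nat \<Rightarrow> nat" where
  "bits m \<equiv> floorlog 2 m"

text \<open>Every natural-number subexpression is charged one plus the bit length of its value.\<close>

primrec ncost :: "state \<Rightarrow> nexp \<Rightarrow> nat" where
  "ncost s (Num m) = 1 + bits m"
| "ncost s (NGet x i) = 1 + bits (nval s (NGet x i)) + ncost s i"
| "ncost s (NAdd a b) = 1 + bits (nval s (NAdd a b)) + ncost s a + ncost s b"
| "ncost s (NSub a b) = 1 + bits (nval s (NSub a b)) + ncost s a + ncost s b"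
| "ncost s (NMul a b) = 1 + bits (nval s (NMul a b)) + ncost s a + ncost s b"
| "ncost s (NDiv a b) = 1 + bits (nval s (NDiv a b)) + ncost s a + ncost s b"
| "ncost s (NMod a b) = 1 + bits (nval s (NMod a b)) + ncost s a + ncost s b"

primrec rcost :: "state \<Rightarrow> rexp \<Rightarrow> nat" where
  "rcost s RZero = 1"
| "rcost s (RGet x i) = 1 + ncost s i"
| "rcost s (RAdd a b) = 1 + rcost s a + rcost s b"
| "rcost s (RSub a b) = 1 + rcost s a + rcost s b"

primrec bcost :: "state \<Rightarrow> bexp \<Rightarrow> nat" where
  "bcost s (NLess a b) = 1 + ncost s a + ncost s b"
| "bcost s (RLess a b) = 1 + rcost s a + rcost s b"
| "bcost s (BNot b) = 1 + bcost s b"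
| "bcost s (BAnd a b) = 1 + bcost s a + bcost s b"

datatype com =
    Skip
  | NAssign vname nexp nexp
  | RAssign vname nexp rexp
  | Random vname nexp
  | Query vname vname
  | Seq com com
  | Cond bexp com com
  | While bexp com

definition tick :: "nat \<Rightarrow> state \<Rightarrow> state" where
  "tick t s = s\<lparr>clock := clock s + t\<rparr>"

definition nupd :: "vname \<Rightarrow> nat \<Rightarrow> nat \<Rightarrow> state \<Rightarrow> state" where
  "nupd x i v s = s\<lparr>nmem := (nmem s)(x := (nmem s x)(i := v))\<rparr>"

definition rupd :: "vname \<Rightarrow> nat \<Rightarrow> real \<Rightarrow> state \<Rightarrow> state" where
  "rupd x i v s = s\<lparr>rmem := (rmem s)(x := (rmem s x)(i := v))\<rparr>"

text \<open>Sets of ground elements are stored as characteristic arrays.\<close>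

definition set_at :: "nat \<Rightarrow> vname \<Rightarrow> state \<Rightarrow> nat set" where
  "set_at n x s = {i. i < n \<and> nmem s x i \<noteq> 0}"

partial_function (spmf) while_spmf :: "('s \<Rightarrow> bool) \<Rightarrow> ('s \<Rightarrow> 's spmf) \<Rightarrow> 's \<Rightarrow> 's spmf" where
  "while_spmf g body s =
     (if g s then bind_spmf (body s) (while_spmf g body) else return_spmf s)"

text \<open>
  \<open>exec n f P s\<close> is the distribution of final states of \<open>P\<close> started in \<open>s\<close>, where \<open>f\<close> is
  the value oracle on subsets of \<open>{..<n}\<close>; missing probability mass means divergence.
  \<open>Random x a\<close> stores a uniform element of \<open>{0..a}\<close> in \<open>x[0]\<close>. \<open>Query r x\<close> stores in \<open>r[0]\<close>
  the value of the set held by array \<open>x\<close>, and is charged the length of the query.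
\<close>

primrec exec :: "nat \<Rightarrow> (nat set \<Rightarrow> real) \<Rightarrow> com \<Rightarrow> state \<Rightarrow> state spmf" where
  "exec n f Skip s = return_spmf (tick 1 s)"
| "exec n f (NAssign x i a) s =
     return_spmf (tick (1 + ncost s i + ncost s a) (nupd x (nval s i) (nval s a) s))"
| "exec n f (RAssign x i a) s =
     return_spmf (tick (1 + ncost s i + rcost s a) (rupd x (nval s i) (rval s a) s))"
| "exec n f (Random x a) s =
     map_spmf (\<lambda>v. tick (1 + ncost s a) (nupd x 0 v s)) (spmf_of_set {0..nval s a})"
| "exec n f (Query r x) s =
     return_spmf (tick (1 + n) (rupd r 0 (f (set_at n x s)) s))"
| "exec n f (Seq c d) s = bind_spmf (exec n f c s) (exec n f d)"
| "exec n f (Cond b c d) s =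
     (if bval s b then exec n f c (tick (1 + bcost s b) s)
      else exec n f d (tick (1 + bcost s b) s))"
| "exec n f (While b c) s =
     map_spmf (\<lambda>s'. tick (1 + bcost s' b) s')
       (while_spmf (\<lambda>s. bval s b) (\<lambda>s. exec n f c (tick (1 + bcost s b) s)) s)"

definition init_state :: "nat \<Rightarrow> nat \<Rightarrow> state" where
  "init_state n k =
     nupd ''n'' 0 n (nupd ''k'' 0 k \<lparr>nmem = (\<lambda>_ _. 0), rmem = (\<lambda>_ _. 0), clock = 0\<rparr>)"

definition run :: "com \<Rightarrow> nat \<Rightarrow> nat \<Rightarrow> (nat set \<Rightarrow> real) \<Rightarrow> state spmf" where
  "run P n k f = exec n f P (init_state n k)"

definition out_set :: "nat \<Rightarrow> state \<Rightarrow> nat set" where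
  "out_set n s = set_at n ''out'' s"

subsection \<open>Symmetric submodular maximization subject to a cardinality constraint\<close>

definition sym_instance :: "nat \<Rightarrow> nat \<Rightarrow> (nat set \<Rightarrow> real) \<Rightarrow> bool" where
  "sym_instance n k f \<longleftrightarrow>
     nonneg_on {..<n} f \<and> symmetric_on {..<n} f \<and> submodular_on {..<n} f \<and> 1 \<le> k \<and> k \<le> n"

definition feasible :: "nat \<Rightarrow> nat \<Rightarrow> nat set set" where
  "feasible n k = {S. S \<subseteq> {..<n} \<and> card S = k}"

definition opt :: "nat \<Rightarrow> nat \<Rightarrow> (nat set \<Rightarrow> real) \<Rightarrow> real" where
  "opt n k f = Max (f ` feasible n k)"

definition polynomial_time :: "com \<Rightarrow> bool" where
  "polynomial_time P \<longleftrightarrow>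
     (\<exists>p :: nat poly. \<forall>n k f. sym_instance n k f \<longrightarrow>
        lossless_spmf (run P n k f) \<and> (\<forall>s \<in> set_spmf (run P n k f). clock s \<le> poly p n))"

definition achieves_ratio :: "com \<Rightarrow> nat \<Rightarrow> nat \<Rightarrow> (nat set \<Rightarrow> real) \<Rightarrow> real \<Rightarrow> bool" where
  "achieves_ratio P n k f \<alpha> \<longleftrightarrow>
     (\<forall>s \<in> set_spmf (run P n k f). out_set n s \<in> feasible n k) \<and>
     integral\<^sup>L (measure_spmf (run P n k f)) (\<lambda>s. f (out_set n s)) \<ge> \<alpha> * opt n k f"

end

theory Submission
  imports Defs
begin

text \<open>
  Replace \<open>k\<close> by \<open>min k (n - k)\<close>, complementing the output if necessary. Let \<open>F\<close> be the multilinear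
  extension of \<open>f\<close> and \<open>O\<close> an optimal set. Submodularity together with symmetry gives
  \<open>f (S \<union> O) + f (S - O) \<ge> f O\<close>, hence the gains of inserting single elements of \<open>O\<close> into a random set and
  those of deleting them sum up to at least \<open>f O - 2 F(y)\<close>. So moving the best coordinate of \<open>y\<close> by a
  fraction \<open>1/w\<close> of its distance to 1, and the best coordinate by a fraction \<open>1/w\<close> of its distance to 0,
  contracts the deficit \<open>f O - 2 F(y)\<close> by the factor \<open>1 - 2 / (k w)\<close>, up to sampling and rounding errors.
  Every round multiplies the product of the slacks \<open>1 - y\<^sub>u\<close> by at least \<open>1 - 1/w\<close>, so by the inequality of
  arithmetic and geometric means the coordinate sum can reach \<open>k\<close> only after about \<open>- w n ln (1 - k/n)\<close>
  rounds; by then the deficit is at most \<open>(1 - k/n) powr (2 n / k) * f O\<close>.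

  If the coordinate sum is still below \<open>k\<close>, then \<open>y\<close> is mixed with the constant vector \<open>1/2\<close> until the sum is
  exactly \<open>k\<close>. For symmetric \<open>f\<close> this never increases a positive deficit. Pipage rounding then turns \<open>y\<close>
  into a set of size \<open>k\<close> without loss in expectation.
\<close>

subsection \<open>The multilinear extension\<close>

text \<open>Deletions lower the coordinate sum again, so the number of useful rounds differs from
  run to run and no round index is common to all runs. Only the excess of the deficit over a fixed
  target is therefore followed; a run that stops early has already brought its guaranteed
  contraction below the target.

  All errors have to be small relative to \<open>f O\<close>, although \<open>f\<close> may be
  larger on sets of other sizes; for \<open>2 * k \<le> n\<close> it exceeds \<open>f O\<close> by a
  factor of at most \<open>n\<close>. With step \<open>1 / w\<close>, grid \<open>1 / w^2\<close>
  and \<open>w^3\<close> samples, a round costs \<open>O(n / w^2) * f O\<close>, and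
  \<open>w = n^3\<close> makes all \<open>2 * n * w\<close> rounds cost
  \<open>O(1 / n) * f O\<close>. Sampling errors enter through second moments only, so expectations
  suffice and no failure event has to be excluded.

  The machine adds and compares reals but cannot multiply or divide them. Fractional vectors are
  therefore natural numbers over a common denominator, and mixing changes the denominator instead of
  rounding.\<close>

primrec mlext :: "nat \<Rightarrow> (nat \<Rightarrow> real) \<Rightarrow> (nat set \<Rightarrow> real) \<Rightarrow> real" where
  "mlext 0 y g = g {}"
| "mlext (Suc n) y g = y n * mlext n y (\<lambda>S. g (insert n S)) + (1 - y n) * mlext n y g"

text \<open>\<open>mlext n y g\<close> averages \<open>g\<close> over the random set that contains
  each \<open>u < n\<close> independently with probability \<open>y u\<close>; the recursion
  conditions on the last element. Its identities are polynomial in \<open>y\<close> and hold for all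
  reals, whereas comparisons need probabilities in the unit interval.\<close>

definition unit_vec :: "nat \<Rightarrow> (nat \<Rightarrow> real) \<Rightarrow> bool" where
  "unit_vec n y \<longleftrightarrow> (\<forall>u<n. 0 \<le> y u \<and> y u \<le> 1)"

lemma mlext_add: "mlext n y (\<lambda>S. g S + h S) = mlext n y g + mlext n y h"
  by (induction n arbitrary: g h) (simp_all add: algebra_simps)

lemma mlext_cmult: "mlext n y (\<lambda>S. c * g S) = c * mlext n y g"
  by (induction n arbitrary: g) (simp_all add: algebra_simps)

lemma mlext_const: "mlext n y (\<lambda>S. c) = c"
  by (induction n) (simp_all add: algebra_simps)

lemma mlext_diff: "mlext n y (\<lambda>S. g S - h S) = mlext n y g - mlext n y h"
  using mlext_add[of n y "\<lambda>S. g S - h S" h] by simp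

lemma mlext_sum: "mlext n y (\<lambda>S. \<Sum>i\<in>I. g i S) = (\<Sum>i\<in>I. mlext n y (g i))"
proof (cases "finite I")
  case True
  then show ?thesis
    by (induction I rule: finite_induct) (simp_all add: mlext_const mlext_add)
qed (simp add: mlext_const)

lemma mlext_mono:
  assumes "unit_vec n y" "\<And>S. S \<subseteq> {..<n} \<Longrightarrow> g S \<le> h S"
  shows "mlext n y g \<le> mlext n y h"
  using assms
proof (induction n arbitrary: g h)
  case (Suc n)
  have "unit_vec n y" "0 \<le> y n" "y n \<le> 1"
    using Suc.prems(1) by (auto simp: unit_vec_def)
  moreover have "mlext n y g \<le> mlext n y h"
    using \<open>unit_vec n y\<close> by (intro Suc.IH Suc.prems(2)) auto
  moreover have "mlext n y (\<lambda>S. g (insert n S)) \<le> mlext n y (\<lambda>S. h (insert n S))"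
    using \<open>unit_vec n y\<close> by (intro Suc.IH Suc.prems(2)) auto
  ultimately show ?case
    by (simp add: add_mono mult_left_mono)
qed simp

lemma mlext_cong:
  assumes "\<And>u. u < n \<Longrightarrow> y u = z u" "\<And>S. S \<subseteq> {..<n} \<Longrightarrow> g S = h S"
  shows "mlext n y g = mlext n z h"
  using assms
proof (induction n arbitrary: g h)
  case (Suc n)
  have "mlext n y g = mlext n z h"
    by (intro Suc.IH Suc.prems) auto
  moreover have "mlext n y (\<lambda>S. g (insert n S)) = mlext n z (\<lambda>S. h (insert n S))"
    by (intro Suc.IH Suc.prems) auto
  ultimately show ?case
    using Suc.prems(1) by simp
qed simp

lemma mlext_upd:
  assumes "u < n"
  shows "mlext n (y(u := p)) g =
    p * mlext n y (\<lambda>S. g (insert u S)) + (1 - p) * mlext n y (\<lambda>S. g (S - {u}))"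
  using assms
proof (induction n arbitrary: g)
  case (Suc n)
  show ?case
  proof (cases "u = n")
    case True
    have "mlext n (y(n := p)) h = mlext n y h" for h
      by (rule mlext_cong) auto
    moreover have "mlext n y (\<lambda>S. g (S - {n})) = mlext n y g"
      by (rule mlext_cong) (auto intro!: arg_cong[of _ _ g])
    moreover have "mlext n y (\<lambda>S. g (insert n S - {n})) = mlext n y g"
      by (rule mlext_cong) (auto intro!: arg_cong[of _ _ g])
    ultimately show ?thesis
      unfolding True mlext.simps fun_upd_same insert_absorb2 by (simp add: algebra_simps)
  next
    case False
    then have "u < n" using Suc.prems by simp
    have ins: "insert n S - {u} = insert n (S - {u})" "insert n (insert u S) = insert u (insert n S)" for S
      using False by auto
    show ?thesis
      unfolding mlext.simps Suc.IH[OF \<open>u < n\<close>] ins using False by (simp add: algebra_simps)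
  qed
qed simp

lemma mlext_split:
  assumes "u < n"
  shows "mlext n y g =
    y u * mlext n y (\<lambda>S. g (insert u S)) + (1 - y u) * mlext n y (\<lambda>S. g (S - {u}))"
  using mlext_upd[OF assms, of y "y u" g] by simp

lemma mlext_upd_diff:
  assumes "u < n"
  shows "mlext n (y(u := p)) g = mlext n y g +
    (p - y u) * (mlext n y (\<lambda>S. g (insert u S)) - mlext n y (\<lambda>S. g (S - {u})))"
  unfolding mlext_upd[OF assms] mlext_split[OF assms, of y g] by (simp add: algebra_simps)

lemma mlext_bounds:
  assumes "unit_vec n y" "\<And>S. S \<subseteq> {..<n} \<Longrightarrow> a \<le> g S" "\<And>S. S \<subseteq> {..<n} \<Longrightarrow> g S \<le> b"
  shows "a \<le> mlext n y g" "mlext n y g \<le> b"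
  using mlext_mono[OF assms(1), of "\<lambda>_. a" g] mlext_mono[OF assms(1), of g "\<lambda>_. b"] assms(2,3)
  by (auto simp: mlext_const)

lemma mlext_ind:
  assumes "S \<subseteq> {..<n}"
  shows "mlext n (\<lambda>u. if u \<in> S then 1 else 0) g = g S"
  using assms
proof (induction n arbitrary: g S)
  case (Suc n)
  have "mlext n (\<lambda>u. if u \<in> S then 1 else 0) h = h (S - {n})" for h :: "nat set \<Rightarrow> real"
  proof -
    have "mlext n (\<lambda>u. if u \<in> S then 1 else 0) h = mlext n (\<lambda>u. if u \<in> S - {n} then 1 else 0) h"
      by (rule mlext_cong) auto
    also have "\<dots> = h (S - {n})"
      using Suc.prems by (intro Suc.IH) force
    finally show ?thesis .
  qed
  then show ?case
    by (auto simp: insert_absorb)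
qed auto

lemma mlext_ind_gen:
  assumes "\<And>u. u < n \<Longrightarrow> y u = (if u \<in> S then 1 else 0)" "S \<subseteq> {..<n}"
  shows "mlext n y g = g S"
  using mlext_ind[OF assms(2)] mlext_cong[of n y "\<lambda>u. if u \<in> S then 1 else 0" g g] assms(1) by simp


section \<open>Concavity on blocks of coordinates and independent noise\<close>

definition set_on :: "nat set \<Rightarrow> real \<Rightarrow> (nat \<Rightarrow> real) \<Rightarrow> nat \<Rightarrow> real" where
  "set_on C p y = (\<lambda>u. if u \<in> C then p else y u)"

lemma set_on_insert: "set_on (insert u C) p y = (set_on C p y)(u := p)"
  by (auto simp: set_on_def)

lemma set_on_insert': "set_on (insert u C) p y = set_on C p (y(u := p))"
  by (auto simp: set_on_def)

lemma mlext_set_on: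
  assumes "finite C" "C \<subseteq> {..<n}"
  shows "mlext n (set_on C 1 y) g = mlext n y (\<lambda>S. g (S \<union> C))"
    and "mlext n (set_on C 0 y) g = mlext n y (\<lambda>S. g (S - C))"
  using assms
proof (induction C arbitrary: g rule: finite_induct)
  case empty
  { case 1 then show ?case by (simp add: set_on_def)
  next case 2 then show ?case by (simp add: set_on_def) }
next
  case (insert u C)
  { case 1
    then have u: "u < n" and C: "C \<subseteq> {..<n}" by auto
    show ?case
      unfolding set_on_insert mlext_upd[OF u] insert.IH(1)[OF C] by simp
  next
    case 2
    have "S - C - {u} = S - insert u C" for S by auto
    moreover have u: "u < n" and C: "C \<subseteq> {..<n}" using 2 by auto
    ultimately show ?case
      unfolding set_on_insert mlext_upd[OF u] insert.IH(2)[OF C] by simp }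
qed

text \<open>Interpolating the block \<open>C\<close> and the new coordinate \<open>u\<close>
  separately produces all four corners \<open>F i j\<close>. By submodularity the mixed corners
  weigh at least as much as the diagonal ones, and \<open>p * (1 - p)\<close> is exactly the weight
  to be exchanged.\<close>

lemma mlext_block_concave:
  assumes sub: "submodular_on {..<n} g" and "finite C" "C \<subseteq> {..<n}"
    and y: "unit_vec n y" and p: "0 \<le> p" "p \<le> 1"
  shows "(1 - p) * mlext n (set_on C 0 y) g + p * mlext n (set_on C 1 y) g \<le> mlext n (set_on C p y) g"
  using assms(2,3,4)
proof (induction C arbitrary: y rule: finite_induct)
  case empty
  then show ?case by (simp add: set_on_def algebra_simps)
next
  case (insert u C)
  have u: "u < n" and C: "C \<subseteq> {..<n}" using insert.prems by auto
  define F where "F i j = mlext n (set_on C i (y(u := j))) g" for i j :: real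
  have uv: "unit_vec n (y(u := j))" if "0 \<le> j" "j \<le> 1" for j
    using insert.prems(2) that by (auto simp: unit_vec_def)
  have swap: "set_on C i (y(u := j)) = (set_on C i y)(u := j)" for i j
    using insert.hyps(2) by (auto simp: set_on_def)
  have "F 1 0 + F 0 1 \<ge> F 0 0 + F 1 1"
  proof -
    have e: "F 1 0 = mlext n y (\<lambda>S. g (S \<union> C - {u}))" "F 0 1 = mlext n y (\<lambda>S. g (insert u (S - C)))"
      "F 0 0 = mlext n y (\<lambda>S. g (S - C - {u}))" "F 1 1 = mlext n y (\<lambda>S. g (insert u (S \<union> C)))"
      unfolding F_def swap
      by (simp_all add: mlext_upd[OF u] mlext_set_on[OF insert.hyps(1) C])
    have pt: "g (S - C - {u}) + g (insert u (S \<union> C)) \<le> g (S \<union> C - {u}) + g (insert u (S - C))"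
      if "S \<subseteq> {..<n}" for S
    proof -
      have "S \<union> C - {u} \<subseteq> {..<n}" "insert u (S - C) \<subseteq> {..<n}" using that C u by auto
      then have "g ((S \<union> C - {u}) \<union> insert u (S - C)) + g ((S \<union> C - {u}) \<inter> insert u (S - C))
          \<le> g (S \<union> C - {u}) + g (insert u (S - C))"
        using sub unfolding submodular_on_def by blast
      moreover have "(S \<union> C - {u}) \<union> insert u (S - C) = insert u (S \<union> C)" by auto
      moreover have "(S \<union> C - {u}) \<inter> insert u (S - C) = S - C - {u}" using insert.hyps(2) by auto
      ultimately show ?thesis by simp
    qed
    show ?thesis
      unfolding e mlext_add[symmetric] by (rule mlext_mono[OF insert.prems(2) pt])
  qed
  then have "p * (1 - p) * (F 0 0 + F 1 1) \<le> p * (1 - p) * (F 1 0 + F 0 1)"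
    using p by (intro mult_left_mono) auto
  moreover have "F p p = (1 - p) * F p 0 + p * F p 1"
    unfolding F_def swap by (simp add: mlext_upd[OF u])
  moreover have "(1 - p) * F 0 0 + p * F 1 0 \<le> F p 0" "(1 - p) * F 0 1 + p * F 1 1 \<le> F p 1"
    unfolding F_def by (intro insert.IH[OF C] uv; simp)+
  then have "(1 - p) * ((1 - p) * F 0 0 + p * F 1 0) \<le> (1 - p) * F p 0"
    "p * ((1 - p) * F 0 1 + p * F 1 1) \<le> p * F p 1"
    using p by (auto intro: mult_left_mono)
  ultimately have "(1 - p) * F 0 0 + p * F 1 1 \<le> F p p"
    by (simp add: algebra_simps)
  then show ?case
    by (simp add: F_def set_on_insert')
qed

text \<open>Flipping the membership of each element independently with probability \<mu> gives
  exactly the mixed marginals, so mixing a vector reduces to adding noise to a fixed set.\<close>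

lemma mlext_noise:
  "mlext n (\<lambda>u. y u * (1 - \<mu>) + (1 - y u) * \<mu>) g =
   mlext n y (\<lambda>S. mlext n (\<lambda>u. if u \<in> S then 1 - \<mu> else \<mu>) g)"
proof (induction n arbitrary: g)
  case (Suc n)
  define h where "h g S = mlext n (\<lambda>u. if u \<in> S then 1 - \<mu> else \<mu>) g" for g :: "nat set \<Rightarrow> real" and S
  define z where "z = (\<lambda>u. y u * (1 - \<mu>) + (1 - y u) * \<mu>)"
  have IH: "mlext n z g = mlext n y (h g)" for g
    unfolding z_def h_def by (rule Suc.IH)
  have "mlext (Suc n) (\<lambda>u. if u \<in> insert n S then 1 - \<mu> else \<mu>) g
      = (1 - \<mu>) * h (\<lambda>S. g (insert n S)) S + \<mu> * h g S" for S
  proof -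
    have "mlext n (\<lambda>u. if u \<in> insert n S then 1 - \<mu> else \<mu>) k = h k S" for k
      unfolding h_def by (rule mlext_cong) auto
    then show ?thesis unfolding mlext.simps by simp
  qed
  moreover have "mlext n y (\<lambda>S. mlext (Suc n) (\<lambda>u. if u \<in> S then 1 - \<mu> else \<mu>) g)
      = mlext n y (\<lambda>S. \<mu> * h (\<lambda>S. g (insert n S)) S + (1 - \<mu>) * h g S)"
    by (rule mlext_cong) (auto simp: h_def)
  ultimately show ?case
    unfolding mlext.simps(2)[of n y] z_def[symmetric]
    unfolding mlext.simps(2)[of n z] IH
    by (simp only: mlext_add mlext_cmult) (simp add: z_def algebra_simps)
qed simp


text \<open>Along two coordinates the extension is bilinear, and the coefficient of the product is a
  mixed second difference, nonpositive by submodularity. Rounding two coordinates against each other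
  relies on this sign.\<close>

lemma mlext_upd2:
  assumes "u < n" "v < n" "u \<noteq> v" "submodular_on {..<n} g" "unit_vec n y"
  obtains p q r s where "s \<le> 0" "\<And>a b. mlext n (y(u := a, v := b)) g = p + q * a + r * b + s * (a * b)"
proof -
  define F11 where "F11 = mlext n y (\<lambda>S. g (insert v (insert u S)))"
  define F01 where "F01 = mlext n y (\<lambda>S. g (insert v (S - {u})))"
  define F10 where "F10 = mlext n y (\<lambda>S. g (insert u S - {v}))"
  define F00 where "F00 = mlext n y (\<lambda>S. g (S - {u} - {v}))"
  have pt: "g (insert v (insert u S)) + g (S - {u} - {v}) \<le> g (insert v (S - {u})) + g (insert u S - {v})"
    if "S \<subseteq> {..<n}" for S
  proof -
    have "insert v (S - {u}) \<subseteq> {..<n}" "insert u S - {v} \<subseteq> {..<n}" using that assms by auto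
    then have "g (insert v (S - {u}) \<union> (insert u S - {v})) + g (insert v (S - {u}) \<inter> (insert u S - {v}))
          \<le> g (insert v (S - {u})) + g (insert u S - {v})"
      using assms(4) unfolding submodular_on_def by blast
    moreover have "insert v (S - {u}) \<union> (insert u S - {v}) = insert v (insert u S)" by auto
    moreover have "insert v (S - {u}) \<inter> (insert u S - {v}) = S - {u} - {v}" using assms(3) by auto
    ultimately show ?thesis by simp
  qed
  have "F11 + F00 \<le> F01 + F10"
    unfolding F11_def F00_def F01_def F10_def mlext_add[symmetric]
    by (rule mlext_mono[OF assms(5) pt])
  moreover have "mlext n (y(u := a, v := b)) g =
      F00 + (F10 - F00) * a + (F01 - F00) * b + (F11 - F10 - F01 + F00) * (a * b)" for a b
    by (simp add: mlext_upd[OF assms(2)] mlext_upd[OF assms(1)] F11_def F01_def F10_def F00_def algebra_simps)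
  ultimately show thesis
    by (intro that[of "F11 - F10 - F01 + F00"]) auto
qed

subsection \<open>Symmetric submodular functions\<close>

definition interp :: "real \<Rightarrow> (real \<Rightarrow> real) \<Rightarrow> real" where
  "interp p h = (1 - p) * h 0 + p * h 1"

lemma interp_mono:
  "0 \<le> p \<Longrightarrow> p \<le> 1 \<Longrightarrow> h 0 \<le> h' 0 \<Longrightarrow> h 1 \<le> h' 1 \<Longrightarrow> interp p h \<le> interp p h'"
  unfolding interp_def by (intro add_mono mult_left_mono) auto

locale symmetric_submodular =
  fixes n :: nat and f :: "nat set \<Rightarrow> real"
  assumes nonneg: "S \<subseteq> {..<n} \<Longrightarrow> 0 \<le> f S"
    and symm: "S \<subseteq> {..<n} \<Longrightarrow> f ({..<n} - S) = f S"
    and submod_on: "submodular_on {..<n} f"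
begin

section \<open>Marginal values under symmetry\<close>

lemma submod: "A \<subseteq> {..<n} \<Longrightarrow> B \<subseteq> {..<n} \<Longrightarrow> f (A \<union> B) + f (A \<inter> B) \<le> f A + f B"
  using submod_on unfolding submodular_on_def by blast

lemma sum_marginals_ge:
  assumes "T \<subseteq> {..<n}" "S \<subseteq> {..<n}"
  shows "f (S \<union> T) - f S \<le> (\<Sum>u\<in>T. f (insert u S) - f S)"
proof -
  have "finite T" using assms(1) finite_subset by blast
  then show ?thesis using assms
  proof (induction T rule: finite_induct)
    case (insert u T)
    have "f ((S \<union> T) \<union> insert u S) + f ((S \<union> T) \<inter> insert u S) \<le> f (S \<union> T) + f (insert u S)"
      using insert.prems by (intro submod) auto
    moreover have "(S \<union> T) \<union> insert u S = S \<union> insert u T" "(S \<union> T) \<inter> insert u S = S"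
      using insert.hyps by auto
    ultimately have "f (S \<union> insert u T) + f S \<le> f (S \<union> T) + f (insert u S)"
      by (simp only:)
    moreover have "f (S \<union> T) - f S \<le> (\<Sum>u\<in>T. f (insert u S) - f S)"
      using insert by auto
    ultimately show ?case
      using insert.hyps by simp
  qed simp
qed

text \<open>By symmetry, deleting from \<open>S\<close> is inserting into the complement of
  \<open>S\<close>.\<close>

lemma sum_deletions_ge:
  assumes "T \<subseteq> {..<n}" "S \<subseteq> {..<n}"
  shows "f (S - T) - f S \<le> (\<Sum>u\<in>T. f (S - {u}) - f S)"
proof -
  have "f (S - T) = f (({..<n} - S) \<union> T)"
  proof -
    have "{..<n} - (S - T) = ({..<n} - S) \<union> T" using assms by auto
    then show ?thesis using symm[of "S - T"] assms by (metis Diff_subset subset_trans)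
  qed
  moreover have "f (S - {u}) = f (insert u ({..<n} - S))" if "u \<in> T" for u
  proof -
    have "{..<n} - (S - {u}) = insert u ({..<n} - S)" using assms that by auto
    then show ?thesis using symm[of "S - {u}"] assms by (metis Diff_subset subset_trans)
  qed
  ultimately show ?thesis
    using sum_marginals_ge[OF assms(1), of "{..<n} - S"] symm[OF assms(2)] by simp
qed

text \<open>Submodularity for the complement of \<open>S \<union> T\<close> and for
  \<open>S - T\<close>: their union is the complement of \<open>T\<close>, and symmetry removes the
  complements. This takes the place of monotonicity: insertions alone only reach
  \<open>f (S \<union> T)\<close>, which can be smaller than \<open>f T\<close>.\<close>

lemma posimodular:
  assumes "T \<subseteq> {..<n}" "S \<subseteq> {..<n}"
  shows "f T \<le> f (S \<union> T) + f (S - T)"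
proof -
  have "f (({..<n} - (S \<union> T)) \<union> (S - T)) + f (({..<n} - (S \<union> T)) \<inter> (S - T)) \<le> f ({..<n} - (S \<union> T)) + f (S - T)"
    using assms by (intro submod) auto
  moreover have "({..<n} - (S \<union> T)) \<union> (S - T) = {..<n} - T" using assms by auto
  moreover have "0 \<le> f (({..<n} - (S \<union> T)) \<inter> (S - T))" using assms by (intro nonneg) auto
  ultimately show ?thesis using symm[OF assms(1)] symm[of "S \<union> T"] assms by simp
qed

lemma sum_moves_ge:
  assumes "T \<subseteq> {..<n}" "S \<subseteq> {..<n}"
  shows "f T - 2 * f S \<le> (\<Sum>u\<in>T. (f (insert u S) - f S) + (f (S - {u}) - f S))"
  using sum_marginals_ge[OF assms] sum_deletions_ge[OF assms] posimodular[OF assms]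
  unfolding sum.distrib by linarith

text \<open>The deletion marginals over \<open>S\<close> sum to at least \<open>- f S\<close>, so
  some element costs at most \<open>f S / card S\<close>. Deleting such elements one at a time
  multiplies the guarantees to \<open>j / card S\<close>.\<close>

lemma shrink_set:
  assumes "S \<subseteq> {..<n}" "j \<le> card S"
  shows "\<exists>X \<subseteq> S. card X = j \<and> real j * f S \<le> real (card S) * f X"
  using assms
proof (induction "card S" arbitrary: S)
  case 0
  then show ?case using nonneg[of S] by auto
next
  case (Suc m)
  have fin: "finite S" using Suc.prems finite_subset by blast
  show ?case
  proof (cases "j = Suc m")
    case True
    then show ?thesis using Suc.hyps by auto
  next
    case False
    have "\<exists>u\<in>S. real m * f S \<le> real (Suc m) * f (S - {u})"
    proof (rule ccontr)
      assume "\<not> ?thesis"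
      then have *: "f (S - {u}) - f S < - f S / real (Suc m)" if "u \<in> S" for u
        using that by (auto simp: field_simps not_le)
      have "S \<noteq> {}" using Suc.hyps by auto
      have "- f S \<le> f (S - S) - f S" using nonneg[of "{}"] by simp
      also have "\<dots> \<le> (\<Sum>u\<in>S. f (S - {u}) - f S)"
        by (rule sum_deletions_ge[OF Suc.prems(1) Suc.prems(1)])
      also have "\<dots> < (\<Sum>u\<in>S. - f S / real (Suc m))"
        by (rule sum_strict_mono[OF fin \<open>S \<noteq> {}\<close> *])
      also have "\<dots> = - f S" using Suc.hyps(2) by (simp add: field_simps flip: Suc.hyps(2))
      finally show False by simp
    qed
    then obtain u where u: "u \<in> S" "real m * f S \<le> real (Suc m) * f (S - {u})" by blast
    have c: "m = card (S - {u})" using u fin Suc.hyps by simp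
    obtain X where X: "X \<subseteq> S - {u}" "card X = j" "real j * f (S - {u}) \<le> real m * f X"
      using Suc.hyps(1)[OF c] Suc.prems False Suc.hyps(2) c by auto
    have "real m * (real j * f S) \<le> real m * (real (Suc m) * f X)"
    proof -
      have "real m * (real j * f S) = real j * (real m * f S)" by simp
      also have "\<dots> \<le> real j * (real (Suc m) * f (S - {u}))"
        using u(2) by (intro mult_left_mono) auto
      also have "\<dots> = real (Suc m) * (real j * f (S - {u}))" by simp
      also have "\<dots> \<le> real (Suc m) * (real m * f X)"
        using X(3) by (intro mult_left_mono) auto
      finally show ?thesis by (simp add: mult_ac)
    qed
    \<comment> \<open>The factor \<open>m\<close> cannot be cancelled when it is 0; then
      \<open>j = 0\<close> and nonnegativity is enough.\<close>
    moreover have "real j * f S \<le> real (Suc m) * f X" if "m = 0"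
    proof -
      have "j = 0" using that False Suc.prems(2) Suc.hyps(2) by simp
      moreover have "X \<subseteq> {..<n}" using X(1) Suc.prems(1) by auto
      ultimately show ?thesis using nonneg[of X] by simp
    qed
    ultimately have "real j * f S \<le> real (Suc m) * f X"
      by (cases "m = 0") (auto simp: mult_le_cancel_left_pos)
    then show ?thesis using X Suc.hyps(2) by (intro exI[of _ X]) auto
  qed
qed

text \<open>Sampling and rounding errors scale with the maximum of \<open>f\<close> over all sets;
  this makes them relative to the constrained optimum. As \<open>2 * k \<le> n\<close>, either
  \<open>S\<close> or its complement can be shrunk to size \<open>k\<close>, at a loss of at most a
  factor \<open>n\<close>.\<close>

lemma value_le_opt:
  assumes "1 \<le> k" "2 * k \<le> n" "S \<subseteq> {..<n}" and opt: "\<And>X. X \<subseteq> {..<n} \<Longrightarrow> card X = k \<Longrightarrow> f X \<le> M"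
  shows "f S \<le> real n * M"
proof -
  have *: "f T \<le> real n * M" if T: "T \<subseteq> {..<n}" "k \<le> card T" for T
  proof -
    obtain X where X: "X \<subseteq> T" "card X = k" "real k * f T \<le> real (card T) * f X"
      using shrink_set[OF T] by blast
    have "f X \<le> M" "0 \<le> f X" using X T opt nonneg[of X] by auto
    have "card T \<le> n" using card_mono[OF _ T(1)] by simp
    have "f T \<le> real k * f T" using assms(1) nonneg[OF T(1)] by (simp add: mult_le_cancel_right1)
    also note X(3)
    also have "real (card T) * f X \<le> real n * M"
      using \<open>card T \<le> n\<close> \<open>f X \<le> M\<close> \<open>0 \<le> f X\<close> by (intro mult_mono) auto
    finally show ?thesis .
  qed
  show ?thesis
  proof (cases "k \<le> card S")
    case True
    then show ?thesis using * assms by blast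
  next
    case False
    have "card ({..<n} - S) = n - card S"
      using assms(3) by (simp add: card_Diff_subset finite_subset[OF assms(3)])
    then have "k \<le> card ({..<n} - S)" using False assms(2) by simp
    then show ?thesis using *[of "{..<n} - S"] symm[OF assms(3)] by auto
  qed
qed


section \<open>Mixing with the constant vector 1/2\<close>

text \<open>
  Concavity on each of the blocks \<open>S \<inter> T\<close>, \<open>S - T\<close>, \<open>T - S\<close> and the rest reduces the claim to the 16 unions of
  blocks, and complementary unions have the same value.
\<close>

lemma noise_gain:
  assumes "T \<subseteq> {..<n}" "S \<subseteq> {..<n}" "0 \<le> \<mu>" "\<mu> \<le> 1"
  shows "(1 - 2 * \<mu>)^2 * f S + 2 * \<mu> * (1 - \<mu>) * f T \<le> mlext n (\<lambda>u. if u \<in> S then 1 - \<mu> else \<mu>) f"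
proof -
  define a where "a = S \<inter> T"
  define b where "b = S - T"
  define c where "c = T - S"
  define d where "d = {..<n} - S - T"
  define \<Phi> where "\<Phi> p q r s = mlext n (\<lambda>u. if u \<in> a then p else if u \<in> b then q else if u \<in> c then r else s) f"
    for p q r s :: real
  have fin: "finite a" "finite b" "finite c" "finite d"
    and sub: "a \<subseteq> {..<n}" "b \<subseteq> {..<n}" "c \<subseteq> {..<n}" "d \<subseteq> {..<n}"
    using assms(1,2) finite_subset[of _ "{..<n}"] by (auto simp: a_def b_def c_def d_def)
  note blk = mlext_block_concave[OF submod_on]
  have A: "interp p (\<lambda>i. \<Phi> i q r s) \<le> \<Phi> p q r s"
    if "0 \<le> p" "p \<le> 1" "0 \<le> q" "q \<le> 1" "0 \<le> r" "r \<le> 1" "0 \<le> s" "s \<le> 1" for p q r s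
  proof -
    have "\<Phi> x q r s = mlext n (set_on a x (\<lambda>u. if u \<in> b then q else if u \<in> c then r else s)) f" for x
      unfolding \<Phi>_def by (rule mlext_cong) (auto simp: set_on_def)
    then show ?thesis unfolding interp_def using that
      by (simp only:) (intro blk fin sub, auto simp: unit_vec_def)
  qed
  have B: "interp q (\<lambda>i. \<Phi> p i r s) \<le> \<Phi> p q r s"
    if "0 \<le> p" "p \<le> 1" "0 \<le> q" "q \<le> 1" "0 \<le> r" "r \<le> 1" "0 \<le> s" "s \<le> 1" for p q r s
  proof -
    have "\<Phi> p x r s = mlext n (set_on b x (\<lambda>u. if u \<in> a then p else if u \<in> c then r else s)) f" for x
      unfolding \<Phi>_def by (rule mlext_cong) (auto simp: set_on_def a_def b_def)
    then show ?thesis unfolding interp_def using that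
      by (simp only:) (intro blk fin sub, auto simp: unit_vec_def)
  qed
  have C: "interp r (\<lambda>i. \<Phi> p q i s) \<le> \<Phi> p q r s"
    if "0 \<le> p" "p \<le> 1" "0 \<le> q" "q \<le> 1" "0 \<le> r" "r \<le> 1" "0 \<le> s" "s \<le> 1" for p q r s
  proof -
    have "\<Phi> p q x s = mlext n (set_on c x (\<lambda>u. if u \<in> a then p else if u \<in> b then q else s)) f" for x
      unfolding \<Phi>_def by (rule mlext_cong) (auto simp: set_on_def a_def b_def c_def)
    then show ?thesis unfolding interp_def using that
      by (simp only:) (intro blk fin sub, auto simp: unit_vec_def)
  qed
  have D: "interp s (\<lambda>i. \<Phi> p q r i) \<le> \<Phi> p q r s"
    if "0 \<le> p" "p \<le> 1" "0 \<le> q" "q \<le> 1" "0 \<le> r" "r \<le> 1" "0 \<le> s" "s \<le> 1" for p q r s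
  proof -
    have "\<Phi> p q r x = mlext n (set_on d x (\<lambda>u. if u \<in> a then p else if u \<in> b then q else r)) f" for x
      unfolding \<Phi>_def by (rule mlext_cong) (auto simp: set_on_def a_def b_def c_def d_def)
    then show ?thesis unfolding interp_def using that
      by (simp only:) (intro blk fin sub, auto simp: unit_vec_def)
  qed
  have "interp (1-\<mu>) (\<lambda>i. interp (1-\<mu>) (\<lambda>j. interp \<mu> (\<lambda>k. interp \<mu> (\<lambda>l. \<Phi> i j k l))))
      \<le> interp (1-\<mu>) (\<lambda>i. interp (1-\<mu>) (\<lambda>j. interp \<mu> (\<lambda>k. \<Phi> i j k \<mu>)))"
    using assms by (intro interp_mono D) auto
  also have "\<dots> \<le> interp (1-\<mu>) (\<lambda>i. interp (1-\<mu>) (\<lambda>j. \<Phi> i j \<mu> \<mu>))"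
    using assms by (intro interp_mono C) auto
  also have "\<dots> \<le> interp (1-\<mu>) (\<lambda>i. \<Phi> i (1-\<mu>) \<mu> \<mu>)"
    using assms by (intro interp_mono B) auto
  also have "\<dots> \<le> \<Phi> (1-\<mu>) (1-\<mu>) \<mu> \<mu>"
    using assms by (intro A) auto
  also have "\<dots> = mlext n (\<lambda>u. if u \<in> S then 1 - \<mu> else \<mu>) f"
    unfolding \<Phi>_def by (rule mlext_cong) (auto simp: a_def b_def c_def)
  finally have main: "interp (1-\<mu>) (\<lambda>i. interp (1-\<mu>) (\<lambda>j. interp \<mu> (\<lambda>k. interp \<mu> (\<lambda>l. \<Phi> i j k l))))
      \<le> mlext n (\<lambda>u. if u \<in> S then 1 - \<mu> else \<mu>) f" .
  have val: "\<Phi> p q r s = f X"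
    if "X \<subseteq> {..<n}" "\<And>u. u < n \<Longrightarrow> (if u \<in> a then p else if u \<in> b then q else if u \<in> c then r else s) = (if u \<in> X then 1 else 0)"
    for p q r s X
    unfolding \<Phi>_def using that(2,1) by (rule mlext_ind_gen)
  note defs = a_def b_def c_def d_def
  have e: "\<Phi> 1 1 0 0 = f S" "\<Phi> 1 1 1 0 = f (S \<union> T)" "\<Phi> 0 1 0 0 = f (S - T)"
      "\<Phi> 1 1 0 1 = f (S \<union> ({..<n} - T))" "\<Phi> 1 0 0 0 = f (S - ({..<n} - T))" "\<Phi> 1 0 1 0 = f T"
      "\<Phi> 0 0 0 0 = f {}" "\<Phi> 0 1 1 0 = f (S - T \<union> (T - S))"
    using assms(1,2) by (intro val; auto simp: defs)+
  have val': "\<Phi> p q r s = f X"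
    if "X \<subseteq> {..<n}" "\<And>u. u < n \<Longrightarrow> (if u \<in> a then p else if u \<in> b then q else if u \<in> c then r else s) = (if u \<in> X then 0 else 1)"
    for p q r s X
  proof -
    have "\<Phi> p q r s = f ({..<n} - X)" by (rule val) (use that in auto)
    then show ?thesis using symm that by simp
  qed
  have e': "\<Phi> 0 0 1 1 = f S" "\<Phi> 0 0 0 1 = f (S \<union> T)" "\<Phi> 1 0 1 1 = f (S - T)"
      "\<Phi> 0 0 1 0 = f (S \<union> ({..<n} - T))" "\<Phi> 0 1 1 1 = f (S - ({..<n} - T))" "\<Phi> 0 1 0 1 = f T"
      "\<Phi> 1 1 1 1 = f {}" "\<Phi> 1 0 0 1 = f (S - T \<union> (T - S))"
    using assms(1,2) by (intro val'; auto simp: defs)+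
  define t where "t = \<mu> * (1 - \<mu>)"
  \<comment> \<open>The 16 product weights regrouped around the claim. What remains are nonnegative
    multiples of the posimodularity slacks for \<open>T\<close> and for its complement, of
    \<open>f {}\<close>, and of a slack for the symmetric difference of \<open>S\<close> and
    \<open>T\<close>.\<close>
  have eq: "interp (1-\<mu>) (\<lambda>i. interp (1-\<mu>) (\<lambda>j. interp \<mu> (\<lambda>k. interp \<mu> (\<lambda>l. \<Phi> i j k l))))
     = ((1 - 2 * \<mu>)^2 * f S + 2 * \<mu> * (1 - \<mu>) * f T)
     + t * (1 - 2 * t) * (f (S \<union> T) + f (S - T) - f T)
     + t * (1 - 2 * t) * (f (S \<union> ({..<n} - T)) + f (S - ({..<n} - T)) - f T)
     + 2 * t^2 * f {} + 2 * t^2 * (f S + f (S - T \<union> (T - S)) - f T)"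
    unfolding interp_def e e' t_def by algebra
  have t0: "0 \<le> t" using assms by (simp add: t_def)
  have "1 - 2 * t = \<mu>^2 + (1 - \<mu>)^2" unfolding t_def by (simp add: power2_eq_square algebra_simps)
  then have t1: "0 \<le> 1 - 2 * t" by simp
  have q1: "0 \<le> f (S \<union> T) + f (S - T) - f T" using posimodular[OF assms(1,2)] by simp
  have q2: "0 \<le> f (S \<union> ({..<n} - T)) + f (S - ({..<n} - T)) - f T"
    using posimodular[of "{..<n} - T" S] assms symm[OF assms(1)] by simp
  have "f (S \<union> (S - T \<union> (T - S))) + f (S \<inter> (S - T \<union> (T - S))) \<le> f S + f (S - T \<union> (T - S))"
    using assms by (intro submod) auto
  moreover have "S \<union> (S - T \<union> (T - S)) = S \<union> T" "S \<inter> (S - T \<union> (T - S)) = S - T" by auto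
  ultimately have q3: "0 \<le> f S + f (S - T \<union> (T - S)) - f T"
    using q1 by simp
  have "0 \<le> t * (1 - 2 * t) * (f (S \<union> T) + f (S - T) - f T)"
     "0 \<le> t * (1 - 2 * t) * (f (S \<union> ({..<n} - T)) + f (S - ({..<n} - T)) - f T)"
     "0 \<le> 2 * t^2 * f {}" "0 \<le> 2 * t^2 * (f S + f (S - T \<union> (T - S)) - f T)"
    using t0 t1 q1 q2 q3 nonneg[of "{}"] by simp_all
  then show ?thesis using main eq by linarith
qed

lemma mix_gain:
  assumes "T \<subseteq> {..<n}" "unit_vec n y" "0 \<le> \<mu>" "\<mu> \<le> 1"
  shows "(1 - 2 * \<mu>)^2 * mlext n y f + 2 * \<mu> * (1 - \<mu>) * f T
    \<le> mlext n (\<lambda>u. y u * (1 - \<mu>) + (1 - y u) * \<mu>) f"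
proof -
  have "(1 - 2 * \<mu>)^2 * mlext n y f + 2 * \<mu> * (1 - \<mu>) * f T =
      mlext n y (\<lambda>S. (1 - 2 * \<mu>)^2 * f S + 2 * \<mu> * (1 - \<mu>) * f T)"
    by (simp only: mlext_add mlext_cmult mlext_const)
  also have "\<dots> \<le> mlext n y (\<lambda>S. mlext n (\<lambda>u. if u \<in> S then 1 - \<mu> else \<mu>) f)"
    by (intro mlext_mono noise_gain assms)
  finally show ?thesis unfolding mlext_noise .
qed

text \<open>\<open>mix_gain\<close> bounds the new deficit by \<open>q = (1 - 2 * \<mu>)^2\<close>
  times the old one, because \<open>4 * \<mu> * (1 - \<mu>) = 1 - q\<close>. As
  \<open>q \<le> 1\<close>, this bound can exceed a negative deficit, hence the clipping at
  0.\<close>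

lemma mix_deficit:
  assumes "T \<subseteq> {..<n}" "unit_vec n y" "0 \<le> \<mu>" "\<mu> \<le> 1"
  shows "f T - max 0 (f T - 2 * mlext n y f) \<le> 2 * mlext n (\<lambda>u. y u * (1 - \<mu>) + (1 - y u) * \<mu>) f"
proof -
  define q where "q = (1 - 2 * \<mu>)^2"
  have "q \<le> 1" "0 \<le> q"
    using assms(3,4) unfolding q_def by (auto simp: abs_square_le_1)
  have "f T - 2 * mlext n (\<lambda>u. y u * (1 - \<mu>) + (1 - y u) * \<mu>) f \<le> q * (f T - 2 * mlext n y f)"
    using mix_gain[OF assms] unfolding q_def by (simp add: power2_eq_square algebra_simps)
  also have "\<dots> \<le> max 0 (f T - 2 * mlext n y f)"
    using \<open>q \<le> 1\<close> \<open>0 \<le> q\<close> mult_left_le_one_le[of "f T - 2 * mlext n y f" q]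
    by (smt (verit) mult_nonneg_nonpos)
  finally show ?thesis by simp
qed


section \<open>Gains of moving a fractional vector\<close>

definition add_gain :: "(nat \<Rightarrow> real) \<Rightarrow> nat \<Rightarrow> real" where
  "add_gain y u = mlext n y (\<lambda>S. f (insert u S) - f S)"

definition del_gain :: "(nat \<Rightarrow> real) \<Rightarrow> nat \<Rightarrow> real" where
  "del_gain y u = mlext n y (\<lambda>S. f (S - {u}) - f S)"

lemma sum_gains_ge:
  assumes "T \<subseteq> {..<n}" "unit_vec n y"
  shows "f T - 2 * mlext n y f \<le> (\<Sum>u\<in>T. add_gain y u + del_gain y u)"
proof -
  have "f T - 2 * mlext n y f = mlext n y (\<lambda>S. f T - 2 * f S)"
    by (simp only: mlext_diff mlext_cmult mlext_const)
  also have "\<dots> \<le> mlext n y (\<lambda>S. \<Sum>u\<in>T. (f (insert u S) - f S) + (f (S - {u}) - f S))"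
    by (intro mlext_mono sum_moves_ge assms)
  also have "\<dots> = (\<Sum>u\<in>T. add_gain y u + del_gain y u)"
    unfolding add_gain_def del_gain_def by (simp only: mlext_sum mlext_add)
  finally show ?thesis .
qed

text \<open>An average over the \<open>k\<close> elements of \<open>T\<close> is at most the maximum
  over all elements; \<open>e\<close> absorbs the imprecise choice of either maximum.\<close>

lemma best_gains_ge:
  assumes T: "T \<subseteq> {..<n}" "card T = k" "0 < k" and y: "unit_vec n y"
    and u: "\<And>x. x < n \<Longrightarrow> add_gain y x \<le> add_gain y u + e"
    and v: "\<And>x. x < n \<Longrightarrow> del_gain y x \<le> del_gain y v + e"
  shows "(f T - 2 * mlext n y f) / k - 2 * e \<le> add_gain y u + del_gain y v"
proof -
  have "f T - 2 * mlext n y f \<le> (\<Sum>x\<in>T. add_gain y x + del_gain y x)"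
    by (rule sum_gains_ge[OF T(1) y])
  also have "\<dots> \<le> (\<Sum>x\<in>T. (add_gain y u + e) + (del_gain y v + e))"
    using T u v by (intro sum_mono add_mono) auto
  also have "\<dots> = real k * (add_gain y u + del_gain y v + 2 * e)"
    using T by (simp add: algebra_simps)
  finally show ?thesis using T(3) by (simp add: field_simps)
qed

text \<open>The partial derivative in coordinate \<open>u\<close>. A move by a fraction
  \<open>1 / w\<close> of the distance to 1 or to 0 gains exactly \<open>add_gain / w\<close> or
  \<open>del_gain / w\<close>, before rounding.\<close>

definition slope :: "(nat \<Rightarrow> real) \<Rightarrow> nat \<Rightarrow> real" where
  "slope y u = mlext n y (\<lambda>S. f (insert u S)) - mlext n y (\<lambda>S. f (S - {u}))"

lemma add_gain_slope: "u < n \<Longrightarrow> add_gain y u = (1 - y u) * slope y u"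
  unfolding add_gain_def mlext_diff slope_def using mlext_split[of u n y f]
  by (simp add: algebra_simps)

lemma del_gain_slope: "u < n \<Longrightarrow> del_gain y u = - y u * slope y u"
  unfolding del_gain_def mlext_diff slope_def using mlext_split[of u n y f]
  by (simp add: algebra_simps)

lemma value_after_shift:
  assumes "u < n" "unit_vec n y" and B: "\<And>S. S \<subseteq> {..<n} \<Longrightarrow> f S \<le> B" and "\<bar>\<delta> - \<delta>'\<bar> \<le> \<eta>"
  shows "mlext n y f + \<delta> * slope y u - B * \<eta> \<le> mlext n (y(u := y u + \<delta>')) f"
proof -
  have "0 \<le> mlext n y (\<lambda>S. f (insert u S))" "mlext n y (\<lambda>S. f (insert u S)) \<le> B"
    "0 \<le> mlext n y (\<lambda>S. f (S - {u}))" "mlext n y (\<lambda>S. f (S - {u})) \<le> B"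
    using assms by (auto intro!: mlext_bounds nonneg B)
  then have "\<bar>slope y u\<bar> \<le> B" unfolding slope_def by linarith
  then have "\<bar>(\<delta> - \<delta>') * slope y u\<bar> \<le> \<eta> * B"
    unfolding abs_mult using assms(4) by (intro mult_mono) auto
  then have "\<delta> * slope y u - B * \<eta> \<le> \<delta>' * slope y u"
    by (simp add: algebra_simps abs_le_iff)
  moreover have "mlext n (y(u := y u + \<delta>')) f = mlext n y f + \<delta>' * slope y u"
    unfolding mlext_upd_diff[OF assms(1)] slope_def by simp
  ultimately show ?thesis by linarith
qed

text \<open>The deleted element is chosen at \<open>y\<close>, but the deletion happens after the
  insertion; this bounds how far its gain can drop meanwhile. Gains lie between \<open>- B\<close>
  and \<open>B\<close>, so their derivative is at least \<open>- 2 * B\<close>.\<close>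

lemma del_gain_upd:
  assumes "u < n" "v < n" "unit_vec n y" and B: "\<And>S. S \<subseteq> {..<n} \<Longrightarrow> f S \<le> B" and \<alpha>: "0 \<le> \<alpha>"
  shows "del_gain y v - 2 * B * \<alpha> \<le> del_gain (y(u := y u + \<alpha>)) v"
proof -
  define h where "h S = f (S - {v}) - f S" for S
  have h: "- B \<le> h S" "h S \<le> B" if "S \<subseteq> {..<n}" for S
  proof -
    have "S - {v} \<subseteq> {..<n}" using that by auto
    then show "- B \<le> h S" "h S \<le> B"
      using nonneg[OF that] B[OF that] nonneg[of "S - {v}"] B[of "S - {v}"] unfolding h_def by auto
  qed
  have "- B \<le> mlext n y (\<lambda>S. h (insert u S))"
    by (rule mlext_bounds(1)[OF assms(3), where b = B]) (use assms(1) in \<open>auto intro!: h\<close>)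
  moreover have "mlext n y (\<lambda>S. h (S - {u})) \<le> B"
    by (rule mlext_bounds(2)[OF assms(3), where a = "-B"]) (auto intro!: h)
  ultimately have "\<alpha> * (- 2 * B) \<le> \<alpha> * (mlext n y (\<lambda>S. h (insert u S)) - mlext n y (\<lambda>S. h (S - {u})))"
    using \<alpha> by (intro mult_left_mono) auto
  then show ?thesis
    unfolding del_gain_def h_def[symmetric] mlext_upd_diff[OF assms(1)] by (simp add: algebra_simps)
qed

text \<open>A rounding error of at most \<eta> costs \<open>B * \<eta>\<close> in either move, the
  outdated choice of \<open>v\<close> costs \<open>2 * B / w^2\<close>, and the tolerance costs
  \<open>2 * e / w\<close>. The deficit contains the value twice, which doubles all of these and
  also the relative gain \<open>1 / (k * w)\<close>.\<close>

lemma greedy_step: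
  assumes T: "T \<subseteq> {..<n}" "card T = k" "0 < k" and y: "unit_vec n y"
    and uv: "u < n" "v < n"
    and u: "\<And>x. x < n \<Longrightarrow> add_gain y x \<le> add_gain y u + e"
    and v: "\<And>x. x < n \<Longrightarrow> del_gain y x \<le> del_gain y v + e"
    and B: "\<And>S. S \<subseteq> {..<n} \<Longrightarrow> f S \<le> B" and w: "1 \<le> w"
    and \<alpha>: "0 \<le> \<alpha>" "(1 - y u) / w - \<eta> \<le> \<alpha>" "\<alpha> \<le> (1 - y u) / w"
    and y1: "y1 = y(u := y u + \<alpha>)"
    and \<beta>: "y1 v / w - \<eta> \<le> \<beta>" "\<beta> \<le> y1 v / w"
  shows "f T - 2 * mlext n (y1(v := y1 v - \<beta>)) f
    \<le> (1 - 2 / (k * w)) * (f T - 2 * mlext n y f) + (4 * e / w + 4 * B * \<eta> + 4 * B / w^2)"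
proof -
  have yu: "0 \<le> y u" "y u \<le> 1" using y uv by (auto simp: unit_vec_def)
  have B0: "0 \<le> B" using nonneg[of "{}"] B[of "{}"] by simp
  have \<alpha>1: "\<alpha> \<le> 1 / w" using \<alpha>(3) yu w by (smt (verit) divide_right_mono)
  have "(1 - y u) / w \<le> 1 - y u" using yu w by (simp add: divide_le_eq mult_le_cancel_left1)
  then have uv1: "unit_vec n y1"
    using y \<alpha>(1,3) unfolding y1 by (auto simp: unit_vec_def)
  define D where "D = f T - 2 * mlext n y f"
  have 1: "mlext n y f + add_gain y u / w - B * \<eta> \<le> mlext n y1 f"
    using value_after_shift[OF uv(1) y B, of "(1 - y u) / w" \<alpha> \<eta>] \<alpha>
    unfolding y1 add_gain_slope[OF uv(1)] by (simp add: abs_le_iff)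
  have 2: "mlext n y1 f + del_gain y1 v / w - B * \<eta> \<le> mlext n (y1(v := y1 v - \<beta>)) f"
    using value_after_shift[OF uv(2) uv1 B, of "- y1 v / w" "- \<beta>" \<eta>] \<beta>
    unfolding del_gain_slope[OF uv(2)] by (simp add: abs_le_iff)
  have "del_gain y v - 2 * B * (1 / w) \<le> del_gain y v - 2 * B * \<alpha>"
    using \<alpha>1 B0 by (intro diff_left_mono mult_left_mono) auto
  also have "\<dots> \<le> del_gain y1 v"
    unfolding y1 by (rule del_gain_upd) (use assms in auto)
  finally have "(del_gain y v - 2 * B * (1 / w)) / w \<le> del_gain y1 v / w"
    using w by (intro divide_right_mono) auto
  then have 3: "del_gain y v / w - 2 * B / w^2 \<le> del_gain y1 v / w"
    using w by (simp add: field_simps power2_eq_square)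
  have "D / k - 2 * e \<le> add_gain y u + del_gain y v"
    unfolding D_def by (rule best_gains_ge[OF T y u v])
  then have "(D / k - 2 * e) / w \<le> (add_gain y u + del_gain y v) / w"
    using w by (intro divide_right_mono) auto
  then have 4: "D / (k * w) - 2 * e / w \<le> add_gain y u / w + del_gain y v / w"
    by (simp add: diff_divide_distrib add_divide_distrib)
  have "(1 - 2 / (k * w)) * D = D - 2 * (D / (k * w))"
    by (simp add: algebra_simps)
  moreover have "f T - 2 * mlext n (y1(v := y1 v - \<beta>)) f \<le> D - 2 * (D / (k * w))
      + (2 * (2 * e / w) + 4 * (B * \<eta>) + 2 * (2 * B / w^2))"
  proof -
    have "f T = D + 2 * mlext n y f" by (simp add: D_def)
    then show ?thesis using 1 2 3 4 by linarith
  qed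
  ultimately show ?thesis
    unfolding D_def by simp
qed

end

subsection \<open>Sampling\<close>

abbreviation EE :: "'a pmf \<Rightarrow> ('a \<Rightarrow> real) \<Rightarrow> real" where
  "EE p g \<equiv> measure_pmf.expectation p g"

lemma EE_bind:
  assumes "finite (set_pmf p)" "\<And>x. x \<in> set_pmf p \<Longrightarrow> finite (set_pmf (q x))"
  shows "EE (bind_pmf p q) g = EE p (\<lambda>x. EE (q x) g)"
  using pmf_expectation_bind[of "set_pmf p" q p g] assms
  by (simp add: integral_measure_pmf[of "set_pmf p"])

lemma EE_mono:
  assumes "finite (set_pmf p)" "\<And>x. x \<in> set_pmf p \<Longrightarrow> g x \<le> h x"
  shows "EE p g \<le> EE p h"
  using assms by (intro integral_mono_AE) (auto simp: integrable_measure_pmf_finite AE_measure_pmf_iff)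

lemma EE_add:
  assumes "finite (set_pmf p)"
  shows "EE p (\<lambda>x. g x + h x) = EE p g + EE p h"
  using assms by (intro Bochner_Integration.integral_add) (auto simp: integrable_measure_pmf_finite)

text \<open>The body receives the loop index. The same combinator specifies the counting loops of
  the program, so the analysis and the program refer to one and the same process.\<close>

primrec for_pmf :: "(nat \<Rightarrow> 'a \<Rightarrow> 'a pmf) \<Rightarrow> nat \<Rightarrow> nat \<Rightarrow> 'a \<Rightarrow> 'a pmf" where
  "for_pmf b j 0 x = return_pmf x"
| "for_pmf b j (Suc m) x = bind_pmf (b j x) (for_pmf b (Suc j) m)"

text \<open>The recursion peels off the first iteration, while the multilinear extension splits off
  the last element.\<close>

lemma for_pmf_snoc: "for_pmf b j (Suc m) x = bind_pmf (for_pmf b j m x) (b (j + m))"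
proof (induction m arbitrary: j x)
  case 0
  have "for_pmf b (Suc j) 0 = return_pmf" by (rule ext) simp
  then show ?case by (simp add: bind_return_pmf bind_return_pmf')
next
  case (Suc m)
  have "for_pmf b j (Suc (Suc m)) x = bind_pmf (b j x) (\<lambda>x. for_pmf b (Suc j) (Suc m) x)"
    by (rule for_pmf.simps(2))
  also have "\<dots> = bind_pmf (b j x) (\<lambda>x. bind_pmf (for_pmf b (Suc j) m x) (b (Suc j + m)))"
    by (simp only: Suc.IH)
  also have "\<dots> = bind_pmf (for_pmf b j (Suc m) x) (b (j + Suc m))"
    by (simp add: bind_assoc_pmf)
  finally show ?case .
qed

lemma finite_for_pmf:
  assumes "\<And>i x. finite (set_pmf (b i x))"
  shows "finite (set_pmf (for_pmf b j m x))"
  by (induction m arbitrary: j x) (auto simp: assms)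

lemma for_pmf_inv:
  assumes "\<And>i x x'. j \<le> i \<Longrightarrow> i < j + m \<Longrightarrow> I i x \<Longrightarrow> x' \<in> set_pmf (b i x) \<Longrightarrow> I (Suc i) x'"
    and "I j x" "x' \<in> set_pmf (for_pmf b j m x)"
  shows "I (j + m) x'"
  using assms
proof (induction m arbitrary: j x)
  case (Suc m)
  obtain z where z: "z \<in> set_pmf (b j x)" "x' \<in> set_pmf (for_pmf b (Suc j) m z)"
    using Suc.prems(3) by auto
  have "I (Suc j) z" using Suc.prems(1)[of j] Suc.prems(2) z by auto
  have "I (Suc j + m) x'"
    by (rule Suc.IH[OF _ \<open>I (Suc j) z\<close> z(2)]) (rule Suc.prems(1); simp)
  then show ?case by simp
qed simp

text \<open>A drift argument. The potential may depend on the index, which lets it carry a moving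
  centre for the estimates and a moving target for the greedy rounds.\<close>

lemma for_pmf_potential:
  fixes \<phi> :: "nat \<Rightarrow> 'a \<Rightarrow> real"
  assumes fin: "\<And>i x. finite (set_pmf (b i x))"
    and step: "\<And>i x x'. j \<le> i \<Longrightarrow> i < j + m \<Longrightarrow> I i x \<Longrightarrow> x' \<in> set_pmf (b i x) \<Longrightarrow> I (Suc i) x'"
    and pot: "\<And>i x. j \<le> i \<Longrightarrow> i < j + m \<Longrightarrow> I i x \<Longrightarrow> EE (b i x) (\<phi> (Suc i)) \<le> \<phi> i x + e"
    and "I j x"
  shows "EE (for_pmf b j m x) (\<phi> (j + m)) \<le> \<phi> j x + real m * e"
  using assms(2-4)
proof (induction m arbitrary: j x)
  case (Suc m)
  have "EE (for_pmf b j (Suc m) x) (\<phi> (j + Suc m)) = EE (b j x) (\<lambda>z. EE (for_pmf b (Suc j) m z) (\<phi> (Suc j + m)))"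
    by (simp add: EE_bind fin finite_for_pmf)
  also have "\<dots> \<le> EE (b j x) (\<lambda>z. \<phi> (Suc j) z + real m * e)"
  proof (rule EE_mono[OF fin])
    fix z assume "z \<in> set_pmf (b j x)"
    then have z: "I (Suc j) z" using Suc.prems(1)[of j x z] Suc.prems(3) by auto
    show "EE (for_pmf b (Suc j) m z) (\<phi> (Suc j + m)) \<le> \<phi> (Suc j) z + real m * e"
    proof (rule Suc.IH[OF _ _ z])
      show "I (Suc i) x'" if "Suc j \<le> i" "i < Suc j + m" "I i x" "x' \<in> set_pmf (b i x)" for i x x'
        using Suc.prems(1)[of i x x'] that by auto
      show "EE (b i x) (\<phi> (Suc i)) \<le> \<phi> i x + e" if "Suc j \<le> i" "i < Suc j + m" "I i x" for i x
        using Suc.prems(2)[of i x] that by auto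
    qed
  qed
  also have "\<dots> = EE (b j x) (\<phi> (Suc j)) + real m * e"
    by (simp add: EE_add[OF fin])
  also have "\<dots> \<le> \<phi> j x + e + real m * e"
    using Suc.prems(2)[of j x] Suc.prems(3) by simp
  finally show ?case by (simp add: algebra_simps)
qed simp

lemma EE_threshold:
  fixes A B :: real
  assumes "m \<le> L"
  shows "EE (pmf_of_set {0..L-1}) (\<lambda>a. if a < m then A else B)
    = real m / real L * A + (1 - real m / real L) * B"
\<comment> \<open>For \<open>L = 0\<close> truncated subtraction makes the sample space
  \<open>{0}\<close>, and \<open>m\<close> is 0: the second alternative is certain, in agreement
  with division by zero.\<close>
proof (cases "L = 0")
  case True
  then show ?thesis using assms by (simp add: pmf_of_set_singleton)
next
  case False
  have "{0..L-1} = {..<L}" using False by auto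
  have *: "{..<L} \<inter> {a. a < m} = {..<m}" "{..<L} \<inter> - {a. a < m} = {m..<L}"
    using assms by auto
  have "(\<Sum>a<L. if a < m then A else B) = real m * A + (real L - real m) * B"
    using assms by (subst sum.If_cases) (auto simp: * of_nat_diff)
  then show ?thesis
    unfolding \<open>{0..L-1} = {..<L}\<close> using False
    by (subst integral_pmf_of_set) (auto simp: field_simps)
qed

definition sample_set :: "(nat \<Rightarrow> nat) \<Rightarrow> nat \<Rightarrow> nat \<Rightarrow> nat set pmf" where
  "sample_set Y Q n =
     for_pmf (\<lambda>u S. map_pmf (\<lambda>a. if a < Y u then insert u S else S) (pmf_of_set {0..Q-1})) 0 n {}"

lemma finite_sample_set [simp]: "finite (set_pmf (sample_set Y Q n))"
  unfolding sample_set_def by (rule finite_for_pmf) auto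

lemma sample_set_Suc:
  "sample_set Y Q (Suc n) = bind_pmf (sample_set Y Q n)
     (\<lambda>S. map_pmf (\<lambda>a. if a < Y n then insert n S else S) (pmf_of_set {0..Q-1}))"
  unfolding sample_set_def for_pmf_snoc by (simp only: add_0)

lemma EE_sample_set:
  assumes "\<And>u. u < n \<Longrightarrow> Y u \<le> Q"
  shows "EE (sample_set Y Q n) g = mlext n (\<lambda>u. real (Y u) / real Q) g"
  using assms
proof (induction n arbitrary: g)
  case 0
  then show ?case by (simp add: sample_set_def)
next
  case (Suc n)
  have "EE (sample_set Y Q (Suc n)) g =
    EE (sample_set Y Q n) (\<lambda>S. EE (pmf_of_set {0..Q-1}) (\<lambda>a. if a < Y n then g (insert n S) else g S))"
    unfolding sample_set_Suc by (subst EE_bind) (auto intro!: arg_cong2[of _ _ _ _ EE] simp: if_distrib)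
  also have "\<dots> = EE (sample_set Y Q n) (\<lambda>S. real (Y n) / real Q * g (insert n S) + (1 - real (Y n) / real Q) * g S)"
    by (subst EE_threshold) (use Suc.prems in auto)
  also have "\<dots> = mlext n (\<lambda>u. real (Y u) / real Q)
      (\<lambda>S. real (Y n) / real Q * g (insert n S) + (1 - real (Y n) / real Q) * g S)"
    using Suc by auto
  also have "\<dots> = mlext (Suc n) (\<lambda>u. real (Y u) / real Q) g"
    by (simp only: mlext_add mlext_cmult mlext.simps)
  finally show ?case .
qed

definition grid_vec :: "nat \<Rightarrow> (nat \<Rightarrow> nat) \<Rightarrow> nat \<Rightarrow> real" where
  "grid_vec Q Y = (\<lambda>u. real (Y u) / real Q)"

lemma unit_grid_vec: "(\<And>u. u < n \<Longrightarrow> Y u \<le> Q) \<Longrightarrow> unit_vec n (grid_vec Q Y)"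
  by (auto simp: unit_vec_def grid_vec_def divide_le_eq_1)

lemma grid_vec_upd: "grid_vec Q (Y(u := a)) = (grid_vec Q Y)(u := real a / real Q)"
  by (auto simp: grid_vec_def)

primrec arg_best :: "(nat \<Rightarrow> real) \<Rightarrow> nat \<Rightarrow> nat" where
  "arg_best g 0 = 0"
| "arg_best g (Suc m) = (if g (arg_best g m) < g m then m else arg_best g m)"

lemma arg_best_less: "0 < m \<Longrightarrow> arg_best g m < m"
  by (induction m) (auto simp: less_Suc_eq gr0_conv_Suc)

lemma arg_best_ge: "u < m \<Longrightarrow> g u \<le> g (arg_best g m)"
proof (induction m)
  case (Suc m)
  then show ?case by (cases "u = m") (auto simp: less_Suc_eq)
qed simp

section \<open>Estimating the gains by sampling\<close>

context symmetric_submodular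
begin

text \<open>Sums rather than averages, since only comparisons follow and the machine cannot divide
  reals. One sampled set serves all \<open>2 * n\<close> gains.\<close>

definition estimate :: "(nat \<Rightarrow> nat) \<Rightarrow> nat \<Rightarrow> nat \<Rightarrow> ((nat \<Rightarrow> real) \<times> (nat \<Rightarrow> real)) pmf" where
  "estimate Y Q M = for_pmf (\<lambda>r gh. map_pmf
       (\<lambda>S. (\<lambda>u. fst gh u + (f (insert u S) - f S), \<lambda>u. snd gh u + (f (S - {u}) - f S)))
       (sample_set Y Q n)) 0 M (\<lambda>_. 0, \<lambda>_. 0)"

lemma finite_estimate [simp]: "finite (set_pmf (estimate Y Q M))"
  unfolding estimate_def by (rule finite_for_pmf) auto

text \<open>Adding up the squared errors of all gains controls every coordinate at once, without a
  union bound; \<open>r\<close> is the number of samples accumulated so far.\<close>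

definition spread :: "(nat \<Rightarrow> real) \<Rightarrow> real \<Rightarrow> (nat \<Rightarrow> real) \<times> (nat \<Rightarrow> real) \<Rightarrow> real" where
  "spread y r gh = (\<Sum>u<n. (fst gh u - r * add_gain y u)^2 + (snd gh u - r * del_gain y u)^2)"

text \<open>A fresh centred term leaves no cross term and adds only its variance, which is at most
  the second moment of \<open>X\<close>.\<close>

lemma mlext_second_moment:
  assumes "unit_vec n y" and X: "\<And>S. S \<subseteq> {..<n} \<Longrightarrow> \<bar>X S\<bar> \<le> B"
  shows "mlext n y (\<lambda>S. (x + X S - mlext n y X)^2) \<le> x^2 + B^2"
proof -
  define m where "m = mlext n y X"
  have "(x + X S - m)^2 = ((x - m)^2 + 2 * (x - m) * X S) + (X S)^2" for S
    by (simp add: power2_eq_square algebra_simps)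
  then have "mlext n y (\<lambda>S. (x + X S - m)^2) = (x - m)^2 + 2 * (x - m) * m + mlext n y (\<lambda>S. (X S)^2)"
    by (simp only: mlext_add mlext_const mlext_cmult m_def)
  also have "\<dots> = x^2 - m^2 + mlext n y (\<lambda>S. (X S)^2)"
    by (simp add: power2_eq_square algebra_simps)
  also have "mlext n y (\<lambda>S. (X S)^2) \<le> B^2"
  proof (rule mlext_bounds(2)[OF assms(1), where a = 0])
    show "(X S)^2 \<le> B^2" if "S \<subseteq> {..<n}" for S
      using X[OF that] by (metis abs_ge_zero power2_abs power_mono)
  qed simp
  finally show ?thesis by (simp add: m_def) (smt (verit) zero_le_power2)
qed

lemma estimate_variance:
  assumes Y: "\<And>u. u < n \<Longrightarrow> Y u \<le> Q" and B: "\<And>S. S \<subseteq> {..<n} \<Longrightarrow> f S \<le> B"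
  shows "EE (estimate Y Q M) (spread (grid_vec Q Y) (real M)) \<le> real M * (2 * real n * B^2)"
proof -
  define y where "y = grid_vec Q Y"
  have uy: "unit_vec n y" unfolding y_def by (rule unit_grid_vec[OF Y])
  have ES: "EE (sample_set Y Q n) g = mlext n y g" for g
    unfolding y_def grid_vec_def by (rule EE_sample_set[OF Y])
  have bd: "\<bar>f (insert u S) - f S\<bar> \<le> B" "\<bar>f (S - {u}) - f S\<bar> \<le> B" if "S \<subseteq> {..<n}" "u < n" for S u
  proof -
    have "insert u S \<subseteq> {..<n}" "S - {u} \<subseteq> {..<n}" using that by auto
    then show "\<bar>f (insert u S) - f S\<bar> \<le> B" "\<bar>f (S - {u}) - f S\<bar> \<le> B"
      using nonneg[OF that(1)] B[OF that(1)] nonneg[of "insert u S"] nonneg[of "S - {u}"] B[of "insert u S"] B[of "S - {u}"]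
      by auto
  qed
  \<comment> \<open>Centred at \<open>i\<close> times the true gains after \<open>i\<close> samples,
    the spread grows per sample by at most \<open>B^2\<close> for each of the \<open>2 * n\<close>
    gains.\<close>
  have "EE (estimate Y Q M) (spread y (real (0 + M))) \<le> spread y (real 0) (\<lambda>_. 0, \<lambda>_. 0) + real M * (2 * real n * B^2)"
    unfolding estimate_def
  proof (rule for_pmf_potential[where I = "\<lambda>_ _. True" and \<phi> = "\<lambda>i. spread y (real i)"])
    fix i and gh :: "(nat \<Rightarrow> real) \<times> (nat \<Rightarrow> real)"
    let ?a = "\<lambda>u. fst gh u - real i * add_gain y u" and ?b = "\<lambda>u. snd gh u - real i * del_gain y u"
    have "EE (map_pmf (\<lambda>S. (\<lambda>u. fst gh u + (f (insert u S) - f S), \<lambda>u. snd gh u + (f (S - {u}) - f S)))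
         (sample_set Y Q n)) (spread y (real (Suc i)))
       = EE (sample_set Y Q n) (\<lambda>S. \<Sum>u<n. (?a u + (f (insert u S) - f S) - add_gain y u)^2
            + (?b u + (f (S - {u}) - f S) - del_gain y u)^2)"
      by (simp add: spread_def algebra_simps)
    also have "\<dots> = (\<Sum>u<n. mlext n y (\<lambda>S. (?a u + (f (insert u S) - f S) - add_gain y u)^2)
            + mlext n y (\<lambda>S. (?b u + (f (S - {u}) - f S) - del_gain y u)^2))"
      unfolding ES by (simp only: mlext_sum mlext_add)
    also have "\<dots> \<le> (\<Sum>u<n. ((?a u)^2 + B^2) + ((?b u)^2 + B^2))"
      unfolding add_gain_def del_gain_def
      by (intro sum_mono add_mono mlext_second_moment uy) (use bd in auto)
    also have "\<dots> = spread y (real i) gh + 2 * real n * B^2"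
      by (simp add: spread_def sum.distrib)
    finally show "EE (map_pmf (\<lambda>S. (\<lambda>u. fst gh u + (f (insert u S) - f S), \<lambda>u. snd gh u + (f (S - {u}) - f S)))
         (sample_set Y Q n)) (spread y (real (Suc i))) \<le> spread y (real i) gh + 2 * real n * B^2" .
  qed auto
  then show ?thesis by (simp add: spread_def y_def)
qed

end

subsection \<open>The greedy phase\<close>

text \<open>The inequality of arithmetic and geometric means, from \<open>1 + x \<le> exp x\<close>:
  the exponents \<open>z u / s - 1\<close> sum to at most 0.\<close>

lemma prod_le_of_mean_le:
  fixes z :: "nat \<Rightarrow> real"
  assumes "\<And>u. u < n \<Longrightarrow> 0 \<le> z u" "0 < s" "(\<Sum>u<n. z u) \<le> real n * s"
  shows "(\<Prod>u<n. z u) \<le> s ^ n"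
proof -
  have "(\<Prod>u<n. z u / s) \<le> (\<Prod>u<n. exp (z u / s - 1))"
    using assms exp_ge_add_one_self[of "z _ / s - 1"] by (intro prod_mono) auto
  also have "\<dots> = exp ((\<Sum>u<n. z u) / s - real n)"
    by (simp add: exp_sum[symmetric] sum_subtractf sum_divide_distrib)
  also have "\<dots> \<le> 1"
    using assms by (simp add: divide_le_eq mult.commute)
  finally show ?thesis
    using assms(2) by (simp add: prod_dividef divide_le_eq)
qed

lemma neg_ln_one_minus_le:
  fixes x :: real
  assumes "0 \<le> x" "x < 1"
  shows "- ln (1 - x) \<le> x / (1 - x)"
proof -
  have "ln (1 / (1 - x)) \<le> 1 / (1 - x) - 1"
    using assms by (intro ln_le_minus_one) auto
  then show ?thesis using assms by (simp add: ln_div field_simps)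
qed

lemma contraction_le_exp:
  fixes k w t :: nat
  assumes "1 \<le> k" "8 \<le> w"
  shows "(1 - 2 / (real k * real w)) ^ t \<le> exp (- (2 * real t / (real k * real w)))"
proof -
  have "8 \<le> real k * real w"
    using assms mult_mono[of 1 "real k" 8 "real w"] by simp
  then have "(1 - 2 / (real k * real w)) ^ t \<le> exp (- 2 / (real k * real w)) ^ t"
    using exp_ge_add_one_self[of "- 2 / (real k * real w)"]
    by (intro power_mono) (auto simp: divide_le_eq)
  then show ?thesis
    by (simp add: exp_of_nat_mult[symmetric] mult.commute)
qed

text \<open>Logarithms turn the last hypothesis into a lower bound of about
  \<open>- w * n * ln (1 - k / n)\<close> for \<open>t\<close>; at rate \<open>2 / (k * w)\<close>
  this produces the exponent \<open>2 * n / k\<close>. The term \<open>1 / (n * w)\<close> is the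
  gap of \<open>1 / w\<close> below \<open>k\<close> at which rounds stop, spread over
  \<open>n\<close> coordinates.\<close>

lemma stopping_bound:
  fixes n k w t :: nat
  assumes "1 \<le> k" "2 * k \<le> n" "8 \<le> w"
    and "(1 - 1 / real w) ^ t \<le> (1 - real k / real n + 1 / (real n * real w)) ^ n"
  shows "(1 - 2 / (real k * real w)) ^ t
    \<le> (1 - real k / real n) powr (2 * real n / real k) + 16 / real w"
proof -
  define c where "c = real k / real n"
  define \<eta> where "\<eta> = 1 / (real n * real w)"
  have n: "0 < n" using assms by simp
  have c: "0 < c" "c \<le> 1/2" using assms n unfolding c_def by (auto simp: field_simps)
  have \<eta>: "0 < \<eta>" using assms n by (simp add: \<eta>_def)
  have w: "8 \<le> real w" using assms by simp
  have t1: "real t * ln (1 - 1 / real w) \<le> real n * ln (1 - c + \<eta>)"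
  proof -
    have "ln ((1 - 1 / real w) ^ t) \<le> ln ((1 - c + \<eta>) ^ n)"
      using assms(4) c \<eta> w by (intro ln_mono) (auto simp: c_def \<eta>_def)
    then show ?thesis using c \<eta> w by (simp add: ln_realpow)
  qed
  have "- ln (1 - 1 / real w) \<le> (1 / real w) / (1 - 1 / real w)"
    using w by (intro neg_ln_one_minus_le) auto
  also have "\<dots> = 1 / (real w - 1)" using w by (simp add: field_simps)
  finally have "real t * (- ln (1 - 1 / real w)) \<le> real t * (1 / (real w - 1))"
    by (intro mult_left_mono) auto
  then have "real n * (- ln (1 - c + \<eta>)) \<le> real t / (real w - 1)" using t1 by simp
  then have t2: "real n * (real w - 1) * (- ln (1 - c + \<eta>)) \<le> real t"
    using w by (simp add: field_simps)
  have l: "ln (1 - c + \<eta>) \<le> ln (1 - c) + 2 * \<eta>"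
  proof -
    have "ln ((1 - c + \<eta>) / (1 - c)) \<le> (1 - c + \<eta>) / (1 - c) - 1"
      using c \<eta> by (intro ln_le_minus_one) auto
    also have "\<dots> = \<eta> / (1 - c)" using c by (simp add: field_simps)
    also have "\<dots> \<le> 2 * \<eta>" using c \<eta> by (simp add: field_simps)
    finally show ?thesis using c \<eta> by (simp add: ln_div)
  qed
  define L where "L = - ln (1 - c)"
  have L: "0 \<le> L" "L \<le> 2 * c"
  proof -
    show "0 \<le> L" using c by (simp add: L_def)
    have "L \<le> c / (1 - c)" unfolding L_def using c by (intro neg_ln_one_minus_le) auto
    also have "\<dots> \<le> 2 * c" using c by (simp add: field_simps)
    finally show "L \<le> 2 * c" .
  qed
  have "real n * (real w - 1) * (L - 2 * \<eta>) \<le> real n * (real w - 1) * (- ln (1 - c + \<eta>))"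
    using l w n unfolding L_def by (intro mult_left_mono) auto
  with t2 have t3: "real n * (real w - 1) * (L - 2 * \<eta>) \<le> real t" by simp
  \<comment> \<open>Replacing \<open>w - 1\<close> by \<open>w\<close> costs
    \<open>n * L \<le> 2 * k\<close>, and the shift \<eta> costs
    \<open>2 * n * w * \<eta> = 2\<close>, together at most \<open>4 * k\<close>; the factor
    \<open>2 / (k * w)\<close> makes this \<open>8 / w\<close>.\<close>
  have e1: "(2 * real n / real k) * L - 8 / real w \<le> 2 * real t / (real k * real w)"
  proof -
    have "real n * real w * L - 4 * real k \<le> real n * (real w - 1) * (L - 2 * \<eta>)"
    proof -
      have "real n * L \<le> 2 * real k" using L n unfolding c_def by (simp add: field_simps)
      moreover have "real n * real w * \<eta> = 1" using n w by (simp add: \<eta>_def)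
      moreover have "real n * (real w - 1) * (L - 2 * \<eta>)
          = real n * real w * L - real n * L - 2 * (real n * real w * \<eta>) + 2 * real n * \<eta>"
        by (simp add: algebra_simps)
      moreover have "0 \<le> real n * \<eta>" using n \<eta> by simp
      moreover have "1 \<le> real k" using assms by simp
      ultimately show ?thesis by linarith
    qed
    with t3 have "real n * real w * L - 4 * real k \<le> real t" by simp
    then have "(real n * real w * L - 4 * real k) * (2 / (real k * real w)) \<le> real t * (2 / (real k * real w))"
      by (intro mult_right_mono) auto
    moreover have "(real n * real w * L - 4 * real k) * (2 / (real k * real w)) = (2 * real n / real k) * L - 8 / real w"
      using assms w by (simp add: field_simps)
    ultimately show ?thesis by (simp add: mult.commute)
  qed
  have "(1 - 2 / (real k * real w)) ^ t \<le> exp (- (2 * real t / (real k * real w)))"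
    using assms by (intro contraction_le_exp) auto
  also have "\<dots> \<le> exp (8 / real w - (2 * real n / real k) * L)"
    using e1 by simp
  also have "\<dots> = exp (8 / real w) * (1 - c) powr (2 * real n / real k)"
    using c unfolding powr_def L_def by (simp add: mult_exp_exp)
  also have "\<dots> \<le> (1 + 16 / real w) * (1 - c) powr (2 * real n / real k)"
  proof (rule mult_right_mono)
    \<comment> \<open>As \<open>8 \<le> w\<close>, the exponent is at most 1 and the quadratic term
      is at most the linear one.\<close>
    have "exp (8 / real w) \<le> 1 + 8 / real w + (8 / real w)^2"
      using w by (intro exp_bound) auto
    also have "(8 / real w)^2 \<le> 8 / real w"
      using w by (simp add: power2_eq_square field_simps)
    finally show "exp (8 / real w) \<le> 1 + 16 / real w" by simp
  qed simp
  also have "\<dots> \<le> (1 - c) powr (2 * real n / real k) + 16 / real w"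
  proof -
    have "(1 - c) powr (2 * real n / real k) \<le> 1 powr (2 * real n / real k)"
      using c by (intro powr_mono2) auto
    then have "16 / real w * (1 - c) powr (2 * real n / real k) \<le> 16 / real w * 1"
      by (intro mult_left_mono) auto
    then show ?thesis by (simp add: algebra_simps)
  qed
  finally show ?thesis unfolding c_def .
qed

text \<open>For runs that stay active to the end. With \<open>k / n \<le> 1/2\<close> the number
  \<open>- ln (1 - k / n)\<close> is at most 1, so \<open>2 * n * w\<close> rounds exceed the count
  that the target calls for.\<close>

lemma final_round_bound:
  fixes n k w :: nat
  assumes "1 \<le> k" "2 * k \<le> n" "8 \<le> w"
  shows "(1 - 2 / (real k * real w)) ^ (2 * n * w) \<le> (1 - real k / real n) powr (2 * real n / real k)"
proof -
  define c where "c = real k / real n"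
  have n: "0 < n" using assms by simp
  have c: "0 < c" "c \<le> 1/2" using assms n unfolding c_def by (auto simp: field_simps)
  have "(1 - 2 / (real k * real w)) ^ (2 * n * w) \<le> exp (- (2 * real (2 * n * w) / (real k * real w)))"
    using assms by (intro contraction_le_exp) auto
  also have "\<dots> = exp (- (4 * real n / real k))"
    using assms by simp
  also have "\<dots> \<le> exp ((2 * real n / real k) * ln (1 - c))"
  proof -
    have "- ln (1 - c) \<le> c / (1 - c)" using c by (intro neg_ln_one_minus_le) auto
    also have "\<dots> \<le> 1" using c by (simp add: field_simps)
    finally have "(2 * real n / real k) * (- ln (1 - c)) \<le> (2 * real n / real k) * 1"
      by (intro mult_left_mono) auto
    moreover have "0 \<le> 2 * real n / real k" "4 * real n / real k = 2 * (2 * real n / real k)" by auto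
    ultimately have "- (4 * real n / real k) \<le> (2 * real n / real k) * ln (1 - c)" by linarith
    then show ?thesis by simp
  qed
  also have "\<dots> = (1 - c) powr (2 * real n / real k)"
    using c by (simp add: powr_def)
  finally show ?thesis unfolding c_def .
qed

section \<open>One rounded move and the product of slacks\<close>

definition move :: "nat \<Rightarrow> nat \<Rightarrow> (nat \<Rightarrow> nat) \<Rightarrow> nat \<Rightarrow> nat \<Rightarrow> nat \<Rightarrow> nat" where
  "move w Q Y u v = (let Y1 = Y(u := Y u + (Q - Y u) div w) in Y1(v := Y1 v - Y1 v div w))"

lemma move_le:
  assumes "\<And>x. x < n \<Longrightarrow> Y x \<le> Q" "x < n"
  shows "move w Q Y u v x \<le> Q"
proof -
  have "Y u + (Q - Y u) div w \<le> Q" if "Y u \<le> Q"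
    using that div_le_dividend[of "Q - Y u" w] by linarith
  then show ?thesis
    using assms(1)[OF assms(2)] unfolding move_def Let_def
    by (auto intro: le_trans[OF diff_le_self])
qed

lemma div_bounds:
  fixes a w :: nat
  assumes "0 < w" "0 < Q"
  shows "real a / real Q / real w - 1 / real Q \<le> real (a div w) / real Q"
    "real (a div w) / real Q \<le> real a / real Q / real w"
proof -
  have "real a / real w - 1 \<le> real (a div w)"
    using divide_nat_diff_div_nat_less_one[of a w] by linarith
  then have "(real a / real w - 1) / real Q \<le> real (a div w) / real Q"
    by (intro divide_right_mono) auto
  then show "real a / real Q / real w - 1 / real Q \<le> real (a div w) / real Q"
    by (simp add: diff_divide_distrib mult.commute)
  have "real (a div w) * real w \<le> real a"
    by (metis of_nat_le_iff of_nat_mult div_times_less_eq_dividend)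
  then have "real (a div w) / real Q \<le> (real a / real w) / real Q"
    using assms by (intro divide_right_mono) (auto simp: le_divide_eq)
  then show "real (a div w) / real Q \<le> real a / real Q / real w"
    by (simp add: mult.commute)
qed

text \<open>Deletions only enlarge slacks, and rounding down keeps the insertion within a fraction
  \<open>1 / w\<close> of a single slack.\<close>

lemma slack_prod_move:
  assumes Y: "\<And>x. x < n \<Longrightarrow> Y x \<le> Q" and "u < n" "0 < w" "0 < Q"
  shows "(1 - 1 / real w) * (\<Prod>x<n. 1 - grid_vec Q Y x) \<le> (\<Prod>x<n. 1 - grid_vec Q (move w Q Y u v) x)"
proof -
  define Y1 where "Y1 = Y(u := Y u + (Q - Y u) div w)"
  have m: "move w Q Y u v = Y1(v := Y1 v - Y1 v div w)"
    by (simp add: move_def Y1_def)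
  have z0: "0 \<le> 1 - grid_vec Q Y x" if "x < n" for x
    using Y[OF that] by (auto simp: grid_vec_def divide_le_eq_1)
  have z1: "(if x = u then 1 - 1 / real w else 1) * (1 - grid_vec Q Y x) \<le> 1 - grid_vec Q (move w Q Y u v) x"
    if "x < n" for x
  proof -
    have "grid_vec Q (move w Q Y u v) x \<le> grid_vec Q Y1 x"
      unfolding m grid_vec_def by (auto intro!: divide_right_mono)
    moreover have "(if x = u then 1 - 1 / real w else 1) * (1 - grid_vec Q Y x) \<le> 1 - grid_vec Q Y1 x"
    proof (cases "x = u")
      case True
      have "real ((Q - Y u) div w) / real Q \<le> real (Q - Y u) / real Q / real w"
        by (rule div_bounds(2)[OF assms(3,4)])
      also have "real (Q - Y u) / real Q = 1 - grid_vec Q Y u"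
        using Y[OF \<open>u < n\<close>] assms(4) by (simp add: grid_vec_def of_nat_diff diff_divide_distrib)
      finally have "real ((Q - Y u) div w) / real Q \<le> (1 - grid_vec Q Y u) / real w" .
      moreover have "grid_vec Q Y1 u = grid_vec Q Y u + real ((Q - Y u) div w) / real Q"
        by (simp add: Y1_def grid_vec_def add_divide_distrib)
      moreover have "(1 - 1 / real w) * (1 - grid_vec Q Y u) = (1 - grid_vec Q Y u) - (1 - grid_vec Q Y u) / real w"
        by (simp add: left_diff_distrib)
      ultimately show ?thesis using True by simp
    qed (simp add: Y1_def grid_vec_def)
    ultimately show ?thesis by linarith
  qed
  have "(1 - 1 / real w) * (\<Prod>x<n. 1 - grid_vec Q Y x)
      = (\<Prod>x<n. (if x = u then 1 - 1 / real w else 1) * (1 - grid_vec Q Y x))"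
    using assms(2) by (simp add: prod.distrib prod.delta)
  also have "\<dots> \<le> (\<Prod>x<n. 1 - grid_vec Q (move w Q Y u v) x)"
    using z0 z1 assms(3) by (intro prod_mono) auto
  finally show ?thesis .
qed

section \<open>The greedy process and its expected deficit\<close>

context symmetric_submodular
begin

text \<open>On the grid \<open>Q = w * w\<close> an insertion adds at most
  \<open>Q div w = w\<close>, so the guard keeps the total below \<open>k * Q\<close> and every
  executed move is a full one. Rounds after stopping are idle, which makes the round count
  fixed.\<close>

definition greedy_round :: "nat \<Rightarrow> nat \<Rightarrow> (nat \<Rightarrow> nat) \<Rightarrow> (nat \<Rightarrow> nat) pmf" where
  "greedy_round k w Y = (if (\<Sum>u<n. Y u) + w < k * (w * w)
     then map_pmf (\<lambda>gh. move w (w * w) Y (arg_best (fst gh) n) (arg_best (snd gh) n))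
       (estimate Y (w * w) (w * w * w))
     else return_pmf Y)"

definition greedy :: "nat \<Rightarrow> nat \<Rightarrow> (nat \<Rightarrow> nat) pmf" where
  "greedy k w = for_pmf (\<lambda>_. greedy_round k w) 0 (2 * n * w) (\<lambda>_. 0)"

lemma finite_greedy_round [simp]: "finite (set_pmf (greedy_round k w Y))"
  by (simp add: greedy_round_def)

lemma finite_greedy [simp]: "finite (set_pmf (greedy k w))"
  unfolding greedy_def by (rule finite_for_pmf) simp

text \<open>Clipped at 0 so that contraction and mixing apply to every vector, including those whose
  value already exceeds \<open>f T / 2\<close>.\<close>

definition deficit :: "nat set \<Rightarrow> nat \<Rightarrow> (nat \<Rightarrow> nat) \<Rightarrow> real" where
  "deficit T Q Y = max 0 (f T - 2 * mlext n (grid_vec Q Y) f)"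

text \<open>From \<open>0 \<le> (\<theta> * |a| - 1)^2\<close>, an error \<open>a\<close> is at most
  \<open>(\<theta> * a^2 + 1 / \<theta>) / 2\<close>. This is affine in the squared error, so the
  variance bound can be inserted after taking expectations, without tail estimates.\<close>

lemma near_best:
  assumes M: "0 < M" and \<theta>: "0 < \<theta>" and "x < n"
  shows "add_gain y x \<le> add_gain y (arg_best (fst gh) n) + (\<theta> * (spread y M gh / M^2) + 1 / \<theta>)"
    and "del_gain y x \<le> del_gain y (arg_best (snd gh) n) + (\<theta> * (spread y M gh / M^2) + 1 / \<theta>)"
proof -
  have n: "0 < n" using assms(3) by simp
  have am: "\<bar>a\<bar> \<le> (\<theta> * (s / M^2) + 1 / \<theta>) / 2" if "(M * a)^2 \<le> s" for a s
  proof -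
    have "0 \<le> (\<theta> * \<bar>a\<bar> - 1)^2" by simp
    then have "2 * \<theta> * \<bar>a\<bar> \<le> \<theta>^2 * a^2 + 1" by (simp add: power2_eq_square algebra_simps)
    then have "\<bar>a\<bar> \<le> (\<theta> * a^2 + 1 / \<theta>) / 2" using \<theta> by (simp add: field_simps power2_eq_square)
    moreover have "a^2 \<le> s / M^2" using that M by (simp add: field_simps power_mult_distrib)
    then have "\<theta> * a^2 \<le> \<theta> * (s / M^2)" using \<theta> by (intro mult_left_mono) auto
    ultimately show ?thesis by (smt (verit) divide_right_mono)
  qed
  have s: "(fst gh u - M * add_gain y u)^2 \<le> spread y M gh" "(snd gh u - M * del_gain y u)^2 \<le> spread y M gh"
    if "u < n" for u
  proof -
    have "(fst gh u - M * add_gain y u)^2 + (snd gh u - M * del_gain y u)^2 \<le> spread y M gh"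
      unfolding spread_def using that by (intro member_le_sum[of u]) auto
    then show "(fst gh u - M * add_gain y u)^2 \<le> spread y M gh" "(snd gh u - M * del_gain y u)^2 \<le> spread y M gh"
      by (smt (verit) zero_le_power2)+
  qed
  define E where "E = \<theta> * (spread y M gh / M^2) + 1 / \<theta>"
  have e1: "\<bar>fst gh u / M - add_gain y u\<bar> \<le> E / 2" if "u < n" for u
    unfolding E_def using s(1)[OF that] M by (intro am) (simp add: right_diff_distrib)
  have e2: "\<bar>snd gh u / M - del_gain y u\<bar> \<le> E / 2" if "u < n" for u
    unfolding E_def using s(2)[OF that] M by (intro am) (simp add: right_diff_distrib)
  have "fst gh x / M \<le> fst gh (arg_best (fst gh) n) / M"
    using arg_best_ge[OF assms(3)] M by (intro divide_right_mono) auto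
  then show "add_gain y x \<le> add_gain y (arg_best (fst gh) n) + (\<theta> * (spread y M gh / M^2) + 1 / \<theta>)"
    unfolding E_def[symmetric] using e1[OF assms(3)] e1[OF arg_best_less[OF n, of "fst gh"]] by linarith
  have "snd gh x / M \<le> snd gh (arg_best (snd gh) n) / M"
    using arg_best_ge[OF assms(3)] M by (intro divide_right_mono) auto
  then show "del_gain y x \<le> del_gain y (arg_best (snd gh) n) + (\<theta> * (spread y M gh / M^2) + 1 / \<theta>)"
    unfolding E_def[symmetric] using e2[OF assms(3)] e2[OF arg_best_less[OF n, of "snd gh"]] by linarith
qed

lemma deficit_move:
  assumes T: "T \<subseteq> {..<n}" "card T = k" "0 < k" and Y: "\<And>u. u < n \<Longrightarrow> Y u \<le> Q" and Q: "0 < Q"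
    and w: "2 \<le> w" and M: "0 < M" and \<theta>: "0 < \<theta>" and B: "\<And>S. S \<subseteq> {..<n} \<Longrightarrow> f S \<le> B"
  shows "deficit T Q (move w Q Y (arg_best (fst gh) n) (arg_best (snd gh) n))
    \<le> (1 - 2 / (real k * real w)) * deficit T Q Y
      + (4 / w * (\<theta> * (spread (grid_vec Q Y) M gh / M^2) + 1 / \<theta>) + 4 * B / Q + 4 * B / w^2)"
proof -
  define u where "u = arg_best (fst gh) n"
  define v where "v = arg_best (snd gh) n"
  define y where "y = grid_vec Q Y"
  define e where "e = \<theta> * (spread y M gh / M^2) + 1 / \<theta>"
  define \<alpha> where "\<alpha> = real ((Q - Y u) div w) / real Q"
  define Y1 where "Y1 = Y(u := Y u + (Q - Y u) div w)"
  have "T \<noteq> {}" using T by auto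
  then have n: "0 < n" using T(1) by (cases n) auto
  have uv: "u < n" "v < n" using n arg_best_less by (auto simp: u_def v_def)
  have y1: "grid_vec Q Y1 = y(u := y u + \<alpha>)"
    unfolding Y1_def grid_vec_upd y_def \<alpha>_def by (simp add: grid_vec_def add_divide_distrib)
  have yu: "1 - y u = real (Q - Y u) / real Q"
    using Y[OF uv(1)] Q by (simp add: y_def grid_vec_def of_nat_diff diff_divide_distrib)
  have e0: "0 \<le> e" unfolding e_def spread_def using M \<theta> by (auto intro!: sum_nonneg add_nonneg_nonneg mult_nonneg_nonneg divide_nonneg_nonneg)
  have B0: "0 \<le> B" using nonneg[of "{}"] B[of "{}"] by simp
  have "Y1 v div w \<le> Y1 v" by simp
  then have g2: "grid_vec Q (move w Q Y u v) = (y(u := y u + \<alpha>))(v := (y(u := y u + \<alpha>)) v - real (Y1 v div w) / real Q)"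
    unfolding move_def Let_def Y1_def[symmetric] grid_vec_upd y1
    by (simp add: of_nat_diff diff_divide_distrib y1[symmetric] grid_vec_def)
  have main: "f T - 2 * mlext n (grid_vec Q (move w Q Y u v)) f
    \<le> (1 - 2 / (k * real w)) * (f T - 2 * mlext n y f) + (4 * e / real w + 4 * B * (1 / real Q) + 4 * B / (real w)^2)"
    unfolding g2
  proof (rule greedy_step[where y = y and u = u and e = e and \<alpha> = \<alpha>, OF T _ uv])
    show "unit_vec n y" unfolding y_def by (rule unit_grid_vec[OF Y])
    show "add_gain y x \<le> add_gain y u + e" if "x < n" for x
      unfolding u_def e_def by (rule near_best(1)[OF M \<theta> that])
    show "del_gain y x \<le> del_gain y v + e" if "x < n" for x
      unfolding v_def e_def by (rule near_best(2)[OF M \<theta> that])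
    show "(1 - y u) / real w - 1 / real Q \<le> \<alpha>" "\<alpha> \<le> (1 - y u) / real w"
      unfolding yu \<alpha>_def using div_bounds[of w Q "Q - Y u"] Q w by auto
    show "(y(u := y u + \<alpha>)) v / real w - 1 / real Q \<le> real (Y1 v div w) / real Q"
      "real (Y1 v div w) / real Q \<le> (y(u := y u + \<alpha>)) v / real w"
      unfolding y1[symmetric] unfolding grid_vec_def using div_bounds[of w Q "Y1 v"] Q w by auto
  qed (use w B in \<open>auto simp: \<alpha>_def\<close>)
  have "2 \<le> real k * real w" using T(3) w mult_mono[of 1 "real k" 2 "real w"] by simp
  then have r: "0 \<le> 1 - 2 / (real k * real w)" by (simp add: divide_le_eq)
  have "(1 - 2 / (k * real w)) * (f T - 2 * mlext n y f) \<le> (1 - 2 / (real k * real w)) * deficit T Q Y"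
    using r unfolding deficit_def y_def by (intro mult_left_mono) auto
  \<comment> \<open>Both parts of the right-hand side are nonnegative, so the bound survives the
    clipping.\<close>
  moreover have "0 \<le> (1 - 2 / (real k * real w)) * deficit T Q Y"
    using r unfolding deficit_def by auto
  moreover have "0 \<le> 4 * e / real w + 4 * B * (1 / real Q) + 4 * B / (real w)^2"
    using e0 B0 by auto
  ultimately show ?thesis
    using main unfolding u_def[symmetric] v_def[symmetric] y_def[symmetric] e_def[symmetric]
    by (subst deficit_def) (auto simp: max_def)
qed

lemma spread_nonneg: "0 \<le> spread y M gh"
  unfolding spread_def by (intro sum_nonneg add_nonneg_nonneg) auto

lemma sum_move_le:
  assumes "\<And>x. x < n \<Longrightarrow> Y x \<le> w * w" "u < n" "0 < w"
  shows "(\<Sum>x<n. move w (w * w) Y u v x) \<le> (\<Sum>x<n. Y x) + w"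
proof -
  define a where "a = (w * w - Y u) div w"
  have "a \<le> w * w div w" unfolding a_def by (intro div_le_mono) simp
  then have a: "a \<le> w" using assms(3) by simp
  have "(\<Sum>x<n. move w (w * w) Y u v x) \<le> (\<Sum>x<n. Y x + (if x = u then a else 0))"
    unfolding move_def Let_def a_def by (intro sum_mono) auto
  also have "\<dots> = (\<Sum>x<n. Y x) + a" using assms(2) by (simp add: sum.distrib)
  finally show ?thesis using a by simp
qed

text \<open>The alternative 0 accounts for \<open>k = 0\<close>, where the guard never holds. The
  strict bound keeps the denominator used for mixing positive.\<close>

lemma greedy_support:
  assumes "Y \<in> set_pmf (greedy k w)" "0 < w" "0 < n"
  shows "\<forall>u<n. Y u \<le> w * w" and "(\<Sum>u<n. Y u) = 0 \<or> (\<Sum>u<n. Y u) < k * (w * w)"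
proof -
  have "(\<forall>u<n. Y u \<le> w * w) \<and> ((\<Sum>u<n. Y u) = 0 \<or> (\<Sum>u<n. Y u) < k * (w * w))"
    using assms(1) unfolding greedy_def
  proof (rule for_pmf_inv[where I = "\<lambda>_ Y. (\<forall>u<n. Y u \<le> w * w) \<and> ((\<Sum>u<n. Y u) = 0 \<or> (\<Sum>u<n. Y u) < k * (w * w))", rotated 2])
    fix Y Z :: "nat \<Rightarrow> nat"
    assume I: "(\<forall>u<n. Y u \<le> w * w) \<and> ((\<Sum>u<n. Y u) = 0 \<or> (\<Sum>u<n. Y u) < k * (w * w))"
      and Z: "Z \<in> set_pmf (greedy_round k w Y)"
    show "(\<forall>u<n. Z u \<le> w * w) \<and> ((\<Sum>u<n. Z u) = 0 \<or> (\<Sum>u<n. Z u) < k * (w * w))"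
    proof (cases "(\<Sum>u<n. Y u) + w < k * (w * w)")
      case True
      then obtain gh where gh: "Z = move w (w * w) Y (arg_best (fst gh) n) (arg_best (snd gh) n)"
        using Z by (auto simp: greedy_round_def)
      have "(\<Sum>u<n. Z u) \<le> (\<Sum>u<n. Y u) + w"
        unfolding gh using I assms arg_best_less by (intro sum_move_le) auto
      moreover have "Z u \<le> w * w" if "u < n" for u
        unfolding gh using I that by (intro move_le[of n]) auto
      ultimately show ?thesis using True by auto
    next
      case False
      then show ?thesis using I Z by (simp add: greedy_round_def)
    qed
  qed auto
  then show "\<forall>u<n. Y u \<le> w * w" and "(\<Sum>u<n. Y u) = 0 \<or> (\<Sum>u<n. Y u) < k * (w * w)"
    by auto
qed

text \<open>The constant 56 consists of 16 from \<open>stopping_bound\<close>, as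
  \<open>n \<le> w\<close>, and 40 from \<open>2 * n * w\<close> rounds with error
  \<open>20 * n * f T / w^2\<close> each.\<close>

lemma greedy_deficit:
  assumes T: "T \<subseteq> {..<n}" "card T = k" and k: "1 \<le> k" "2 * k \<le> n"
    and opt: "\<And>X. X \<subseteq> {..<n} \<Longrightarrow> card X = k \<Longrightarrow> f X \<le> f T"
    and w: "w = n ^ 3"
  shows "EE (greedy k w) (deficit T (w * w))
    \<le> ((1 - real k / real n) powr (2 * real n / real k) + 56 / real n) * f T"
proof -
  define B where "B = real n * f T"
  define X where "X = (1 - real k / real n) powr (2 * real n / real k) + 16 / real w"
  define \<rho> where "\<rho> = 1 - 2 / (real k * real w)"
  define Q where "Q = w * w"
  have n: "2 \<le> n" using k by simp
  have w8: "8 \<le> w" unfolding w using power_mono[OF n, of 3] by simp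
  have wn: "real n * real n * real n = real w" unfolding w by (simp add: power3_eq_cube)
  have "n \<le> w" unfolding w using n by (simp add: self_le_power)
  have Q: "0 < Q" "real Q = real w * real w" using w8 by (auto simp: Q_def)
  have B: "f S \<le> B" if "S \<subseteq> {..<n}" for S
    unfolding B_def using value_le_opt[OF k that opt] .
  have fT: "0 \<le> f T" by (rule nonneg[OF T(1)])
  have X0: "0 \<le> X" by (simp add: X_def)
  have XX: "X * f T + real (2 * n * w) * (20 * real n * f T / (real w)^2)
      \<le> ((1 - real k / real n) powr (2 * real n / real k) + 56 / real n) * f T"
  proof -
    have "16 / real w \<le> 16 / real n" using \<open>n \<le> w\<close> n by (simp add: frac_le)
    then have "X * f T \<le> ((1 - real k / real n) powr (2 * real n / real k) + 16 / real n) * f T"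
      unfolding X_def using fT by (intro mult_right_mono) auto
    moreover have "real (2 * n * w) * (20 * real n * f T / (real w)^2) = 40 / real n * f T"
      using n wn[symmetric] by (simp add: field_simps power2_eq_square)
    ultimately show ?thesis by (simp add: algebra_simps)
  qed
  show ?thesis
  \<comment> \<open>Treated apart because \<theta> divides by \<open>f T\<close>.\<close>
  proof (cases "f T = 0")
    case True
    have z: "deficit T Q Y = 0" if "Y \<in> set_pmf (greedy k w)" for Y
    proof -
      have "\<forall>u<n. Y u \<le> Q" unfolding Q_def using greedy_support(1)[OF that] w8 n by simp
      then have "0 \<le> mlext n (grid_vec Q Y) f"
        using nonneg B by (intro mlext_bounds(1)[where b = B] unit_grid_vec) auto
      then show ?thesis by (simp add: deficit_def True)
    qed
    have "EE (greedy k w) (deficit T Q) \<le> EE (greedy k w) (\<lambda>_. 0)"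
      by (rule EE_mono) (auto simp: z)
    then show ?thesis by (simp add: True Q_def)
  next
    case False
    then have fT: "0 < f T" using fT by simp
    \<comment> \<open>Balances the two parts of the sampling error: the expectation of
      \<open>\<theta> * spread / M^2\<close> and \<open>1 / \<theta>\<close> are then both of order
      \<open>f T / w\<close>.\<close>
    define \<theta> where "\<theta> = real w / f T"
    have \<theta>: "0 < \<theta>" using fT w8 by (simp add: \<theta>_def)
    define M where "M = w * w * w"
    have M: "0 < real M" "real M = real w * real w * real w" using w8 by (auto simp: M_def)
    have \<rho>: "0 \<le> \<rho>" "\<rho> \<le> 1"
    proof -
      have "8 \<le> real k * real w" using k w8 mult_mono[of 1 "real k" 8 "real w"] by simp
      then show "0 \<le> \<rho>" "\<rho> \<le> 1" unfolding \<rho>_def by (auto simp: divide_le_eq)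
    qed
    define active where "active Y \<longleftrightarrow> (\<Sum>u<n. Y u) + w < k * Q" for Y :: "nat \<Rightarrow> nat"
    \<comment> \<open>Only the excess over the target \<open>X\<close> is counted, hence a path may stop as soon as \<open>\<rho> ^ t \<le> X\<close>.\<close>
    define \<phi> where "\<phi> t Y = max 0 (deficit T Q Y - max (\<rho> ^ t) X * f T)" for t Y
    \<comment> \<open>The slack bound carries a run until it goes idle, at which moment its
      contraction has reached \<open>X\<close> for good.\<close>
    define I where "I t Y \<longleftrightarrow> (\<forall>u<n. Y u \<le> Q) \<and>
      ((1 - 1 / real w) ^ t \<le> (\<Prod>u<n. 1 - grid_vec Q Y u) \<or> \<rho> ^ t \<le> X \<and> \<not> active Y)" for t Y
    \<comment> \<open>An idle vector has coordinate sum at least \<open>k - 1 / w\<close>, so its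
      mean slack is at most \<open>s\<close>; the slack product then forces \<open>t\<close> to be
      large enough for \<open>stopping_bound\<close>.\<close>
    have stop: "\<rho> ^ t \<le> X" if I: "I t Y" and na: "\<not> active Y" for t Y
    proof (rule disjE)
      show "(1 - 1 / real w) ^ t \<le> (\<Prod>u<n. 1 - grid_vec Q Y u) \<or> \<rho> ^ t \<le> X"
        using I by (auto simp: I_def)
    next
      assume a: "(1 - 1 / real w) ^ t \<le> (\<Prod>u<n. 1 - grid_vec Q Y u)"
      define s where "s = 1 - real k / real n + 1 / (real n * real w)"
      have "real k / real n < 1" using k n by simp
      then have s0: "0 < s" unfolding s_def using n w8 by (intro add_pos_pos) auto
      have "(\<Prod>u<n. 1 - grid_vec Q Y u) \<le> s ^ n"
      proof (rule prod_le_of_mean_le[OF _ s0])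
        show "0 \<le> 1 - grid_vec Q Y u" if "u < n" for u
          using I that by (auto simp: I_def grid_vec_def divide_le_eq_1)
        have "real k * real Q \<le> real (\<Sum>u<n. Y u) + real w"
          using na unfolding active_def by (metis not_less of_nat_add of_nat_le_iff of_nat_mult)
        then have "real k * real Q / real Q \<le> (real (\<Sum>u<n. Y u) + real w) / real Q"
          by (intro divide_right_mono) auto
        then have "real k \<le> (\<Sum>u<n. grid_vec Q Y u) + 1 / real w"
          using Q w8 by (simp add: grid_vec_def add_divide_distrib sum_divide_distrib[symmetric])
        moreover have "real n * s = real n - real k + 1 / real w"
          using n w8 unfolding s_def by (simp add: field_simps)
        ultimately show "(\<Sum>u<n. 1 - grid_vec Q Y u) \<le> real n * s"
          by (simp add: sum_subtractf)
      qed
      with a have "(1 - 1 / real w) ^ t \<le> s ^ n" by simp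
      then show ?thesis
        unfolding \<rho>_def X_def s_def by (rule stopping_bound[OF k w8])
    qed
    have "EE (for_pmf (\<lambda>_. greedy_round k w) 0 (2 * n * w) (\<lambda>_. 0)) (\<phi> (0 + 2 * n * w))
        \<le> \<phi> 0 (\<lambda>_. 0) + real (2 * n * w) * (20 * real n * f T / (real w)^2)"
    proof (rule for_pmf_potential[where I = I])
      show "I 0 (\<lambda>_. 0)" by (simp add: I_def grid_vec_def)
    next
      fix t Y Z
      assume I: "I t Y" and Z: "Z \<in> set_pmf (greedy_round k w Y)"
      show "I (Suc t) Z"
      proof (cases "active Y")
        case True
        then obtain gh where gh: "Z = move w Q Y (arg_best (fst gh) n) (arg_best (snd gh) n)"
          using Z by (auto simp: greedy_round_def active_def Q_def)
        have YQ: "\<forall>u<n. Y u \<le> Q" and P: "(1 - 1 / real w) ^ t \<le> (\<Prod>u<n. 1 - grid_vec Q Y u)"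
          using I True by (auto simp: I_def)
        have "(1 - 1 / real w) ^ Suc t \<le> (1 - 1 / real w) * (\<Prod>u<n. 1 - grid_vec Q Y u)"
          using P w8 by (simp add: mult_left_mono)
        also have "\<dots> \<le> (\<Prod>u<n. 1 - grid_vec Q Z u)"
          unfolding gh using YQ w8 Q n arg_best_less by (intro slack_prod_move) auto
        finally have "(1 - 1 / real w) ^ Suc t \<le> (\<Prod>u<n. 1 - grid_vec Q Z u)" .
        moreover have "Z u \<le> Q" if "u < n" for u
          unfolding gh using YQ that by (intro move_le[of n]) auto
        ultimately show ?thesis by (simp add: I_def)
      next
        case False
        then have "Z = Y" using Z by (auto simp: greedy_round_def active_def Q_def)
        moreover have "\<rho> ^ Suc t \<le> X"
          using stop[OF I False] \<rho> power_Suc_le_self power_decreasing[of t "Suc t" \<rho>] by linarith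
        ultimately show ?thesis using I False by (simp add: I_def)
      qed
    next
      fix t Y
      assume I: "I t Y"
      show "EE (greedy_round k w Y) (\<phi> (Suc t)) \<le> \<phi> t Y + 20 * real n * f T / (real w)^2"
      proof (cases "active Y")
        case False
        then have "greedy_round k w Y = return_pmf Y"
          by (auto simp: greedy_round_def active_def Q_def)
        moreover have "\<rho> ^ t \<le> X" using stop[OF I False] .
        moreover have "\<rho> ^ Suc t \<le> X"
          using stop[OF I False] \<rho> power_decreasing[of t "Suc t" \<rho>] by linarith
        ultimately show ?thesis using fT by (simp add: \<phi>_def max_absorb2)
      next
        case True
        define y where "y = grid_vec Q Y"
        define err where "err gh = 4 / real w * (\<theta> * (spread y (real M) gh / (real M)^2) + 1 / \<theta>)
            + 4 * B / real Q + 4 * B / (real w)^2" for gh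
        have YQ: "Y u \<le> Q" if "u < n" for u using I that by (simp add: I_def)
        have gr: "greedy_round k w Y = map_pmf (\<lambda>gh. move w Q Y (arg_best (fst gh) n) (arg_best (snd gh) n)) (estimate Y Q M)"
          using True by (simp add: greedy_round_def active_def Q_def M_def)
        have pw: "\<phi> (Suc t) (move w Q Y (arg_best (fst gh) n) (arg_best (snd gh) n)) \<le> \<phi> t Y + err gh" for gh
        proof -
          have 1: "deficit T Q (move w Q Y (arg_best (fst gh) n) (arg_best (snd gh) n)) \<le> \<rho> * deficit T Q Y + err gh"
            unfolding \<rho>_def err_def y_def
            by (rule deficit_move) (use T k YQ Q w8 M \<theta> B in auto)
          \<comment> \<open>The target contracts no faster than the deficit, so the excess grows
            only by the error.\<close>
          have "\<rho> * max (\<rho> ^ t) X \<le> max (\<rho> ^ Suc t) X"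
            using \<rho> X0 mult_left_le_one_le[of X \<rho>] by (auto simp: max_def)
          then have 2: "\<rho> * max (\<rho> ^ t) X * f T \<le> max (\<rho> ^ Suc t) X * f T"
            using fT by (intro mult_right_mono) auto
          have "\<rho> * deficit T Q Y - \<rho> * max (\<rho> ^ t) X * f T = \<rho> * (deficit T Q Y - max (\<rho> ^ t) X * f T)"
            by (simp add: algebra_simps)
          also have "\<dots> \<le> \<rho> * \<phi> t Y"
            using \<rho> unfolding \<phi>_def by (intro mult_left_mono) auto
          also have "\<dots> \<le> \<phi> t Y"
            using \<rho> by (intro mult_left_le_one_le) (auto simp: \<phi>_def)
          finally have 3: "\<rho> * deficit T Q Y - \<rho> * max (\<rho> ^ t) X * f T \<le> \<phi> t Y" .
          have "0 \<le> err gh" unfolding err_def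
            using \<theta> spread_nonneg[of y "real M" gh] B[of "{}"] nonneg[of "{}"] by auto
          moreover have "0 \<le> \<phi> t Y" by (simp add: \<phi>_def)
          ultimately show ?thesis using 1 2 3 unfolding \<phi>_def[of "Suc t"] by simp
        qed
        have "EE (greedy_round k w Y) (\<phi> (Suc t)) \<le> EE (estimate Y Q M) (\<lambda>gh. \<phi> t Y + err gh)"
          unfolding gr integral_map_pmf by (intro EE_mono pw) simp
        also have "\<dots> = \<phi> t Y + EE (estimate Y Q M) err"
          by (simp add: EE_add)
        \<comment> \<open>In units of \<open>f T / w^2\<close> the errors are 8 from the variance, 4
          from \<open>1 / \<theta>\<close>, and \<open>4 * n\<close> each from rounding and from the
          outdated deletion; \<open>12 + 8 * n \<le> 20 * n\<close>.\<close>
        also have "EE (estimate Y Q M) err \<le> 20 * real n * f T / (real w)^2"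
        proof -
          have "err = (\<lambda>gh. (4 / real w * \<theta> / (real M)^2) * spread y (real M) gh
              + (4 / real w / \<theta> + 4 * B / real Q + 4 * B / (real w)^2))"
            by (rule ext) (simp add: err_def algebra_simps)
          then have "EE (estimate Y Q M) err = (4 / real w * \<theta> / (real M)^2) * EE (estimate Y Q M) (spread y (real M))
              + (4 / real w / \<theta> + 4 * B / real Q + 4 * B / (real w)^2)"
            by (simp add: EE_add)
          also have "EE (estimate Y Q M) (spread y (real M)) \<le> real M * (2 * real n * B^2)"
            unfolding y_def by (rule estimate_variance[OF YQ B])
          then have "(4 / real w * \<theta> / (real M)^2) * EE (estimate Y Q M) (spread y (real M))
              \<le> (4 / real w * \<theta> / (real M)^2) * (real M * (2 * real n * B^2))"
            using \<theta> by (intro mult_left_mono) auto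
          also have "\<dots> = 8 * (real n * real n * real n) * f T / (real w * real w * real w)"
            using fT w8 unfolding \<theta>_def M B_def by (simp add: field_simps power2_eq_square)
          also have "\<dots> = 8 * f T / (real w)^2"
            unfolding wn using w8 by (simp add: power2_eq_square)
          also have "4 / real w / \<theta> = 4 * f T / (real w)^2"
            using w8 by (simp add: \<theta>_def power2_eq_square)
          also have "4 * B / real Q = 4 * real n * f T / (real w)^2"
            by (simp add: B_def Q power2_eq_square)
          also have "4 * B / (real w)^2 = 4 * real n * f T / (real w)^2"
            by (simp add: B_def)
          also have "8 * f T / (real w)^2 + (4 * f T / (real w)^2 + 4 * real n * f T / (real w)^2 + 4 * real n * f T / (real w)^2)
              = (12 * f T + 8 * (real n * f T)) / (real w)^2"
            by (simp add: add_divide_distrib[symmetric])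
          also have "\<dots> \<le> 20 * real n * f T / (real w)^2"
          proof (rule divide_right_mono)
            have "1 * f T \<le> real n * f T" using n fT by (intro mult_right_mono) auto
            then show "12 * f T + 8 * (real n * f T) \<le> 20 * real n * f T" by simp
          qed simp
          finally show ?thesis by simp
        qed
        finally show ?thesis by simp
      qed
    qed simp
    moreover have "\<phi> 0 (\<lambda>_. 0) = 0"
    proof -
      have "0 \<le> mlext n (grid_vec Q (\<lambda>_. 0)) f"
        using nonneg B by (intro mlext_bounds(1)[where b = B] unit_grid_vec) auto
      then have "deficit T Q (\<lambda>_. 0) \<le> 1 * f T" using fT by (simp add: deficit_def)
      also have "\<dots> \<le> max (\<rho> ^ 0) X * f T" using fT by (intro mult_right_mono) auto
      finally show ?thesis by (simp add: \<phi>_def)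
    qed
    ultimately have E: "EE (greedy k w) (\<phi> (2 * n * w)) \<le> real (2 * n * w) * (20 * real n * f T / (real w)^2)"
      by (simp add: greedy_def)
    \<comment> \<open>After the last round, runs that never went idle have reached the target as
      well.\<close>
    have "\<rho> ^ (2 * n * w) \<le> X"
      using final_round_bound[OF k w8] unfolding \<rho>_def X_def
      by (smt (verit) divide_nonneg_nonneg of_nat_0_le_iff)
    then have "deficit T Q Y \<le> X * f T + \<phi> (2 * n * w) Y" for Y
      by (simp add: \<phi>_def max_absorb2)
    then have "EE (greedy k w) (deficit T Q) \<le> EE (greedy k w) (\<lambda>Y. X * f T + \<phi> (2 * n * w) Y)"
      by (intro EE_mono) auto
    also have "\<dots> = X * f T + EE (greedy k w) (\<phi> (2 * n * w))"
      by (simp add: EE_add)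
    finally show ?thesis using E XX by (simp add: Q_def)
  qed
qed

end

subsection \<open>Mixing and rounding\<close>

text \<open>
  With \<open>p\<close> and \<open>d\<close> as below, \<open>mix_num / mix_den = (1 - 2\<mu>) y + \<mu>\<close> for \<open>\<mu> = p / (2 d)\<close>; the truncated
  subtractions are exact because the coordinate sum is at most \<open>k Q\<close> and \<open>2 k \<le> n\<close>.
\<close>

definition mix_num :: "nat \<Rightarrow> nat \<Rightarrow> nat \<Rightarrow> (nat \<Rightarrow> nat) \<Rightarrow> nat \<Rightarrow> nat" where
  "mix_num n k Q Y = (let p = 2 * (k * Q - (\<Sum>u<n. Y u)); d = n * Q - 2 * (\<Sum>u<n. Y u) in
     (\<lambda>u. 2 * (d - p) * Y u + p * Q))"

definition mix_den :: "nat \<Rightarrow> nat \<Rightarrow> (nat \<Rightarrow> nat) \<Rightarrow> nat" where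
  "mix_den n Q Y = 2 * (n * Q - 2 * (\<Sum>u<n. Y u)) * Q"

text \<open>For the coordinate total \<open>s\<close>, \<mu> solves
  \<open>(1 - 2 * \<mu>) * s / Q + n * \<mu> = k\<close>, that is
  \<open>\<mu> = (k * Q - s) / (n * Q - 2 * s)\<close>, and \<open>2 * k \<le> n\<close> makes it at
  most 1/2. The strict bound in \<open>tot\<close> keeps \<open>d\<close> positive when
  \<open>2 * k = n\<close>.\<close>

lemma mix:
  fixes n k Q :: nat and Y :: "nat \<Rightarrow> nat"
  assumes Y: "\<And>u. u < n \<Longrightarrow> Y u \<le> Q" and Q: "0 < Q" and k: "2 * k \<le> n" and n: "0 < n"
    and tot: "(\<Sum>u<n. Y u) = 0 \<or> (\<Sum>u<n. Y u) < k * Q"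
  shows mix_den_pos: "0 < mix_den n Q Y"
    and mix_num_le: "u < n \<Longrightarrow> mix_num n k Q Y u \<le> mix_den n Q Y"
    and sum_mix_num: "(\<Sum>u<n. mix_num n k Q Y u) = k * mix_den n Q Y"
    and mix_grid_vec: "\<exists>\<mu>. 0 \<le> \<mu> \<and> \<mu> \<le> 1 \<and> grid_vec (mix_den n Q Y) (mix_num n k Q Y)
      = (\<lambda>u. grid_vec Q Y u * (1 - \<mu>) + (1 - grid_vec Q Y u) * \<mu>)"
proof -
  define s where "s = (\<Sum>u<n. Y u)"
  define p where "p = 2 * (k * Q - s)"
  define d where "d = n * Q - 2 * s"
  have kn: "2 * (k * Q) \<le> n * Q" using k by (metis mult.assoc mult_le_mono1)
  have s: "s \<le> k * Q" using tot by (auto simp: s_def)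
  have nQ: "0 < n * Q" using n Q by simp
  have "2 * s < n * Q" using tot kn nQ unfolding s_def[symmetric] by linarith
  then have d0: "0 < d" unfolding d_def by simp
  have pd: "p \<le> d" using kn s unfolding p_def d_def by linarith
  have dp: "d - p = n * Q - 2 * (k * Q)" using s kn unfolding p_def d_def by linarith
  have num: "mix_num n k Q Y u = 2 * (d - p) * Y u + p * Q" for u
    by (simp add: mix_num_def Let_def s_def d_def p_def)
  have den: "mix_den n Q Y = 2 * d * Q" by (simp add: mix_den_def s_def d_def)
  show "0 < mix_den n Q Y" unfolding den using d0 Q by simp
  show "mix_num n k Q Y u \<le> mix_den n Q Y" if "u < n"
  proof -
    have "2 * (d - p) * Y u + p * Q \<le> 2 * (d - p) * Q + 2 * p * Q"
      using Y[OF that] by (intro add_mono mult_le_mono) auto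
    also have "\<dots> = 2 * d * Q" using pd by (simp add: algebra_simps)
    finally show ?thesis unfolding num den .
  qed
  have "(\<Sum>u<n. mix_num n k Q Y u) = 2 * (d - p) * s + n * (p * Q)"
    unfolding num s_def by (simp add: sum.distrib sum_distrib_left)
  also have "\<dots> = k * (2 * d * Q)"
  proof -
    have "int (2 * (d - p) * s + n * (p * Q)) = int (k * (2 * d * Q))"
    proof -
      have 1: "int (d - p) = int n * int Q - 2 * (int k * int Q)" unfolding dp using kn by (simp add: of_nat_diff)
      have 2: "int p = 2 * (int k * int Q - int s)" unfolding p_def using s by (simp add: of_nat_diff)
      have 3: "int d = int n * int Q - 2 * int s" unfolding d_def using \<open>2 * s < n * Q\<close> by (simp add: of_nat_diff)
      show ?thesis unfolding of_nat_add of_nat_mult 1 2 3 by (simp add: algebra_simps)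
    qed
    then show ?thesis by (simp only: of_nat_eq_iff)
  qed
  finally show "(\<Sum>u<n. mix_num n k Q Y u) = k * mix_den n Q Y" unfolding den .
  show "\<exists>\<mu>. 0 \<le> \<mu> \<and> \<mu> \<le> 1 \<and> grid_vec (mix_den n Q Y) (mix_num n k Q Y)
      = (\<lambda>u. grid_vec Q Y u * (1 - \<mu>) + (1 - grid_vec Q Y u) * \<mu>)"
  proof (intro exI conjI ext)
    show "0 \<le> real p / (2 * real d)" by simp
    show "real p / (2 * real d) \<le> 1" using pd d0 by (simp add: divide_le_eq)
    fix u
    have "grid_vec (mix_den n Q Y) (mix_num n k Q Y) u = (2 * (real d - real p) * real (Y u) + real p * real Q) / (2 * real d * real Q)"
      unfolding grid_vec_def num den using pd by (simp add: of_nat_diff)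
    also have "\<dots> = grid_vec Q Y u * (1 - real p / (2 * real d)) + (1 - grid_vec Q Y u) * (real p / (2 * real d))"
      using d0 Q unfolding grid_vec_def by (simp add: field_simps)
    finally show "grid_vec (mix_den n Q Y) (mix_num n k Q Y) u
      = grid_vec Q Y u * (1 - real p / (2 * real d)) + (1 - grid_vec Q Y u) * (real p / (2 * real d))" .
  qed
qed

section \<open>Pipage rounding\<close>

text \<open>
  Shifts mass between \<open>c\<close> and \<open>v\<close> until one of them is integral; \<open>c\<close> is then the other one. For \<open>t = 0\<close> and
  \<open>t = 2 Q\<close> the sample space is \<open>{0}\<close> and the second alternative is taken.
\<close>

definition pipage_step :: "nat \<Rightarrow> nat \<Rightarrow> (nat \<Rightarrow> nat) \<times> nat \<Rightarrow> ((nat \<Rightarrow> nat) \<times> nat) pmf" where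
  "pipage_step Q v x = (let Y = fst x; c = snd x; t = Y c + Y v in
     if t \<le> Q
     then map_pmf (\<lambda>a. if a < Y c then (Y(c := t, v := 0), c) else (Y(c := 0, v := t), v))
       (pmf_of_set {0..t - 1})
     else map_pmf (\<lambda>a. if a < Q - Y v then (Y(c := Q, v := t - Q), v) else (Y(c := t - Q, v := Q), c))
       (pmf_of_set {0..2 * Q - t - 1}))"

definition pipage :: "nat \<Rightarrow> nat \<Rightarrow> (nat \<Rightarrow> nat) \<Rightarrow> ((nat \<Rightarrow> nat) \<times> nat) pmf" where
  "pipage n Q Y = for_pmf (\<lambda>i. pipage_step Q (Suc i)) 0 (n - 1) (Y, 0)"

lemma finite_pipage_step [simp]: "finite (set_pmf (pipage_step Q v x))"
  by (simp add: pipage_step_def Let_def)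

lemma finite_pipage [simp]: "finite (set_pmf (pipage n Q Y))"
  unfolding pipage_def by (rule finite_for_pmf) simp

text \<open>\<open>snd x\<close> is the only position up to \<open>i\<close> that may be fractional;
  the preserved total settles it at the end.\<close>

definition pipage_inv :: "nat \<Rightarrow> nat \<Rightarrow> nat \<Rightarrow> nat \<Rightarrow> (nat \<Rightarrow> nat) \<times> nat \<Rightarrow> bool" where
  "pipage_inv n Q K i x \<longleftrightarrow> snd x \<le> i \<and> (\<forall>u<n. fst x u \<le> Q) \<and>
     (\<forall>u\<le>i. u \<noteq> snd x \<longrightarrow> fst x u = 0 \<or> fst x u = Q) \<and> (\<Sum>u<n. fst x u) = K"

lemma sum_upd2:
  fixes Y :: "nat \<Rightarrow> nat"
  assumes "c < n" "v < n" "c \<noteq> v" "a + b = Y c + Y v"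
  shows "(\<Sum>u<n. (Y(c := a, v := b)) u) = (\<Sum>u<n. Y u)"
proof -
  have *: "(\<Sum>u<n. Z u) = Z c + Z v + (\<Sum>u\<in>{..<n} - {c, v}. Z u)" for Z :: "nat \<Rightarrow> nat"
  proof -
    have "(\<Sum>u<n. Z u) = (\<Sum>u\<in>{..<n} - {c, v}. Z u) + (\<Sum>u\<in>{c, v}. Z u)"
      using assms by (intro sum.subset_diff) auto
    then show ?thesis using assms(3) by simp
  qed
  show ?thesis
    unfolding *[of "Y(c := a, v := b)"] *[of Y] using assms(3,4) by (auto intro!: sum.cong)
qed

lemma pipage_step_inv:
  assumes I: "pipage_inv n Q K i x" and v: "Suc i < n" and x': "x' \<in> set_pmf (pipage_step Q (Suc i) x)"
  shows "pipage_inv n Q K (Suc i) x'"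
proof -
  obtain Y c where x: "x = (Y, c)" by (cases x)
  define v where "v = Suc i"
  have c: "c \<le> i" and le: "\<And>u. u < n \<Longrightarrow> Y u \<le> Q" and int: "\<And>u. u \<le> i \<Longrightarrow> u \<noteq> c \<Longrightarrow> Y u = 0 \<or> Y u = Q"
    and s: "(\<Sum>u<n. Y u) = K"
    using I by (auto simp: pipage_inv_def x)
  have cv: "c < n" "v < n" "c \<noteq> v" using c assms(2) by (auto simp: v_def)
  have ok: "pipage_inv n Q K v (Y(c := a, v := b), c')"
    if "a + b = Y c + Y v" "a \<le> Q" "b \<le> Q" "c' = c \<and> (b = 0 \<or> b = Q) \<or> c' = v \<and> (a = 0 \<or> a = Q)" for a b c'
    unfolding pipage_inv_def
  proof (intro conjI allI impI)
    show "snd (Y(c := a, v := b), c') \<le> v" using that(4) c by (auto simp: v_def)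
    show "fst (Y(c := a, v := b), c') u \<le> Q" if "u < n" for u
      using le[OF that] \<open>a \<le> Q\<close> \<open>b \<le> Q\<close> by auto
    show "fst (Y(c := a, v := b), c') u = 0 \<or> fst (Y(c := a, v := b), c') u = Q"
      if "u \<le> v" "u \<noteq> snd (Y(c := a, v := b), c')" for u
      using int[of u] that \<open>c' = c \<and> (b = 0 \<or> b = Q) \<or> c' = v \<and> (a = 0 \<or> a = Q)\<close> by (auto simp: v_def le_Suc_eq)
    show "(\<Sum>u<n. fst (Y(c := a, v := b), c') u) = K"
      using sum_upd2[OF cv that(1)] s by simp
  qed
  have "Y c \<le> Q" "Y v \<le> Q" using le cv by auto
  then show ?thesis
    using x' unfolding x pipage_step_def Let_def v_def[symmetric]
    by (auto split: if_splits intro!: ok)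
qed

lemma EE_map_if:
  "EE (map_pmf (\<lambda>a. if P a then x else z) p) g = EE p (\<lambda>a. if P a then g x else g z)"
  by (simp add: if_distrib)

text \<open>The probabilities preserve the mean of both coordinates, so the linear part is unchanged
  in expectation. The product becomes 0 or \<open>y c + y v - 1\<close>, neither above
  \<open>y c * y v\<close>, and its coefficient is nonpositive.\<close>

lemma pipage_step_value:
  assumes I: "pipage_inv n Q K i x" and v: "Suc i < n" and Q: "0 < Q" and sub: "submodular_on {..<n} f"
  shows "mlext n (grid_vec Q (fst x)) f \<le> EE (pipage_step Q (Suc i) x) (\<lambda>x'. mlext n (grid_vec Q (fst x')) f)"
proof -
  obtain Y c where x: "x = (Y, c)" by (cases x)
  define v where "v = Suc i"
  have c: "c \<le> i" and le: "\<And>u. u < n \<Longrightarrow> Y u \<le> Q"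
    using I by (auto simp: pipage_inv_def x)
  have cv: "c < n" "v < n" "c \<noteq> v" using c assms(2) by (auto simp: v_def)
  define y where "y = grid_vec Q Y"
  have y: "unit_vec n y" unfolding y_def by (rule unit_grid_vec[OF le])
  obtain p q r s where s: "s \<le> 0" and F: "\<And>a b. mlext n (y(c := a, v := b)) f = p + q * a + r * b + s * (a * b)"
    by (rule mlext_upd2[OF cv sub y]) (rule that)
  have F': "mlext n (grid_vec Q (Y(c := a, v := b))) f
      = p + q * (real a / real Q) + r * (real b / real Q) + s * (real a / real Q * (real b / real Q))" for a b
    unfolding grid_vec_upd y_def[symmetric] F ..
  have F0: "mlext n (grid_vec Q Y) f = p + q * y c + r * y v + s * (y c * y v)"
    using F[of "y c" "y v"] unfolding y_def by simp
  define t where "t = Y c + Y v"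
  have yc: "y c = real (Y c) / real Q" and yv: "y v = real (Y v) / real Q" by (auto simp: y_def grid_vec_def)
  have b: "0 \<le> y c" "y c \<le> 1" "0 \<le> y v" "y v \<le> 1" using y cv by (auto simp: unit_vec_def)
  show ?thesis
  proof (cases "t \<le> Q")
    case True
    define P where "P = real (Y c) / real t"
    \<comment> \<open>Also for \<open>t = 0\<close>, where division by zero gives
      \<open>P = 0\<close> and \<open>Y c = 0\<close>.\<close>
    have P: "P * real t = real (Y c)" unfolding P_def t_def by auto
    have "EE (pipage_step Q v x) (\<lambda>x'. mlext n (grid_vec Q (fst x')) f)
       = EE (pmf_of_set {0..t - 1}) (\<lambda>a. if a < Y c then mlext n (grid_vec Q (Y(c := t, v := 0))) f
            else mlext n (grid_vec Q (Y(c := 0, v := t))) f)"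
    proof -
      have "pipage_step Q v x = map_pmf (\<lambda>a. if a < Y c then (Y(c := t, v := 0), c) else (Y(c := 0, v := t), v))
          (pmf_of_set {0..t - 1})"
        using True unfolding x pipage_step_def Let_def t_def fst_conv snd_conv by simp
      then show ?thesis by (simp only: EE_map_if fst_conv)
    qed
    also have "\<dots> = P * (p + q * (real t / real Q)) + (1 - P) * (p + r * (real t / real Q))"
      unfolding P_def by (subst EE_threshold) (auto simp: t_def F')
    also have "\<dots> = p + q * (P * real t / real Q) + r * (real t / real Q - P * real t / real Q)"
      by (simp add: algebra_simps add_divide_distrib[symmetric])
    also have "\<dots> = p + q * y c + r * y v"
      unfolding P yc yv unfolding t_def by (simp add: add_divide_distrib)
    finally have "EE (pipage_step Q v x) (\<lambda>x'. mlext n (grid_vec Q (fst x')) f) = p + q * y c + r * y v" .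
    moreover have "s * (y c * y v) \<le> 0" using s b by (simp add: mult_nonpos_nonneg)
    ultimately have "mlext n (grid_vec Q (fst x)) f \<le> EE (pipage_step Q v x) (\<lambda>x'. mlext n (grid_vec Q (fst x')) f)"
      using F0 by (simp add: x)
    then show ?thesis by (simp only: v_def)
  next
    case False
    have le2: "Y c \<le> Q" "Y v \<le> Q" using le cv by auto
    define P where "P = real (Q - Y v) / real (2 * Q - t)"
    define \<sigma> where "\<sigma> = real t / real Q"
    have \<sigma>: "\<sigma> = y c + y v" unfolding \<sigma>_def t_def yc yv by (simp add: add_divide_distrib)
    have rt: "real (t - Q) / real Q = \<sigma> - 1" using False Q by (simp add: \<sigma>_def of_nat_diff diff_divide_distrib)
    \<comment> \<open>If \<open>t = 2 * Q\<close>, both coordinates are full and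
      \<open>\<sigma> = 2\<close>, so both sides are 0.\<close>
    have P: "P * (2 - \<sigma>) = 1 - y v"
    proof (cases "2 * Q - t = 0")
      case True
      then have "Y v = Q" using le2 by (auto simp: t_def)
      then show ?thesis unfolding P_def yv using Q by simp
    next
      case False
      have e: "real (2 * Q - t) = real Q * (2 - \<sigma>)"
        using le2 Q unfolding \<sigma>_def by (simp add: of_nat_diff t_def field_simps)
      have "0 < real Q * (2 - \<sigma>)" using False by (subst e[symmetric]) simp
      then have ne: "2 - \<sigma> \<noteq> 0" by auto
      have "P * (2 - \<sigma>) = (real Q - real (Y v)) / real Q"
        unfolding P_def e using le2 ne by (simp add: of_nat_diff)
      then show ?thesis unfolding yv using Q by (simp add: diff_divide_distrib)
    qed
    have "EE (pipage_step Q v x) (\<lambda>x'. mlext n (grid_vec Q (fst x')) f)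
       = EE (pmf_of_set {0..2 * Q - t - 1}) (\<lambda>a. if a < Q - Y v then mlext n (grid_vec Q (Y(c := Q, v := t - Q))) f
            else mlext n (grid_vec Q (Y(c := t - Q, v := Q))) f)"
    proof -
      have "pipage_step Q v x = map_pmf (\<lambda>a. if a < Q - Y v then (Y(c := Q, v := t - Q), v)
          else (Y(c := t - Q, v := Q), c)) (pmf_of_set {0..2 * Q - t - 1})"
        using False unfolding x pipage_step_def Let_def t_def fst_conv snd_conv by simp
      then show ?thesis by (simp only: EE_map_if fst_conv)
    qed
    also have "\<dots> = P * (p + q + r * (\<sigma> - 1) + s * (\<sigma> - 1)) + (1 - P) * (p + q * (\<sigma> - 1) + r + s * (\<sigma> - 1))"
    proof -
      have "Q - Y v \<le> 2 * Q - t" using le2 by (simp add: t_def)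
      then show ?thesis unfolding EE_threshold[OF \<open>Q - Y v \<le> 2 * Q - t\<close>] F' rt P_def[symmetric]
        using Q by simp
    qed
    also have "\<dots> = p + q * (\<sigma> - 1 + P * (2 - \<sigma>)) + r * (1 - P * (2 - \<sigma>)) + s * (\<sigma> - 1)"
      by (simp add: algebra_simps)
    also have "\<dots> = p + q * y c + r * y v + s * (y c + y v - 1)"
      unfolding P by (simp add: \<sigma>)
    finally have E: "EE (pipage_step Q v x) (\<lambda>x'. mlext n (grid_vec Q (fst x')) f) = p + q * y c + r * y v + s * (y c + y v - 1)" .
    have "0 \<le> (1 - y c) * (1 - y v)" using b by simp
    then have "y c + y v - 1 \<le> y c * y v" by (simp add: algebra_simps)
    then have "s * (y c * y v) \<le> s * (y c + y v - 1)" using s by (rule mult_left_mono_neg)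
    then have "mlext n (grid_vec Q (fst x)) f \<le> EE (pipage_step Q v x) (\<lambda>x'. mlext n (grid_vec Q (fst x')) f)"
      using E F0 by (simp add: x)
    then show ?thesis by (simp only: v_def)
  qed
qed

lemma pipage_start:
  assumes "\<And>u. u < n \<Longrightarrow> Y u \<le> Q" "(\<Sum>u<n. Y u) = K"
  shows "pipage_inv n Q K 0 (Y, 0)"
  using assms by (simp add: pipage_inv_def)

text \<open>The total is a multiple of \<open>Q\<close>, and so are all positions but one; hence the
  remaining one is a multiple of \<open>Q\<close> that is at most \<open>Q\<close>.\<close>

lemma pipage_support:
  assumes Y: "\<And>u. u < n \<Longrightarrow> Y u \<le> Q" and K: "(\<Sum>u<n. Y u) = k * Q" and Q: "0 < Q" and n: "0 < n"
    and x: "x \<in> set_pmf (pipage n Q Y)"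
  shows "\<forall>u<n. fst x u = 0 \<or> fst x u = Q" and "card {u. u < n \<and> fst x u \<noteq> 0} = k"
proof -
  have "pipage_inv n Q (k * Q) (0 + (n - 1)) x"
    using x unfolding pipage_def
    by (rule for_pmf_inv[where I = "pipage_inv n Q (k * Q)", rotated 2])
      (auto intro!: pipage_start Y K pipage_step_inv)
  then have I: "snd x < n" "\<And>u. u < n \<Longrightarrow> fst x u \<le> Q" "(\<Sum>u<n. fst x u) = k * Q"
      "\<And>u. u < n \<Longrightarrow> u \<noteq> snd x \<Longrightarrow> fst x u = 0 \<or> fst x u = Q"
    using n by (auto simp: pipage_inv_def)
  have "Q dvd (\<Sum>u\<in>{..<n} - {snd x}. fst x u)"
  proof (rule dvd_sum)
    show "Q dvd fst x u" if "u \<in> {..<n} - {snd x}" for u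
      using I(4)[of u] that by auto
  qed
  moreover have "(\<Sum>u<n. fst x u) = fst x (snd x) + (\<Sum>u\<in>{..<n} - {snd x}. fst x u)"
    using I(1) by (intro sum.remove) auto
  ultimately have "Q dvd fst x (snd x)"
    using I(3) by (metis dvd_add_left_iff dvd_triv_right)
  then have c: "fst x (snd x) = 0 \<or> fst x (snd x) = Q"
    using I(2)[OF I(1)] by (metis dvd_imp_le le_antisym neq0_conv)
  show all: "\<forall>u<n. fst x u = 0 \<or> fst x u = Q" using c I(4) by auto
  have "(\<Sum>u<n. fst x u) = (\<Sum>u<n. if fst x u \<noteq> 0 then Q else 0)"
    using all by (intro sum.cong) auto
  also have "\<dots> = card {u. u < n \<and> fst x u \<noteq> 0} * Q"
    by (simp add: sum.If_cases Int_def)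
  finally show "card {u. u < n \<and> fst x u \<noteq> 0} = k" using I(3) Q by simp
qed

lemma pipage_value:
  assumes Y: "\<And>u. u < n \<Longrightarrow> Y u \<le> Q" and K: "(\<Sum>u<n. Y u) = k * Q" and Q: "0 < Q" and n: "0 < n"
    and sub: "submodular_on {..<n} f"
  shows "mlext n (grid_vec Q Y) f \<le> EE (pipage n Q Y) (\<lambda>x. f {u. u < n \<and> fst x u \<noteq> 0})"
proof -
  \<comment> \<open>\<open>for_pmf_potential\<close> limits growth from above, so the value enters
    with a minus sign.\<close>
  have "EE (pipage n Q Y) (\<lambda>x. - mlext n (grid_vec Q (fst x)) f) \<le> - mlext n (grid_vec Q (fst (Y, 0::nat))) f + real (n - 1) * 0"
    unfolding pipage_def
  proof (rule for_pmf_potential[where I = "pipage_inv n Q (k * Q)" and \<phi> = "\<lambda>_ x. - mlext n (grid_vec Q (fst x)) f"])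
    show "pipage_inv n Q (k * Q) 0 (Y, 0)" by (rule pipage_start[OF Y K])
    show "pipage_inv n Q (k * Q) (Suc i) x'" if "i < 0 + (n - 1)" "pipage_inv n Q (k * Q) i x" "x' \<in> set_pmf (pipage_step Q (Suc i) x)" for i x x'
      using pipage_step_inv[OF that(2) _ that(3)] that(1) by simp
    show "EE (pipage_step Q (Suc i) x) (\<lambda>x. - mlext n (grid_vec Q (fst x)) f) \<le> - mlext n (grid_vec Q (fst x)) f + 0"
      if "i < 0 + (n - 1)" "pipage_inv n Q (k * Q) i x" for i x
      using pipage_step_value[OF that(2) _ Q sub] that(1) by simp
  qed auto
  then have "mlext n (grid_vec Q Y) f \<le> EE (pipage n Q Y) (\<lambda>x. mlext n (grid_vec Q (fst x)) f)"
    by simp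
  also have "\<dots> \<le> EE (pipage n Q Y) (\<lambda>x. f {u. u < n \<and> fst x u \<noteq> 0})"
  proof (rule EE_mono)
    fix x assume "x \<in> set_pmf (pipage n Q Y)"
    note a = pipage_support(1)[OF Y K Q n this]
    have "mlext n (grid_vec Q (fst x)) f = f {u. u < n \<and> fst x u \<noteq> 0}"
      using a Q by (intro mlext_ind_gen) (auto simp: grid_vec_def)
    then show "mlext n (grid_vec Q (fst x)) f \<le> f {u. u < n \<and> fst x u \<noteq> 0}" by simp
  qed simp
  finally show ?thesis .
qed

section \<open>The random solution and its expected value\<close>

context symmetric_submodular
begin

definition solve :: "nat \<Rightarrow> nat set pmf" where
  "solve k = (let w = n * n * n in bind_pmf (greedy k w)
     (\<lambda>Y. map_pmf (\<lambda>x. {u. u < n \<and> fst x u \<noteq> 0})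
        (pipage n (mix_den n (w * w) Y) (mix_num n k (w * w) Y))))"

lemma finite_solve [simp]: "finite (set_pmf (solve k))"
  by (simp add: solve_def Let_def)

lemma mix_greedy:
  assumes "Y \<in> set_pmf (greedy k w)" "0 < w" "0 < n" "2 * k \<le> n"
  shows "\<And>u. u < n \<Longrightarrow> Y u \<le> w * w" "0 < w * w" "(\<Sum>u<n. Y u) = 0 \<or> (\<Sum>u<n. Y u) < k * (w * w)"
  using greedy_support[OF assms(1-3)] assms by auto

lemma solve_feasible:
  assumes "0 < n" "2 * k \<le> n" "S \<in> set_pmf (solve k)"
  shows "S \<subseteq> {..<n} \<and> card S = k"
proof -
  define w where "w = n * n * n"
  obtain Y x where Y: "Y \<in> set_pmf (greedy k w)"
    and x: "x \<in> set_pmf (pipage n (mix_den n (w * w) Y) (mix_num n k (w * w) Y))"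
    and S: "S = {u. u < n \<and> fst x u \<noteq> 0}"
    using assms(3) by (auto simp: solve_def Let_def w_def)
  have "0 < w" using assms(1) by (simp add: w_def)
  note g = mix_greedy[OF Y this assms(1,2)]
  note m = mix[OF g(1,2) assms(2,1) g(3)]
  show ?thesis unfolding S using pipage_support(2)[OF m(2) m(3) m(1) assms(1) x] by auto
qed

text \<open>Mixing preserves the bound by the clipped deficit, and rounding loses no value in
  expectation, so every greedy outcome yields an expected value of at least
  \<open>(f T - deficit) / 2\<close>; 28 is half of 56.\<close>

lemma solve_value:
  assumes T: "T \<subseteq> {..<n}" "card T = k" and k: "1 \<le> k" "2 * k \<le> n"
    and opt: "\<And>X. X \<subseteq> {..<n} \<Longrightarrow> card X = k \<Longrightarrow> f X \<le> f T"
  shows "(1/2 * (1 - (1 - real k / real n) powr (2 * real n / real k)) - 28 / real n) * f T \<le> EE (solve k) f"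
proof -
  define w where "w = n * n * n"
  have n: "0 < n" using k by simp
  have w: "0 < w" using n by (simp add: w_def)
  have "1/2 * f T - 1/2 * deficit T (w * w) Y
      \<le> EE (pipage n (mix_den n (w * w) Y) (mix_num n k (w * w) Y)) (\<lambda>x. f {u. u < n \<and> fst x u \<noteq> 0})"
    if Y: "Y \<in> set_pmf (greedy k w)" for Y
  proof -
    note g = mix_greedy[OF Y w n k(2)]
    note m = mix[OF g(1,2) k(2) n g(3)]
    obtain \<mu> where \<mu>: "0 \<le> \<mu>" "\<mu> \<le> 1" "grid_vec (mix_den n (w * w) Y) (mix_num n k (w * w) Y)
        = (\<lambda>u. grid_vec (w * w) Y u * (1 - \<mu>) + (1 - grid_vec (w * w) Y u) * \<mu>)"
      using m(4) by blast
    have "f T - deficit T (w * w) Y \<le> 2 * mlext n (grid_vec (mix_den n (w * w) Y) (mix_num n k (w * w) Y)) f"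
      unfolding deficit_def \<mu>(3) by (intro mix_deficit T \<mu> unit_grid_vec g)
    moreover have "mlext n (grid_vec (mix_den n (w * w) Y) (mix_num n k (w * w) Y)) f
        \<le> EE (pipage n (mix_den n (w * w) Y) (mix_num n k (w * w) Y)) (\<lambda>x. f {u. u < n \<and> fst x u \<noteq> 0})"
      by (rule pipage_value[OF m(2) m(3) m(1) n submod_on])
    ultimately show ?thesis by simp
  qed
  then have "EE (greedy k w) (\<lambda>Y. 1/2 * f T + (- (1/2)) * deficit T (w * w) Y)
      \<le> EE (greedy k w) (\<lambda>Y. EE (pipage n (mix_den n (w * w) Y) (mix_num n k (w * w) Y)) (\<lambda>x. f {u. u < n \<and> fst x u \<noteq> 0}))"
    by (intro EE_mono) auto
  also have "\<dots> = EE (solve k) f"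
    unfolding solve_def Let_def w_def by (simp add: EE_bind)
  also have "EE (greedy k w) (\<lambda>Y. 1/2 * f T + (- (1/2)) * deficit T (w * w) Y)
      = 1/2 * f T - 1/2 * EE (greedy k w) (deficit T (w * w))"
    by (subst EE_add) auto
  finally have "1/2 * f T - 1/2 * EE (greedy k w) (deficit T (w * w)) \<le> EE (solve k) f" .
  moreover have "EE (greedy k w) (deficit T (w * w))
    \<le> ((1 - real k / real n) powr (2 * real n / real k) + 56 / real n) * f T"
    by (rule greedy_deficit[OF T k opt]) (auto simp: w_def power3_eq_cube)
  ultimately show ?thesis by (simp add: algebra_simps)
qed

end

subsection \<open>Refinement of programs\<close>

text \<open>Every bound depends only on \<open>V\<close>, a common bound on all memory cells, and is
  built from sums and products. A polynomial \<open>V\<close> therefore yields polynomial time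
  without counting the steps of each program separately.\<close>

primrec nval_bound :: "nat \<Rightarrow> nexp \<Rightarrow> nat" where
  "nval_bound V (Num m) = m"
| "nval_bound V (NGet x i) = V"
| "nval_bound V (NAdd a b) = nval_bound V a + nval_bound V b"
| "nval_bound V (NSub a b) = nval_bound V a"
| "nval_bound V (NMul a b) = nval_bound V a * nval_bound V b"
| "nval_bound V (NDiv a b) = nval_bound V a"
| "nval_bound V (NMod a b) = nval_bound V a"

text \<open>Values stand in for bit lengths: crude, but harmless because all stored numbers are
  polynomial in \<open>n\<close>.\<close>

primrec ncost_bound :: "nat \<Rightarrow> nexp \<Rightarrow> nat" where
  "ncost_bound V (Num m) = 1 + m"
| "ncost_bound V (NGet x i) = 1 + V + ncost_bound V i"
| "ncost_bound V (NAdd a b) = 1 + (nval_bound V a + nval_bound V b) + ncost_bound V a + ncost_bound V b"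
| "ncost_bound V (NSub a b) = 1 + nval_bound V a + ncost_bound V a + ncost_bound V b"
| "ncost_bound V (NMul a b) = 1 + nval_bound V a * nval_bound V b + ncost_bound V a + ncost_bound V b"
| "ncost_bound V (NDiv a b) = 1 + nval_bound V a + ncost_bound V a + ncost_bound V b"
| "ncost_bound V (NMod a b) = 1 + nval_bound V a + ncost_bound V a + ncost_bound V b"

primrec rcost_bound :: "nat \<Rightarrow> rexp \<Rightarrow> nat" where
  "rcost_bound V RZero = 1"
| "rcost_bound V (RGet x i) = 1 + ncost_bound V i"
| "rcost_bound V (RAdd a b) = 1 + rcost_bound V a + rcost_bound V b"
| "rcost_bound V (RSub a b) = 1 + rcost_bound V a + rcost_bound V b"

primrec bcost_bound :: "nat \<Rightarrow> bexp \<Rightarrow> nat" where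
  "bcost_bound V (NLess a b) = 1 + ncost_bound V a + ncost_bound V b"
| "bcost_bound V (RLess a b) = 1 + rcost_bound V a + rcost_bound V b"
| "bcost_bound V (BNot b) = 1 + bcost_bound V b"
| "bcost_bound V (BAnd a b) = 1 + bcost_bound V a + bcost_bound V b"

text \<open>
  The bound for a loop assumes that its counter stays in memory, so that it runs at most \<open>V\<close> times.
\<close>

primrec time_bound :: "nat \<Rightarrow> com \<Rightarrow> nat" where
  "time_bound V Skip = 1"
| "time_bound V (NAssign x i a) = 1 + ncost_bound V i + ncost_bound V a"
| "time_bound V (RAssign x i a) = 1 + ncost_bound V i + rcost_bound V a"
| "time_bound V (Random x a) = 1 + ncost_bound V a"
| "time_bound V (Query r x) = 1 + V"
| "time_bound V (Seq c d) = time_bound V c + time_bound V d"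
| "time_bound V (Cond b c d) = 1 + bcost_bound V b + time_bound V c + time_bound V d"
| "time_bound V (While b c) = V * (1 + bcost_bound V b + time_bound V c) + (1 + bcost_bound V b)"

definition mem_le :: "nat \<Rightarrow> state \<Rightarrow> bool" where
  "mem_le V s \<longleftrightarrow> (\<forall>x i. nmem s x i \<le> V)"

lemma bits_le: "bits m \<le> m"
  by (intro floorlog_leI) (auto simp: less_exp)

lemma nval_le: "mem_le V s \<Longrightarrow> nval s e \<le> nval_bound V e"
proof (induction e)
  case (NSub a b)
  then show ?case by (simp add: le_trans[OF diff_le_self])
next
  case (NDiv a b)
  then show ?case by (simp add: le_trans[OF div_le_dividend])
next
  case (NMod a b)
  then show ?case by (simp add: le_trans[OF mod_less_eq_dividend])
qed (auto simp: mem_le_def add_mono mult_le_mono)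

lemma bits_nval_le: "mem_le V s \<Longrightarrow> bits (nval s e) \<le> nval_bound V e"
  using bits_le nval_le le_trans by blast

lemma ncost_le: "mem_le V s \<Longrightarrow> ncost s e \<le> ncost_bound V e"
proof (induction e)
  case (Num m)
  then show ?case by (simp add: bits_le)
qed (use bits_nval_le[of V s "NGet _ _"] bits_nval_le[of V s "NAdd _ _"] bits_nval_le[of V s "NSub _ _"]
    bits_nval_le[of V s "NMul _ _"] bits_nval_le[of V s "NDiv _ _"] bits_nval_le[of V s "NMod _ _"]
    in \<open>simp_all add: add_mono\<close>)

lemma rcost_le: "mem_le V s \<Longrightarrow> rcost s e \<le> rcost_bound V e"
  by (induction e) (auto simp: ncost_le add_mono)

lemma bcost_le: "mem_le V s \<Longrightarrow> bcost s e \<le> bcost_bound V e"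
  by (induction e) (auto simp: ncost_le rcost_le add_mono)

lemma mem_simps [simp]:
  "nmem (tick t s) = nmem s" "rmem (tick t s) = rmem s" "clock (tick t s) = clock s + t"
  "nmem (nupd x i v s) = (nmem s)(x := (nmem s x)(i := v))" "rmem (nupd x i v s) = rmem s"
  "clock (nupd x i v s) = clock s"
  "nmem (rupd x i a s) = nmem s" "rmem (rupd x i a s) = (rmem s)(x := (rmem s x)(i := a))"
  "clock (rupd x i a s) = clock s"
  by (simp_all add: tick_def nupd_def rupd_def)

lemma mem_le_tick [simp]: "mem_le V (tick t s) = mem_le V s"
  by (simp add: mem_le_def)

lemma mem_le_rupd [simp]: "mem_le V (rupd x i a s) = mem_le V s"
  by (simp add: mem_le_def)

lemma mem_le_nupd: "mem_le V s \<Longrightarrow> v \<le> V \<Longrightarrow> mem_le V (nupd x i v s)"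
  by (auto simp: mem_le_def)

section \<open>Couplings of programs with probability mass functions\<close>

type_synonym 'a post = "'a \<Rightarrow> (vname \<Rightarrow> nat \<Rightarrow> nat) \<Rightarrow> (vname \<Rightarrow> nat \<Rightarrow> real) \<Rightarrow> bool"

text \<open>
  The final states of \<open>c\<close> are coupled to the outcomes of \<open>p\<close> so that \<open>R\<close> holds; in particular \<open>c\<close> terminates
  almost surely.
\<close>

definition refines :: "nat \<Rightarrow> (nat set \<Rightarrow> real) \<Rightarrow> nat \<Rightarrow> com \<Rightarrow> state \<Rightarrow> 'a pmf \<Rightarrow> 'a post \<Rightarrow> bool" where
  "refines n f V c s p R \<longleftrightarrow> rel_spmf
     (\<lambda>x s'. R x (nmem s') (rmem s') \<and> mem_le V s' \<and> clock s' \<le> clock s + time_bound V c)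
     (spmf_of_pmf p) (exec n f c s)"

lemma refines_mono:
  assumes "refines n f V c s p R" "\<And>x N M. x \<in> set_pmf p \<Longrightarrow> R x N M \<Longrightarrow> R' x N M"
  shows "refines n f V c s p R'"
  using assms(1) unfolding refines_def
  by (rule rel_spmf_mono_strong) (auto simp: assms(2))

lemma refines_Skip:
  assumes "mem_le V s" "R x (nmem s) (rmem s)"
  shows "refines n f V Skip s (return_pmf x) R"
  using assms by (simp add: refines_def)

lemma refines_Seq:
  assumes c: "refines n f V c s p R"
    and d: "\<And>x s'. R x (nmem s') (rmem s') \<Longrightarrow> mem_le V s' \<Longrightarrow> refines n f V d s' (q x) R'"
  shows "refines n f V (Seq c d) s (bind_pmf p q) R'"
proof -
  have "rel_spmf (\<lambda>x s'. R' x (nmem s') (rmem s') \<and> mem_le V s' \<and> clock s' \<le> clock s + time_bound V (Seq c d))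
    (bind_spmf (spmf_of_pmf p) (\<lambda>x. spmf_of_pmf (q x))) (bind_spmf (exec n f c s) (exec n f d))"
  proof (rule rel_spmf_bindI[OF c[unfolded refines_def]])
    fix x s' assume *: "R x (nmem s') (rmem s') \<and> mem_le V s' \<and> clock s' \<le> clock s + time_bound V c"
    then have "refines n f V d s' (q x) R'" using d by auto
    then show "rel_spmf (\<lambda>x s'. R' x (nmem s') (rmem s') \<and> mem_le V s' \<and> clock s' \<le> clock s + time_bound V (Seq c d))
        (spmf_of_pmf (q x)) (exec n f d s')"
      unfolding refines_def by (rule rel_spmf_mono) (use * in auto)
  qed
  then show ?thesis by (simp add: refines_def spmf_of_pmf_bind)
qed

lemma refines_Seq_det:
  assumes "refines n f V c s (return_pmf x) R"
    and "\<And>s'. R x (nmem s') (rmem s') \<Longrightarrow> mem_le V s' \<Longrightarrow> refines n f V d s' q R'"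
  shows "refines n f V (Seq c d) s q R'"
  using refines_Seq[of n f V c s "return_pmf x" "\<lambda>y N M. y = x \<and> R y N M" d "\<lambda>_. q" R']
    refines_mono[OF assms(1), of "\<lambda>y N M. y = x \<and> R y N M"] assms(2)
  by (simp add: bind_return_pmf)

text \<open>This rule and its analogues carry the continuation \<open>d\<close>, so that proofs run
  forwards through a program. Only the memories and the bound \<open>V\<close> are passed on; time
  is accounted for inside \<open>refines\<close>.\<close>

lemma refines_NAssign:
  assumes "mem_le V s" "nval s a \<le> V"
    and "\<And>s'. nmem s' = (nmem s)(x := (nmem s x)(nval s i := nval s a)) \<Longrightarrow> rmem s' = rmem s \<Longrightarrow>
      mem_le V s' \<Longrightarrow> refines n f V d s' q R"
  shows "refines n f V (Seq (NAssign x i a) d) s q R"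
  by (rule refines_Seq_det[where x = "()" and R = "\<lambda>_ N M. N = (nmem s)(x := (nmem s x)(nval s i := nval s a)) \<and> M = rmem s"])
    (use assms in \<open>auto simp: refines_def mem_le_nupd intro!: add_mono ncost_le\<close>)

lemma refines_RAssign:
  assumes "mem_le V s"
    and "\<And>s'. nmem s' = nmem s \<Longrightarrow> rmem s' = (rmem s)(x := (rmem s x)(nval s i := rval s a)) \<Longrightarrow>
      mem_le V s' \<Longrightarrow> refines n f V d s' q R"
  shows "refines n f V (Seq (RAssign x i a) d) s q R"
  by (rule refines_Seq_det[where x = "()" and R = "\<lambda>_ N M. N = nmem s \<and> M = (rmem s)(x := (rmem s x)(nval s i := rval s a))"])
    (use assms in \<open>auto simp: refines_def intro!: add_mono ncost_le rcost_le\<close>)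

lemma refines_Query:
  assumes "mem_le V s" "n \<le> V"
    and "\<And>s'. nmem s' = nmem s \<Longrightarrow> rmem s' = (rmem s)(r := (rmem s r)(0 := f {i. i < n \<and> nmem s x i \<noteq> 0})) \<Longrightarrow>
      mem_le V s' \<Longrightarrow> refines n f V d s' q R"
  shows "refines n f V (Seq (Query r x) d) s q R"
  by (rule refines_Seq_det[where x = "()" and R = "\<lambda>_ N M. N = nmem s \<and> M = (rmem s)(r := (rmem s r)(0 := f {i. i < n \<and> nmem s x i \<noteq> 0}))"])
    (use assms in \<open>auto simp: refines_def set_at_def\<close>)

lemma refines_Random:
  assumes "mem_le V s" "nval s a \<le> V"
    and "\<And>v s'. v \<le> nval s a \<Longrightarrow> nmem s' = (nmem s)(x := (nmem s x)(0 := v)) \<Longrightarrow> rmem s' = rmem s \<Longrightarrow>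
      mem_le V s' \<Longrightarrow> refines n f V d s' (h v) R"
  shows "refines n f V (Seq (Random x a) d) s (bind_pmf (pmf_of_set {0..nval s a}) h) R"
proof (rule refines_Seq)
  have "rel_spmf (\<lambda>v s'. (v \<le> nval s a \<and> nmem s' = (nmem s)(x := (nmem s x)(0 := v)) \<and> rmem s' = rmem s) \<and>
      mem_le V s' \<and> clock s' \<le> clock s + time_bound V (Random x a))
     (spmf_of_set {0..nval s a}) (map_spmf (\<lambda>v. tick (1 + ncost s a) (nupd x 0 v s)) (spmf_of_set {0..nval s a}))"
    unfolding spmf_rel_map by (rule rel_spmf_reflI) (use assms in \<open>auto simp: ncost_le mem_le_nupd\<close>)
  then show "refines n f V (Random x a) s (pmf_of_set {0..nval s a})
     (\<lambda>v N M. v \<le> nval s a \<and> N = (nmem s)(x := (nmem s x)(0 := v)) \<and> M = rmem s)"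
    by (simp add: refines_def)
qed (use assms(3) in auto)

lemma refines_Seq_assoc:
  "refines n f V (Seq c (Seq d e)) s q R \<Longrightarrow> refines n f V (Seq (Seq c d) e) s q R"
proof -
  have "exec n f (Seq d e) = (\<lambda>y. bind_spmf (exec n f d y) (exec n f e))" by (rule ext) simp
  then show "refines n f V (Seq c (Seq d e)) s q R \<Longrightarrow> refines n f V (Seq (Seq c d) e) s q R"
    by (simp add: refines_def add.assoc)
qed

lemma refines_Skip_Seq:
  assumes "\<And>s'. nmem s' = nmem s \<Longrightarrow> rmem s' = rmem s \<Longrightarrow> mem_le V s' \<Longrightarrow> refines n f V d s' q R" "mem_le V s"
  shows "refines n f V (Seq Skip d) s q R"
  by (rule refines_Seq_det[where x = "()" and R = "\<lambda>_ N M. N = nmem s \<and> M = rmem s"])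
    (use assms in \<open>auto simp: refines_def\<close>)

text \<open>\<open>time_bound\<close> adds up both branches, so one bound serves whichever is taken;
  the continuation is moved into the branches.\<close>

lemma refines_Cond:
  assumes "mem_le V s"
    and "\<And>s'. bval s b \<Longrightarrow> nmem s' = nmem s \<Longrightarrow> rmem s' = rmem s \<Longrightarrow> mem_le V s' \<Longrightarrow> refines n f V (Seq c e) s' q R"
    and "\<And>s'. \<not> bval s b \<Longrightarrow> nmem s' = nmem s \<Longrightarrow> rmem s' = rmem s \<Longrightarrow> mem_le V s' \<Longrightarrow> refines n f V (Seq d e) s' q R"
  shows "refines n f V (Seq (Cond b c d) e) s q R"
proof -
  define s' where "s' = tick (1 + bcost s b) s"
  have s': "nmem s' = nmem s" "rmem s' = rmem s" "mem_le V s'" "clock s' \<le> clock s + (1 + bcost_bound V b)"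
    using assms(1) bcost_le[OF assms(1), of b] by (auto simp: s'_def)
  show ?thesis
  proof (cases "bval s b")
    case True
    have "refines n f V (Seq c e) s' q R" using assms(2) True s' by auto
    then have "rel_spmf (\<lambda>x s'. R x (nmem s') (rmem s') \<and> mem_le V s' \<and> clock s' \<le> clock s + time_bound V (Seq (Cond b c d) e))
        (spmf_of_pmf q) (exec n f (Seq c e) s')"
      unfolding refines_def by (rule rel_spmf_mono) (use s' in auto)
    then show ?thesis using True by (simp add: refines_def s'_def)
  next
    case False
    have "refines n f V (Seq d e) s' q R" using assms(3) False s' by auto
    then have "rel_spmf (\<lambda>x s'. R x (nmem s') (rmem s') \<and> mem_le V s' \<and> clock s' \<le> clock s + time_bound V (Seq (Cond b c d) e))
        (spmf_of_pmf q) (exec n f (Seq d e) s')"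
      unfolding refines_def by (rule rel_spmf_mono) (use s' in auto)
    then show ?thesis using False by (simp add: refines_def s'_def)
  qed
qed

text \<open>The number of iterations is known beforehand, so the fixed point is unfolded exactly
  \<open>m\<close> times and then exits; almost sure termination is a by-product of the
  coupling.\<close>

lemma while_spmf_refines:
  assumes body: "\<And>j x s. j < L \<Longrightarrow> I j x s \<Longrightarrow> g s \<and>
      rel_spmf (\<lambda>x' s'. I (Suc j) x' s' \<and> clock s' \<le> clock s + C) (spmf_of_pmf (b j x)) (B s)"
    and exit: "\<And>x s. I L x s \<Longrightarrow> \<not> g s"
    and "I j x s" "j + m = L"
  shows "rel_spmf (\<lambda>x' s'. I L x' s' \<and> clock s' \<le> clock s + m * C) (spmf_of_pmf (for_pmf b j m x)) (while_spmf g B s)"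
  using assms(3,4)
proof (induction m arbitrary: j x s)
  case 0
  then have "while_spmf g B s = return_spmf s"
    using exit by (subst while_spmf.simps) auto
  then show ?case using 0 by simp
next
  case (Suc m)
  have j: "j < L" using Suc.prems by simp
  have g: "g s" and r: "rel_spmf (\<lambda>x' s'. I (Suc j) x' s' \<and> clock s' \<le> clock s + C) (spmf_of_pmf (b j x)) (B s)"
    using body[OF j Suc.prems(1)] by auto
  have "rel_spmf (\<lambda>x' s'. I L x' s' \<and> clock s' \<le> clock s + Suc m * C)
      (bind_spmf (spmf_of_pmf (b j x)) (\<lambda>x. spmf_of_pmf (for_pmf b (Suc j) m x))) (bind_spmf (B s) (while_spmf g B))"
  proof (rule rel_spmf_bindI[OF r])
    fix x' s' assume *: "I (Suc j) x' s' \<and> clock s' \<le> clock s + C"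
    then have "rel_spmf (\<lambda>x' s''. I L x' s'' \<and> clock s'' \<le> clock s' + m * C) (spmf_of_pmf (for_pmf b (Suc j) m x')) (while_spmf g B s')"
      using Suc.prems by (intro Suc.IH) auto
    then show "rel_spmf (\<lambda>x' s'. I L x' s' \<and> clock s' \<le> clock s + Suc m * C) (spmf_of_pmf (for_pmf b (Suc j) m x')) (while_spmf g B s')"
      by (rule rel_spmf_mono) (use * in auto)
  qed
  moreover have "while_spmf g B s = bind_spmf (B s) (while_spmf g B)"
    using g by (subst while_spmf.simps) simp
  ultimately show ?case by (simp add: spmf_of_pmf_bind)
qed

abbreviation nvar :: "vname \<Rightarrow> nexp" where "nvar x \<equiv> NGet x (Num 0)"

definition loop :: "vname \<Rightarrow> nexp \<Rightarrow> com \<Rightarrow> com" where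
  "loop i e c = Seq (NAssign i (Num 0) (Num 0))
     (While (NLess (nvar i) e) (Seq c (NAssign i (Num 0) (NAdd (nvar i) (Num 1)))))"

text \<open>The body has to leave the counter at \<open>j\<close>; the invariant is then required of
  the memory after the increment. \<open>L \<le> V\<close> keeps the counter within the memory bound
  and justifies the factor \<open>V\<close> in \<open>time_bound\<close>.\<close>

lemma refines_loop:
  fixes I :: "nat \<Rightarrow> 'a post"
  assumes s: "mem_le V s" and L: "L \<le> V"
    and start: "I 0 x ((nmem s)(i := (nmem s i)(0 := 0))) (rmem s)"
    and bound: "\<And>j x s'. I j x (nmem s') (rmem s') \<Longrightarrow> nval s' e = L"
    and body: "\<And>j x s'. j < L \<Longrightarrow> I j x (nmem s') (rmem s') \<Longrightarrow> nmem s' i 0 = j \<Longrightarrow> mem_le V s' \<Longrightarrow>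
      refines n f V c s' (b j x) (\<lambda>x' N M. N i 0 = j \<and> I (Suc j) x' (N(i := (N i)(0 := Suc j))) M)"
  shows "refines n f V (loop i e c) s (for_pmf b 0 L x) (I L)"
proof -
  let ?b = "NLess (nvar i) e" and ?c = "Seq c (NAssign i (Num 0) (NAdd (nvar i) (Num 1)))"
  define J where "J j x s' \<longleftrightarrow> I j x (nmem s') (rmem s') \<and> nmem s' i 0 = j \<and> mem_le V s'" for j x s'
  have w: "rel_spmf (\<lambda>x' s'. J L x' s' \<and> clock s' \<le> clock s1 + L * (1 + bcost_bound V ?b + time_bound V ?c))
    (spmf_of_pmf (for_pmf b 0 L x)) (while_spmf (\<lambda>s. bval s ?b) (\<lambda>s. exec n f ?c (tick (1 + bcost s ?b) s)) s1)"
    if "J 0 x s1" for s1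
  proof (rule while_spmf_refines[where I = J and g = "\<lambda>s. bval s ?b"])
    show "J 0 x s1" by (rule that)
    show "\<not> bval s' ?b" if "J L x s'" for x s'
      using that bound[of L x s'] by (auto simp: J_def)
    fix j x' s' assume j: "j < L" and J: "J j x' s'"
    have bv: "bval s' ?b" using J j bound[of j x' s'] by (auto simp: J_def)
    define s2 where "s2 = tick (1 + bcost s' ?b) s'"
    have s2: "nmem s2 = nmem s'" "rmem s2 = rmem s'" "mem_le V s2" "clock s2 \<le> clock s' + (1 + bcost_bound V ?b)"
      using J bcost_le[of V s' ?b] by (auto simp: s2_def J_def)
    have "refines n f V c s2 (b j x') (\<lambda>x' N M. N i 0 = j \<and> I (Suc j) x' (N(i := (N i)(0 := Suc j))) M)"
      using body[OF j, of x' s2] J s2 by (auto simp: J_def)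
    then have "refines n f V ?c s2 (bind_pmf (b j x') return_pmf) (\<lambda>x' N M. N i 0 = Suc j \<and> I (Suc j) x' N M)"
    proof (rule refines_Seq)
      fix x'' s3
      assume *: "nmem s3 i 0 = j \<and> I (Suc j) x'' ((nmem s3)(i := (nmem s3 i)(0 := Suc j))) (rmem s3)" "mem_le V s3"
      then have "ncost s3 (Num 0) \<le> ncost_bound V (Num 0)" "ncost s3 (NAdd (nvar i) (Num 1)) \<le> ncost_bound V (NAdd (nvar i) (Num 1))"
        using ncost_le by blast+
      then show "refines n f V (NAssign i (Num 0) (NAdd (nvar i) (Num 1))) s3 (return_pmf x'')
          (\<lambda>x' N M. N i 0 = Suc j \<and> I (Suc j) x' N M)"
        using * j L by (auto simp: refines_def mem_le_nupd simp del: ncost.simps ncost_bound.simps)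
    qed
    then have "rel_spmf (\<lambda>x' s'a. J (Suc j) x' s'a \<and> clock s'a \<le> clock s' + (1 + bcost_bound V ?b + time_bound V ?c))
        (spmf_of_pmf (b j x')) (exec n f ?c s2)"
      unfolding refines_def bind_return_pmf'
      by (rule rel_spmf_mono) (use s2 in \<open>auto simp: J_def\<close>)
    then show "bval s' ?b \<and> rel_spmf (\<lambda>x' s'a. J (Suc j) x' s'a \<and> clock s'a \<le> clock s' + (1 + bcost_bound V ?b + time_bound V ?c))
        (spmf_of_pmf (b j x')) (exec n f ?c (tick (1 + bcost s' ?b) s'))"
      using bv by (simp only: s2_def simp_thms)
  qed simp
  have "refines n f V (While ?b ?c) s1 (for_pmf b 0 L x) (I L)" if J: "J 0 x s1" for s1
  proof -
    have "L * (1 + bcost_bound V ?b + time_bound V ?c) \<le> V * (1 + bcost_bound V ?b + time_bound V ?c)" using L by (intro mult_le_mono1)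
    then have "rel_spmf (\<lambda>x' s'. I L x' (nmem s') (rmem s') \<and> mem_le V s' \<and>
        clock s' + (1 + bcost s' ?b) \<le> clock s1 + time_bound V (While ?b ?c))
      (spmf_of_pmf (for_pmf b 0 L x)) (while_spmf (\<lambda>s. bval s ?b) (\<lambda>s. exec n f ?c (tick (1 + bcost s ?b) s)) s1)"
    proof (intro rel_spmf_mono[OF w[OF J]])
      fix x' s'
      assume a: "L * (1 + bcost_bound V ?b + time_bound V ?c) \<le> V * (1 + bcost_bound V ?b + time_bound V ?c)"
        and "J L x' s' \<and> clock s' \<le> clock s1 + L * (1 + bcost_bound V ?b + time_bound V ?c)"
      moreover from this(2) have "mem_le V s'" by (simp add: J_def)
      then have "bcost s' ?b \<le> bcost_bound V ?b" by (rule bcost_le)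
      ultimately show "I L x' (nmem s') (rmem s') \<and> mem_le V s' \<and>
        clock s' + (1 + bcost s' ?b) \<le> clock s1 + time_bound V (While ?b ?c)"
        unfolding J_def time_bound.simps by linarith
    qed
    then show ?thesis by (simp add: refines_def spmf_rel_map)
  qed
  then show ?thesis
    unfolding loop_def
    by (intro refines_NAssign s) (use start in \<open>auto simp: J_def\<close>)
qed

primrec seq :: "com list \<Rightarrow> com" where
  "seq [] = Skip"
| "seq (c # cs) = Seq c (seq cs)"

text \<open>A frame condition on whole arrays, so that frames compose by collecting the names that a
  program writes.\<close>

definition eq_off :: "vname set \<Rightarrow> (vname \<Rightarrow> nat \<Rightarrow> 'a) \<Rightarrow> (vname \<Rightarrow> nat \<Rightarrow> 'a) \<Rightarrow> bool" where
  "eq_off A N N0 \<longleftrightarrow> (\<forall>z. z \<notin> A \<longrightarrow> N z = N0 z)"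

lemma eq_offD: "eq_off A N N0 \<Longrightarrow> z \<notin> A \<Longrightarrow> N z = N0 z"
  by (simp add: eq_off_def)

lemma eq_off_refl [simp]: "eq_off A N N"
  by (simp add: eq_off_def)

lemma eq_off_upd [simp]: "z \<in> A \<Longrightarrow> eq_off A (N(z := a)) N0 = eq_off A N N0"
  by (auto simp: eq_off_def)

lemma eq_off_mono: "eq_off A N N0 \<Longrightarrow> A \<subseteq> B \<Longrightarrow> eq_off B N N0"
  by (auto simp: eq_off_def)

lemma for_pmf_return: "for_pmf (\<lambda>_. return_pmf) j m x = return_pmf x"
  by (induction m arbitrary: j) (auto simp: bind_return_pmf)

lemma refines_loop_det:
  assumes s: "mem_le V s" and L: "L \<le> V"
    and start: "I 0 ((nmem s)(i := (nmem s i)(0 := 0))) (rmem s)"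
    and bound: "\<And>j s'. I j (nmem s') (rmem s') \<Longrightarrow> nval s' e = L"
    and body: "\<And>j s'. j < L \<Longrightarrow> I j (nmem s') (rmem s') \<Longrightarrow> nmem s' i 0 = j \<Longrightarrow> mem_le V s' \<Longrightarrow>
      refines n f V c s' (return_pmf ()) (\<lambda>_ N M. N i 0 = j \<and> I (Suc j) (N(i := (N i)(0 := Suc j))) M)"
  shows "refines n f V (loop i e c) s (return_pmf ()) (\<lambda>_. I L)"
  using refines_loop[of V s L "\<lambda>j (_::unit). I j" "()" i e n f c "\<lambda>_. return_pmf"] assms
  by (simp add: for_pmf_return)

lemma refines_Random_map:
  assumes "mem_le V s" "nval s a = m" "m \<le> V"
    and "\<And>v s'. v \<le> m \<Longrightarrow> nmem s' = (nmem s)(x := (nmem s x)(0 := v)) \<Longrightarrow> rmem s' = rmem s \<Longrightarrow>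
      mem_le V s' \<Longrightarrow> refines n f V d s' (return_pmf (h v)) R"
  shows "refines n f V (Seq (Random x a) d) s (map_pmf h (pmf_of_set {0..m})) R"
  unfolding map_pmf_def assms(2)[symmetric]
  by (rule refines_Random) (use assms in auto)

lemma refines_Seq_Skip:
  assumes "refines n f V c s p R"
  shows "refines n f V (Seq c Skip) s p R"
proof -
  have "refines n f V (Seq c Skip) s (bind_pmf p return_pmf) R"
    by (rule refines_Seq[OF assms refines_Skip])
  then show ?thesis by (simp add: bind_return_pmf')
qed

lemma refines_Seq_map:
  assumes c: "refines n f V c s p R"
    and d: "\<And>x s'. R x (nmem s') (rmem s') \<Longrightarrow> mem_le V s' \<Longrightarrow> refines n f V d s' (return_pmf (h x)) R'"
  shows "refines n f V (Seq c d) s (map_pmf h p) R'"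
  unfolding map_pmf_def by (rule refines_Seq[OF c d])

abbreviation nget :: "vname \<Rightarrow> vname \<Rightarrow> nexp" where "nget x i \<equiv> NGet x (nvar i)"
abbreviation rget :: "vname \<Rightarrow> vname \<Rightarrow> rexp" where "rget x i \<equiv> RGet x (nvar i)"
abbreviation nset :: "vname \<Rightarrow> nexp \<Rightarrow> com" where "nset x e \<equiv> NAssign x (Num 0) e"

subsection \<open>The program\<close>

definition sum_prog :: com where
  "sum_prog = seq [nset ''t'' (Num 0),
     loop ''u'' (nvar ''n'') (seq [nset ''t'' (NAdd (nvar ''t'') (nget ''y'' ''u''))])]"

lemma sum_le_mult: "(\<And>u. u < n \<Longrightarrow> Y u \<le> (Q::nat)) \<Longrightarrow> m \<le> n \<Longrightarrow> (\<Sum>u<m. Y u) \<le> n * Q"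
  using sum_bounded_above[of "{..<m}" Y Q] mult_le_mono1[of m n Q] by (auto intro: le_trans)

lemma refines_sum:
  assumes s: "mem_le V s" and n: "nmem s ''n'' 0 = n" and y: "\<And>u. u < n \<Longrightarrow> nmem s ''y'' u \<le> Q"
    and V: "n * Q \<le> V" "n \<le> V"
  shows "refines n f V sum_prog s (return_pmf ()) (\<lambda>_ N M. eq_off {''t'', ''u''} N (nmem s) \<and>
    N ''t'' 0 = (\<Sum>u<n. nmem s ''y'' u))"
  unfolding sum_prog_def seq.simps
proof (rule refines_NAssign[OF s])
  fix s1 assume s1: "nmem s1 = (nmem s)(''t'' := (nmem s ''t'')(nval s (Num 0) := nval s (Num 0)))" "mem_le V s1"
  let ?I = "\<lambda>j N (M :: vname \<Rightarrow> nat \<Rightarrow> real). eq_off {''t'', ''u''} N (nmem s) \<and> N ''t'' 0 = (\<Sum>u<j. nmem s ''y'' u)"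
  show "refines n f V (Seq (loop ''u'' (nvar ''n'') (Seq (nset ''t'' (NAdd (nvar ''t'') (nget ''y'' ''u''))) Skip)) Skip)
      s1 (return_pmf ()) (\<lambda>_. ?I n)"
  proof (rule refines_Seq_det[OF refines_loop_det[where L = n and I = ?I]])
    fix j s' assume j: "j < n" and I: "?I j (nmem s') (rmem s')" and u: "nmem s' ''u'' 0 = j" and m: "mem_le V s'"
    note fr = eq_offD[OF conjunct1[OF I]]
    have "(\<Sum>u<Suc j. nmem s ''y'' u) \<le> V"
      using sum_le_mult[of n "nmem s ''y''" Q "Suc j"] y j V by auto
    then show "refines n f V (Seq (nset ''t'' (NAdd (nvar ''t'') (nget ''y'' ''u''))) Skip) s' (return_pmf ())
        (\<lambda>_ N M. N ''u'' 0 = j \<and> ?I (Suc j) (N(''u'' := (N ''u'')(0 := Suc j))) M)"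
      using I u by (intro refines_NAssign m refines_Skip) (auto simp: fr)
  qed (use s1 n V in \<open>auto simp: eq_off_def intro!: refines_Skip\<close>)
qed simp

text \<open>Every position is written, so an earlier sample in the same array leaves no trace. The
  bound is \<open>q - 1\<close> because \<open>Random\<close> includes its upper end.\<close>

definition sample_prog :: com where
  "sample_prog = loop ''u'' (nvar ''n'') (seq [Random ''a'' (NSub (nvar ''q'') (Num 1)),
     Cond (NLess (nvar ''a'') (nget ''y'' ''u'')) (NAssign ''s'' (nvar ''u'') (Num 1)) (NAssign ''s'' (nvar ''u'') (Num 0))])"

definition holds_set :: "nat \<Rightarrow> nat set \<Rightarrow> (nat \<Rightarrow> nat) \<Rightarrow> bool" where
  "holds_set n S a \<longleftrightarrow> S \<subseteq> {..<n} \<and> (\<forall>u<n. a u = (if u \<in> S then 1 else 0))"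

lemma refines_sample:
  assumes s: "mem_le V s" and n: "nmem s ''n'' 0 = n" and q: "nmem s ''q'' 0 = Q" and y: "nmem s ''y'' = Y"
    and V: "n \<le> V" "1 \<le> V"
  shows "refines n f V sample_prog s (sample_set Y Q n)
    (\<lambda>S N M. eq_off {''u'', ''a'', ''s''} N (nmem s) \<and> M = rmem s \<and> holds_set n S (N ''s''))"
proof -
  let ?I = "\<lambda>j S N M. eq_off {''u'', ''a'', ''s''} N (nmem s) \<and> M = rmem s \<and> holds_set j S (N ''s'')"
  show ?thesis
    unfolding sample_prog_def sample_set_def seq.simps
  proof (rule refines_loop[where I = ?I])
    fix j S s' assume j: "j < n" and I: "?I j S (nmem s') (rmem s')" and u: "nmem s' ''u'' 0 = j" and m: "mem_le V s'"
    note fr = eq_offD[OF conjunct1[OF I]]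
    have "nmem s' ''q'' 0 \<le> V" using m by (simp add: mem_le_def)
    then have Q: "Q - 1 \<le> V" using fr[of "''q''"] q by simp
    have S: "S \<subseteq> {..<j}" "\<forall>u<j. nmem s' ''s'' u = (if u \<in> S then 1 else 0)"
      using I by (auto simp: holds_set_def)
    then have "j \<notin> S" by auto
    show "refines n f V (Seq (Random ''a'' (NSub (nvar ''q'') (Num 1)))
        (Seq (Cond (NLess (nvar ''a'') (nget ''y'' ''u'')) (NAssign ''s'' (nvar ''u'') (Num 1)) (NAssign ''s'' (nvar ''u'') (Num 0))) Skip))
        s' (map_pmf (\<lambda>a. if a < Y j then insert j S else S) (pmf_of_set {0..Q - 1}))
        (\<lambda>S N M. N ''u'' 0 = j \<and> ?I (Suc j) S (N(''u'' := (N ''u'')(0 := Suc j))) M)"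
    proof (rule refines_Random_map[OF m _ Q])
      show "nval s' (NSub (nvar ''q'') (Num 1)) = Q - 1" using q by (simp add: fr)
      fix v s1
      assume s1: "nmem s1 = (nmem s')(''a'' := (nmem s' ''a'')(0 := v))" "rmem s1 = rmem s'" "mem_le V s1"
      show "refines n f V (Seq (Cond (NLess (nvar ''a'') (nget ''y'' ''u'')) (NAssign ''s'' (nvar ''u'') (Num 1)) (NAssign ''s'' (nvar ''u'') (Num 0))) Skip)
        s1 (return_pmf (if v < Y j then insert j S else S))
        (\<lambda>S N M. N ''u'' 0 = j \<and> ?I (Suc j) S (N(''u'' := (N ''u'')(0 := Suc j))) M)"
      proof (rule refines_Cond[OF s1(3)])
        fix s2 assume s2: "bval s1 (NLess (nvar ''a'') (nget ''y'' ''u''))" "nmem s2 = nmem s1" "rmem s2 = rmem s1" "mem_le V s2"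
        have "v < Y j" using s2(1) s1 u y by (simp add: fr)
        then show "refines n f V (Seq (NAssign ''s'' (nvar ''u'') (Num 1)) Skip) s2 (return_pmf (if v < Y j then insert j S else S))
          (\<lambda>S N M. N ''u'' 0 = j \<and> ?I (Suc j) S (N(''u'' := (N ''u'')(0 := Suc j))) M)"
          using I u s1 s2 S V by (intro refines_NAssign refines_Skip s2) (auto simp: holds_set_def less_Suc_eq)
      next
        fix s2 assume s2: "\<not> bval s1 (NLess (nvar ''a'') (nget ''y'' ''u''))" "nmem s2 = nmem s1" "rmem s2 = rmem s1" "mem_le V s2"
        have "\<not> v < Y j" using s2(1) s1 u y by (simp add: fr)
        then show "refines n f V (Seq (NAssign ''s'' (nvar ''u'') (Num 0)) Skip) s2 (return_pmf (if v < Y j then insert j S else S))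
          (\<lambda>S N M. N ''u'' 0 = j \<and> ?I (Suc j) S (N(''u'' := (N ''u'')(0 := Suc j))) M)"
          using I u s1 s2 S V \<open>j \<notin> S\<close> by (intro refines_NAssign refines_Skip s2) (auto simp: holds_set_def less_Suc_eq)
      qed
    qed
  qed (use s n V in \<open>auto simp: eq_off_def holds_set_def\<close>)
qed

text \<open>A single characteristic array serves all \<open>2 * n + 1\<close> queries: the old entry
  is kept in \<open>''o''\<close>, replaced by 1 and by 0 for the two marginals, and put
  back.\<close>

definition eval_prog :: com where
  "eval_prog = seq [Query ''b'' ''s'',
     loop ''u'' (nvar ''n'') (seq [nset ''o'' (nget ''s'' ''u''),
       NAssign ''s'' (nvar ''u'') (Num 1), Query ''v'' ''s'',
       RAssign ''G'' (nvar ''u'') (RAdd (rget ''G'' ''u'') (RSub (RGet ''v'' (Num 0)) (RGet ''b'' (Num 0)))),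
       NAssign ''s'' (nvar ''u'') (Num 0), Query ''v'' ''s'',
       RAssign ''H'' (nvar ''u'') (RAdd (rget ''H'' ''u'') (RSub (RGet ''v'' (Num 0)) (RGet ''b'' (Num 0)))),
       NAssign ''s'' (nvar ''u'') (nvar ''o'')])]"

lemma holds_set_eq: "holds_set n S a \<Longrightarrow> {i. i < n \<and> a i \<noteq> 0} = S"
  by (auto simp: holds_set_def split: if_splits)

lemma holds_set_insert: "holds_set n S a \<Longrightarrow> u < n \<Longrightarrow> {i. i < n \<and> (a(u := Suc 0)) i \<noteq> 0} = insert u S"
  by (auto simp: holds_set_def split: if_splits)

lemma holds_set_remove: "holds_set n S a \<Longrightarrow> {i. i < n \<and> (a(u := 0)) i \<noteq> 0} = S - {u}"
  by (auto simp: holds_set_def split: if_splits)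

lemma refines_eval:
  assumes s: "mem_le V s" and n: "nmem s ''n'' 0 = n" and S: "holds_set n S (nmem s ''s'')"
    and V: "n \<le> V" "1 \<le> V"
  shows "refines n f V eval_prog s (return_pmf ())
    (\<lambda>_ N M. eq_off {''u'', ''o'', ''s''} N (nmem s) \<and>
      (\<forall>u<n. M ''G'' u = rmem s ''G'' u + (f (insert u S) - f S) \<and> M ''H'' u = rmem s ''H'' u + (f (S - {u}) - f S)))"
  unfolding eval_prog_def seq.simps
proof (rule refines_Query[OF s V(1)])
  fix s1 assume s1: "nmem s1 = nmem s" "rmem s1 = (rmem s)(''b'' := (rmem s ''b'')(0 := f {i. i < n \<and> nmem s ''s'' i \<noteq> 0}))" "mem_le V s1"
  \<comment> \<open>The clause on positions from \<open>j\<close> on tells which old value an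
    accumulator update reads.\<close>
  let ?I = "\<lambda>j N M. eq_off {''u'', ''o'', ''s''} N (nmem s) \<and> holds_set n S (N ''s'') \<and> M ''b'' 0 = f S \<and>
    (\<forall>u<j. M ''G'' u = rmem s ''G'' u + (f (insert u S) - f S) \<and> M ''H'' u = rmem s ''H'' u + (f (S - {u}) - f S)) \<and>
    (\<forall>u. j \<le> u \<longrightarrow> M ''G'' u = rmem s ''G'' u \<and> M ''H'' u = rmem s ''H'' u)"
  let ?c = "Seq (nset ''o'' (nget ''s'' ''u''))
       (Seq (NAssign ''s'' (nvar ''u'') (Num 1)) (Seq (Query ''v'' ''s'')
       (Seq (RAssign ''G'' (nvar ''u'') (RAdd (rget ''G'' ''u'') (RSub (RGet ''v'' (Num 0)) (RGet ''b'' (Num 0)))))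
       (Seq (NAssign ''s'' (nvar ''u'') (Num 0)) (Seq (Query ''v'' ''s'')
       (Seq (RAssign ''H'' (nvar ''u'') (RAdd (rget ''H'' ''u'') (RSub (RGet ''v'' (Num 0)) (RGet ''b'' (Num 0)))))
       (Seq (NAssign ''s'' (nvar ''u'') (nvar ''o'')) Skip)))))))"
  show "refines n f V (Seq (loop ''u'' (nvar ''n'') ?c) Skip) s1 (return_pmf ())
    (\<lambda>_ N M. eq_off {''u'', ''o'', ''s''} N (nmem s) \<and>
      (\<forall>u<n. M ''G'' u = rmem s ''G'' u + (f (insert u S) - f S) \<and> M ''H'' u = rmem s ''H'' u + (f (S - {u}) - f S)))"
  proof (rule refines_Seq_det[OF refines_loop_det[where L = n and I = ?I]])
    fix j s' assume j: "j < n" and I: "?I j (nmem s') (rmem s')" and u: "nmem s' ''u'' 0 = j" and m: "mem_le V s'"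
    have S': "holds_set n S (nmem s' ''s'')" using I by simp
    have sj: "nmem s' ''s'' j \<le> V" using m by (simp add: mem_le_def)
    show "refines n f V ?c s' (return_pmf ()) (\<lambda>_ N M. N ''u'' 0 = j \<and> ?I (Suc j) (N(''u'' := (N ''u'')(0 := Suc j))) M)"
      apply (rule refines_NAssign[OF m])
       apply (simp add: u sj)
      apply (rule refines_NAssign, assumption, use V in simp)
      apply (rule refines_Query, assumption, rule V)
      apply (rule refines_RAssign, assumption)
      apply (rule refines_NAssign, assumption, simp)
      apply (rule refines_Query, assumption, rule V)
      apply (rule refines_RAssign, assumption)
      apply (rule refines_NAssign, assumption, simp add: u sj)
      apply (rule refines_Skip, assumption)
      using I u S' j
      apply (simp add: holds_set_insert[OF S' j, simplified] holds_set_remove[OF S', simplified] less_Suc_eq)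
      done
  next
    have "rmem s1 ''b'' 0 = f S" "rmem s1 ''G'' = rmem s ''G''" "rmem s1 ''H'' = rmem s ''H''"
      using s1(2) holds_set_eq[OF S] by auto
    then show "?I 0 ((nmem s1)(''u'' := (nmem s1 ''u'')(0 := 0))) (rmem s1)"
      using S s1(1) by auto
  qed (use s1 n V S in \<open>auto simp: eq_off_def intro!: refines_Skip\<close>)
qed

definition estimate_prog :: com where
  "estimate_prog = seq [
     loop ''u'' (nvar ''n'') (seq [RAssign ''G'' (nvar ''u'') RZero, RAssign ''H'' (nvar ''u'') RZero]),
     loop ''r'' (NMul (NMul (nvar ''w'') (nvar ''w'')) (nvar ''w'')) (seq [sample_prog, eval_prog])]"

context symmetric_submodular
begin

lemma refines_estimate:
  assumes s: "mem_le V s" and n: "nmem s ''n'' 0 = n" and q: "nmem s ''q'' 0 = Q" and y: "nmem s ''y'' = Y"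
    and w: "nmem s ''w'' 0 = w" and V: "n \<le> V" "1 \<le> V" "w * w * w \<le> V"
  shows "refines n f V estimate_prog s (estimate Y Q (w * w * w))
    (\<lambda>gh N M. eq_off {''u'', ''a'', ''s'', ''o'', ''r''} N (nmem s) \<and> (\<forall>u<n. M ''G'' u = fst gh u \<and> M ''H'' u = snd gh u))"
  unfolding estimate_prog_def seq.simps
proof (rule refines_Seq_det[where x = "()"])
  let ?I = "\<lambda>j N M. eq_off {''u''} N (nmem s) \<and> (\<forall>u<j. M ''G'' u = (0::real) \<and> M ''H'' u = 0)"
  let ?c = "Seq (RAssign ''G'' (nvar ''u'') RZero) (Seq (RAssign ''H'' (nvar ''u'') RZero) Skip)"
  show "refines n f V (loop ''u'' (nvar ''n'') ?c) s (return_pmf ()) (\<lambda>_. ?I n)"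
  proof (rule refines_loop_det)
    fix j s' assume I: "?I j (nmem s') (rmem s')" and u: "nmem s' ''u'' 0 = j" and m: "mem_le V s'"
    show "refines n f V ?c s' (return_pmf ()) (\<lambda>_ N M. N ''u'' 0 = j \<and> ?I (Suc j) (N(''u'' := (N ''u'')(0 := Suc j))) M)"
      using I u by (intro refines_RAssign refines_Skip m) (auto simp: less_Suc_eq)
  qed (use s n V in \<open>auto simp: eq_off_def\<close>)
next
  fix s1 :: state
  assume s1: "eq_off {''u''} (nmem s1) (nmem s) \<and> (\<forall>u<n. rmem s1 ''G'' u = (0::real) \<and> rmem s1 ''H'' u = 0)" "mem_le V s1"
  let ?A = "{''u'', ''a'', ''s'', ''o'', ''r''}"
  let ?J = "\<lambda>(j::nat) gh N M. eq_off ?A N (nmem s) \<and> (\<forall>u<n. M ''G'' u = fst gh u \<and> M ''H'' u = snd gh u)"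
  have "refines n f V (loop ''r'' (NMul (NMul (nvar ''w'') (nvar ''w'')) (nvar ''w'')) (Seq sample_prog (Seq eval_prog Skip)))
      s1 (estimate Y Q (w * w * w)) (?J (w * w * w))"
    unfolding estimate_def
  proof (rule refines_loop[where I = ?J])
    show "?J 0 (\<lambda>_. 0, \<lambda>_. 0) ((nmem s1)(''r'' := (nmem s1 ''r'')(0 := 0))) (rmem s1)"
      using s1 by (auto intro: eq_off_mono)
    fix j and gh :: "(nat \<Rightarrow> real) \<times> (nat \<Rightarrow> real)" and s2
    assume J: "?J j gh (nmem s2) (rmem s2)" and r: "nmem s2 ''r'' 0 = j" and m: "mem_le V s2"
    note fr = eq_offD[OF conjunct1[OF J]]
    show "refines n f V (Seq sample_prog (Seq eval_prog Skip)) s2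
        (map_pmf (\<lambda>S. (\<lambda>u. fst gh u + (f (insert u S) - f S), \<lambda>u. snd gh u + (f (S - {u}) - f S))) (sample_set Y Q n))
        (\<lambda>gh N M. N ''r'' 0 = j \<and> ?J (Suc j) gh (N(''r'' := (N ''r'')(0 := Suc j))) M)"
    proof (rule refines_Seq_map[OF refines_sample[OF m]])
      fix S s3
      assume s3: "eq_off {''u'', ''a'', ''s''} (nmem s3) (nmem s2) \<and> rmem s3 = rmem s2 \<and> holds_set n S (nmem s3 ''s'')"
        and m3: "mem_le V s3"
      note fr3 = eq_offD[OF conjunct1[OF s3]]
      show "refines n f V (Seq eval_prog Skip) s3
          (return_pmf (\<lambda>u. fst gh u + (f (insert u S) - f S), \<lambda>u. snd gh u + (f (S - {u}) - f S)))
          (\<lambda>gh N M. N ''r'' 0 = j \<and> ?J (Suc j) gh (N(''r'' := (N ''r'')(0 := Suc j))) M)"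
      proof (rule refines_Seq_det[OF refines_eval[OF m3 _ _ V(1,2)]])
        show "nmem s3 ''n'' 0 = n" using n by (simp add: fr fr3)
        show "holds_set n S (nmem s3 ''s'')" using s3 by simp
        fix s4
        assume s4: "eq_off {''u'', ''o'', ''s''} (nmem s4) (nmem s3) \<and> (\<forall>u<n. rmem s4 ''G'' u = rmem s3 ''G'' u + (f (insert u S) - f S)
             \<and> rmem s4 ''H'' u = rmem s3 ''H'' u + (f (S - {u}) - f S))" and m4: "mem_le V s4"
        note fr4 = eq_offD[OF conjunct1[OF s4]]
        have "eq_off ?A (nmem s4) (nmem s)"
          using s4 s3 J unfolding eq_off_def by simp
        moreover have "nmem s4 ''r'' 0 = j" using r by (simp add: fr3 fr4)
        ultimately show "refines n f V Skip s4
          (return_pmf (\<lambda>u. fst gh u + (f (insert u S) - f S), \<lambda>u. snd gh u + (f (S - {u}) - f S)))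
          (\<lambda>gh N M. N ''r'' 0 = j \<and> ?J (Suc j) gh (N(''r'' := (N ''r'')(0 := Suc j))) M)"
          using s4 s3 J m4 by (intro refines_Skip) auto
      qed
    qed (use n q y V in \<open>auto simp: fr\<close>)
  qed (use s1 V w in \<open>auto simp: eq_off_def\<close>)
  then show "refines n f V (Seq (loop ''r'' (NMul (NMul (nvar ''w'') (nvar ''w'')) (nvar ''w'')) (Seq sample_prog (Seq eval_prog Skip))) Skip)
      s1 (estimate Y Q (w * w * w)) (\<lambda>gh N M. eq_off ?A N (nmem s) \<and> (\<forall>u<n. M ''G'' u = fst gh u \<and> M ''H'' u = snd gh u))"
    by (rule refines_Seq_Skip)
qed

end

text \<open>Here \<open>''b''\<close> is an index in the natural-number memory; the base value of
  the same name lives in the real memory.\<close>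

definition best_prog :: com where
  "best_prog = seq [nset ''b'' (Num 0), nset ''c'' (Num 0),
     loop ''u'' (nvar ''n'') (seq [
       Cond (RLess (rget ''G'' ''b'') (rget ''G'' ''u'')) (nset ''b'' (nvar ''u'')) Skip,
       Cond (RLess (rget ''H'' ''c'') (rget ''H'' ''u'')) (nset ''c'' (nvar ''u'')) Skip])]"

lemma refines_best:
  assumes s: "mem_le V s" and n: "nmem s ''n'' 0 = n" and V: "n \<le> V"
  shows "refines n f V best_prog s (return_pmf ()) (\<lambda>_ N M. eq_off {''b'', ''c'', ''u''} N (nmem s) \<and>
    N ''b'' 0 = arg_best (rmem s ''G'') n \<and> N ''c'' 0 = arg_best (rmem s ''H'') n)"
  unfolding best_prog_def seq.simps
proof (rule refines_NAssign[OF s], simp, rule refines_NAssign, assumption, simp)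
  fix s0 s1
  assume s0: "nmem s0 = (nmem s)(''b'' := (nmem s ''b'')(nval s (Num 0) := nval s (Num 0)))" "rmem s0 = rmem s"
    and s1: "nmem s1 = (nmem s0)(''c'' := (nmem s0 ''c'')(nval s0 (Num 0) := nval s0 (Num 0)))" "rmem s1 = rmem s0" "mem_le V s1"
  let ?I = "\<lambda>j N M. eq_off {''b'', ''c'', ''u''} N (nmem s) \<and> M = rmem s \<and>
    N ''b'' 0 = arg_best (rmem s ''G'') j \<and> N ''c'' 0 = arg_best (rmem s ''H'') j"
  let ?d = "Seq (Cond (RLess (rget ''H'' ''c'') (rget ''H'' ''u'')) (nset ''c'' (nvar ''u'')) Skip) Skip"
  let ?c = "Seq (Cond (RLess (rget ''G'' ''b'') (rget ''G'' ''u'')) (nset ''b'' (nvar ''u'')) Skip) ?d"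
  show "refines n f V (Seq (loop ''u'' (nvar ''n'') ?c) Skip) s1 (return_pmf ()) (\<lambda>_ N M. eq_off {''b'', ''c'', ''u''} N (nmem s) \<and>
    N ''b'' 0 = arg_best (rmem s ''G'') n \<and> N ''c'' 0 = arg_best (rmem s ''H'') n)"
  proof (rule refines_Seq_det[OF refines_loop_det[where L = n and I = ?I]])
    fix j s' assume j: "j < n" and I: "?I j (nmem s') (rmem s')" and u: "nmem s' ''u'' 0 = j" and m: "mem_le V s'"
    let ?R = "\<lambda>(_::unit) N M. N ''u'' 0 = j \<and> ?I (Suc j) (N(''u'' := (N ''u'')(0 := Suc j))) M"
    have jV: "j \<le> V" using j V by simp
    have d: "refines n f V ?d s2 (return_pmf ()) ?R"
      if s2: "nmem s2 ''u'' 0 = j" "eq_off {''b'', ''c'', ''u''} (nmem s2) (nmem s)" "rmem s2 = rmem s"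
        "nmem s2 ''b'' 0 = arg_best (rmem s ''G'') (Suc j)" "nmem s2 ''c'' 0 = arg_best (rmem s ''H'') j" "mem_le V s2" for s2
      by (intro refines_Cond refines_NAssign refines_Skip_Seq refines_Skip; (assumption | use that jV in auto))
    show "refines n f V ?c s' (return_pmf ()) ?R"
      by (intro refines_Cond refines_NAssign refines_Skip_Seq d; (assumption | use I u m jV in auto))
  qed (use s0 s1 n V in \<open>auto simp: eq_off_def intro!: refines_Skip\<close>)
qed

lemma arg_best_cong: "(\<And>u. u < m \<Longrightarrow> g u = h u) \<Longrightarrow> arg_best g m = arg_best h m"
proof (induction m)
  case (Suc m)
  have "arg_best h m < Suc m" using arg_best_less[of m h] by (cases m) auto
  then show ?case using Suc by auto
qed simp

definition move_prog :: com where
  "move_prog = seq [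
     NAssign ''y'' (nvar ''b'') (NAdd (nget ''y'' ''b'') (NDiv (NSub (nvar ''q'') (nget ''y'' ''b'')) (nvar ''w''))),
     NAssign ''y'' (nvar ''c'') (NSub (nget ''y'' ''c'') (NDiv (nget ''y'' ''c'') (nvar ''w'')))]"

lemma nval_NSub_NGet_le: "mem_le V s \<Longrightarrow> nval s (NSub (NGet x i) e) \<le> V"
  using nval_le[of V s "NSub (NGet x i) e"] by simp

lemma refines_move:
  assumes s: "mem_le V s" and q: "nmem s ''q'' 0 = Q" and w: "nmem s ''w'' 0 = w" and y: "nmem s ''y'' = Y"
    and b: "nmem s ''b'' 0 = u" and c: "nmem s ''c'' 0 = v" and Yu: "Y u \<le> Q"
  shows "refines n f V move_prog s (return_pmf (move w Q Y u v))
    (\<lambda>Y' N M. eq_off {''y''} N (nmem s) \<and> N ''y'' = Y')"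
proof -
  have "nmem s ''q'' 0 \<le> V" using s by (simp add: mem_le_def)
  then have Q: "Q \<le> V" using q by simp
  have 1: "Y u + (Q - Y u) div w \<le> V"
    using Yu Q div_le_dividend[of "Q - Y u" w] by linarith
  show ?thesis
    unfolding move_prog_def seq.simps
    apply (rule refines_NAssign[OF s])
     apply (simp add: q w y b 1)
    apply (rule refines_NAssign, assumption, erule nval_NSub_NGet_le)
    apply (rule refines_Skip, assumption)
    apply (simp add: move_def Let_def q w y b c)
    done
qed

definition round_prog :: com where
  "round_prog = seq [sum_prog,
     Cond (NLess (NAdd (nvar ''t'') (nvar ''w'')) (NMul (nvar ''m'') (nvar ''q'')))
       (seq [estimate_prog, best_prog, move_prog]) Skip]"

definition greedy_prog :: com where
  "greedy_prog = loop ''i'' (NMul (NMul (Num 2) (nvar ''n'')) (nvar ''w'')) round_prog"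

context symmetric_submodular
begin

lemma refines_round:
  assumes s: "mem_le V s" and n: "nmem s ''n'' 0 = n" and q: "nmem s ''q'' 0 = w * w" and y: "nmem s ''y'' = Y"
    and w: "nmem s ''w'' 0 = w" and m: "nmem s ''m'' 0 = k" and Y: "\<And>u. u < n \<Longrightarrow> Y u \<le> w * w" and n0: "0 < n"
    and V: "n \<le> V" "1 \<le> V" "w * w * w \<le> V" "n * (w * w) \<le> V"
  shows "refines n f V round_prog s (greedy_round k w Y)
    (\<lambda>Y' N M. eq_off {''t'', ''u'', ''a'', ''s'', ''o'', ''r'', ''b'', ''c'', ''y''} N (nmem s) \<and> N ''y'' = Y')"
  unfolding round_prog_def seq.simps
proof (rule refines_Seq_det[OF refines_sum[OF s n _ V(4,1)]])
  let ?A = "{''t'', ''u'', ''a'', ''s'', ''o'', ''r'', ''b'', ''c'', ''y''}"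
  show "nmem s ''y'' u \<le> w * w" if "u < n" for u using Y[OF that] y by simp
  fix s1 assume s1: "eq_off {''t'', ''u''} (nmem s1) (nmem s) \<and> nmem s1 ''t'' 0 = (\<Sum>u<n. nmem s ''y'' u)" and m1: "mem_le V s1"
  note fr1 = eq_offD[OF conjunct1[OF s1]]
  let ?b = "NLess (NAdd (nvar ''t'') (nvar ''w'')) (NMul (nvar ''m'') (nvar ''q''))"
  have b: "bval s1 ?b \<longleftrightarrow> (\<Sum>u<n. Y u) + w < k * (w * w)"
    using s1 w m q y by (simp add: fr1)
  show "refines n f V (Seq (Cond ?b (Seq estimate_prog (Seq best_prog (Seq move_prog Skip))) Skip) Skip) s1
      (greedy_round k w Y) (\<lambda>Y' N M. eq_off ?A N (nmem s) \<and> N ''y'' = Y')"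
  proof (rule refines_Cond[OF m1])
    fix s2 assume s2: "bval s1 ?b" "nmem s2 = nmem s1" "rmem s2 = rmem s1" "mem_le V s2"
    have gr: "greedy_round k w Y = map_pmf (\<lambda>gh. move w (w * w) Y (arg_best (fst gh) n) (arg_best (snd gh) n))
       (estimate Y (w * w) (w * w * w))"
      using s2(1) b by (simp add: greedy_round_def)
    show "refines n f V (Seq (Seq estimate_prog (Seq best_prog (Seq move_prog Skip))) Skip) s2 (greedy_round k w Y)
        (\<lambda>Y' N M. eq_off ?A N (nmem s) \<and> N ''y'' = Y')"
      unfolding gr
    proof (rule refines_Seq_assoc, rule refines_Seq_map[OF refines_estimate[OF s2(4)]])
      fix gh s3
      assume s3: "eq_off {''u'', ''a'', ''s'', ''o'', ''r''} (nmem s3) (nmem s2) \<and> (\<forall>u<n. rmem s3 ''G'' u = fst gh u \<and> rmem s3 ''H'' u = snd gh u)"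
        and m3: "mem_le V s3"
      note fr3 = eq_offD[OF conjunct1[OF s3]]
      define u where "u = arg_best (fst gh) n"
      define v where "v = arg_best (snd gh) n"
      have uv: "arg_best (rmem s3 ''G'') n = u" "arg_best (rmem s3 ''H'') n = v"
        unfolding u_def v_def by (rule arg_best_cong, use s3 in simp)+
      have un: "u < n" using n0 arg_best_less by (auto simp: u_def)
      show "refines n f V (Seq (Seq best_prog (Seq move_prog Skip)) Skip) s3 (return_pmf (move w (w * w) Y u v))
          (\<lambda>Y' N M. eq_off ?A N (nmem s) \<and> N ''y'' = Y')"
      proof (rule refines_Seq_assoc, rule refines_Seq_det[OF refines_best[OF m3 _ V(1)]])
        show "nmem s3 ''n'' 0 = n" using n s2 by (simp add: fr1 fr3)
        fix s4
        assume s4: "eq_off {''b'', ''c'', ''u''} (nmem s4) (nmem s3) \<and>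
          nmem s4 ''b'' 0 = arg_best (rmem s3 ''G'') n \<and> nmem s4 ''c'' 0 = arg_best (rmem s3 ''H'') n" and m4: "mem_le V s4"
        note fr4 = eq_offD[OF conjunct1[OF s4]]
        show "refines n f V (Seq (Seq move_prog Skip) Skip) s4 (return_pmf (move w (w * w) Y u v))
          (\<lambda>Y' N M. eq_off ?A N (nmem s) \<and> N ''y'' = Y')"
        proof (rule refines_Seq_assoc, rule refines_Seq_det[OF refines_move[OF m4]])
          fix s5 assume s5: "eq_off {''y''} (nmem s5) (nmem s4) \<and> nmem s5 ''y'' = move w (w * w) Y u v" and m5: "mem_le V s5"
          have "eq_off ?A (nmem s5) (nmem s)"
            using s5 s4 s3 s2(2) s1 unfolding eq_off_def by simp
          then show "refines n f V (Seq Skip Skip) s5 (return_pmf (move w (w * w) Y u v)) (\<lambda>Y' N M. eq_off ?A N (nmem s) \<and> N ''y'' = Y')"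
            using s5 m5 by (intro refines_Skip_Seq refines_Skip) auto
        qed (use s4 uv un Y q w y s2 in \<open>auto simp: fr4 fr3 fr1\<close>)
      qed
    qed (use n q w y s2 V in \<open>auto simp: fr1\<close>)
  next
    fix s2 assume s2: "\<not> bval s1 ?b" "nmem s2 = nmem s1" "rmem s2 = rmem s1" "mem_le V s2"
    have gr: "greedy_round k w Y = return_pmf Y"
      using s2(1) b by (auto simp: greedy_round_def)
    have "eq_off ?A (nmem s1) (nmem s)" using s1 unfolding eq_off_def by simp
    then show "refines n f V (Seq Skip Skip) s2 (greedy_round k w Y) (\<lambda>Y' N M. eq_off ?A N (nmem s) \<and> N ''y'' = Y')"
      unfolding gr using s2 y fr1[of "''y''"] by (intro refines_Skip_Seq refines_Skip) auto
  qed
qed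

lemma refines_greedy:
  assumes s: "mem_le V s" and n: "nmem s ''n'' 0 = n" and q: "nmem s ''q'' 0 = w * w" and y: "nmem s ''y'' = (\<lambda>_. 0)"
    and w: "nmem s ''w'' 0 = w" and m: "nmem s ''m'' 0 = k" and n0: "0 < n" "0 < w"
    and V: "n \<le> V" "1 \<le> V" "w * w * w \<le> V" "n * (w * w) \<le> V" "2 * n * w \<le> V"
  shows "refines n f V greedy_prog s (greedy k w)
    (\<lambda>Y N M. eq_off {''t'', ''u'', ''a'', ''s'', ''o'', ''r'', ''b'', ''c'', ''y'', ''i''} N (nmem s) \<and> N ''y'' = Y \<and>
       (\<forall>u<n. Y u \<le> w * w) \<and> ((\<Sum>u<n. Y u) = 0 \<or> (\<Sum>u<n. Y u) < k * (w * w)))"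
proof -
  let ?A = "{''t'', ''u'', ''a'', ''s'', ''o'', ''r'', ''b'', ''c'', ''y'', ''i''}"
  let ?I = "\<lambda>(j::nat) Y N (M :: vname \<Rightarrow> nat \<Rightarrow> real). eq_off ?A N (nmem s) \<and> N ''y'' = Y \<and> (\<forall>u<n. Y u \<le> w * w)"
  have "refines n f V greedy_prog s (greedy k w) (?I (2 * n * w))"
    unfolding greedy_prog_def greedy_def
  proof (rule refines_loop[where I = ?I])
    fix j Y s' assume I: "?I j Y (nmem s') (rmem s')" and i: "nmem s' ''i'' 0 = j" and ms: "mem_le V s'"
    note fr = eq_offD[OF conjunct1[OF I]]
    have "refines n f V round_prog s' (greedy_round k w Y)
      (\<lambda>Y' N M. eq_off {''t'', ''u'', ''a'', ''s'', ''o'', ''r'', ''b'', ''c'', ''y''} N (nmem s') \<and> N ''y'' = Y')"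
      by (rule refines_round) (use ms n q w m I V n0 in \<open>auto simp: fr\<close>)
    then show "refines n f V round_prog s' (greedy_round k w Y)
        (\<lambda>Y' N M. N ''i'' 0 = j \<and> ?I (Suc j) Y' (N(''i'' := (N ''i'')(0 := Suc j))) M)"
    proof (rule refines_mono)
      fix Y' N and M :: "vname \<Rightarrow> nat \<Rightarrow> real"
      assume Y': "Y' \<in> set_pmf (greedy_round k w Y)"
        and N: "eq_off {''t'', ''u'', ''a'', ''s'', ''o'', ''r'', ''b'', ''c'', ''y''} N (nmem s') \<and> N ''y'' = Y'"
      have "\<forall>u<n. Y' u \<le> w * w"
        using Y' I move_le[of n Y "w * w"] by (auto simp: greedy_round_def split: if_splits)
      moreover have "eq_off ?A N (nmem s)" using N I unfolding eq_off_def by simp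
      moreover have "N ''i'' 0 = j" using N i eq_offD[OF conjunct1[OF N], of "''i''"] by simp
      ultimately show "N ''i'' 0 = j \<and> ?I (Suc j) Y' (N(''i'' := (N ''i'')(0 := Suc j))) M"
        using N by simp
    qed
  qed (use s n w V y in \<open>auto simp: eq_off_def\<close>)
  then show ?thesis
    \<comment> \<open>\<open>refines_mono\<close> supplies membership in the support, so the bound
      on the total is taken from the process instead of the loop invariant.\<close>
    by (rule refines_mono) (use greedy_support[OF _ n0(2,1)] in auto)
qed

end

section \<open>Programs for mixing, rounding and output\<close>

definition mix_prog :: com where
  "mix_prog = seq [sum_prog,
     nset ''p'' (NMul (Num 2) (NSub (NMul (nvar ''m'') (nvar ''q'')) (nvar ''t''))),
     nset ''d'' (NSub (NMul (nvar ''n'') (nvar ''q'')) (NMul (Num 2) (nvar ''t''))),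
     loop ''u'' (nvar ''n'') (seq [NAssign ''y'' (nvar ''u'')
       (NAdd (NMul (NMul (Num 2) (NSub (nvar ''d'') (nvar ''p''))) (nget ''y'' ''u'')) (NMul (nvar ''p'') (nvar ''q'')))]),
     nset ''q'' (NMul (NMul (Num 2) (nvar ''d'')) (nvar ''q''))]"

lemma refines_mix:
  assumes s: "mem_le V s" and n: "nmem s ''n'' 0 = n" and q: "nmem s ''q'' 0 = Q" and y: "nmem s ''y'' = Y"
    and m: "nmem s ''m'' 0 = k" and Y: "\<And>u. u < n \<Longrightarrow> Y u \<le> Q" and Q: "0 < Q" and k: "2 * k \<le> n" and n0: "0 < n"
    and tot: "(\<Sum>u<n. Y u) = 0 \<or> (\<Sum>u<n. Y u) < k * Q"
    and V: "n \<le> V" "n * Q \<le> V" "2 * (n * Q) * Q \<le> V"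
  shows "refines n f V mix_prog s (return_pmf ()) (\<lambda>_ N M.
    eq_off {''t'', ''u'', ''p'', ''d'', ''y'', ''q''} N (nmem s) \<and> N ''q'' 0 = mix_den n Q Y \<and>
    (\<forall>u<n. N ''y'' u = mix_num n k Q Y u))"
  unfolding mix_prog_def seq.simps
proof (rule refines_Seq_det[OF refines_sum[OF s n _ V(2,1)]])
  show "nmem s ''y'' u \<le> Q" if "u < n" for u using Y[OF that] y by simp
  define t where "t = (\<Sum>u<n. Y u)"
  define p where "p = 2 * (k * Q - t)"
  define d where "d = n * Q - 2 * t"
  have num: "mix_num n k Q Y = (\<lambda>u. 2 * (d - p) * Y u + p * Q)"
    by (simp add: mix_num_def Let_def t_def d_def p_def)
  have den: "mix_den n Q Y = 2 * d * Q" by (simp add: mix_den_def t_def d_def)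
  have "2 * (k * Q) \<le> n * Q" using k by (metis mult.assoc mult_le_mono1)
  then have pV: "p \<le> V" unfolding p_def using V(2) by linarith
  have dV: "d \<le> V" unfolding d_def using V(2) by linarith
  have "2 * d * Q \<le> 2 * (n * Q) * Q" unfolding d_def by (intro mult_le_mono) auto
  then have denV: "mix_den n Q Y \<le> V" using V(3) den by linarith
  fix s1 assume s1: "eq_off {''t'', ''u''} (nmem s1) (nmem s) \<and> nmem s1 ''t'' 0 = (\<Sum>u<n. nmem s ''y'' u)" and m1: "mem_le V s1"
  note fr1 = eq_offD[OF conjunct1[OF s1]]
  let ?c = "Seq (NAssign ''y'' (nvar ''u'')
       (NAdd (NMul (NMul (Num 2) (NSub (nvar ''d'') (nvar ''p''))) (nget ''y'' ''u'')) (NMul (nvar ''p'') (nvar ''q'')))) Skip"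
  let ?R = "\<lambda>_ N M. eq_off {''t'', ''u'', ''p'', ''d'', ''y'', ''q''} N (nmem s) \<and> N ''q'' 0 = mix_den n Q Y \<and>
    (\<forall>u<n. N ''y'' u = mix_num n k Q Y u)"
  let ?e = "nset ''q'' (NMul (NMul (Num 2) (nvar ''d'')) (nvar ''q''))"
  have p1: "nval s1 (NMul (Num 2) (NSub (NMul (nvar ''m'') (nvar ''q'')) (nvar ''t''))) = p"
    using s1 m q y by (simp add: fr1 p_def t_def)
  show "refines n f V (Seq (nset ''p'' (NMul (Num 2) (NSub (NMul (nvar ''m'') (nvar ''q'')) (nvar ''t''))))
      (Seq (nset ''d'' (NSub (NMul (nvar ''n'') (nvar ''q'')) (NMul (Num 2) (nvar ''t''))))
      (Seq (loop ''u'' (nvar ''n'') ?c) (Seq ?e Skip)))) s1 (return_pmf ()) ?R"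
  proof (rule refines_NAssign[OF m1], unfold p1, rule pV)
    fix s2 assume s2: "nmem s2 = (nmem s1)(''p'' := (nmem s1 ''p'')(nval s1 (Num 0) := p))" and m2: "mem_le V s2"
    have d2: "nval s2 (NSub (NMul (nvar ''n'') (nvar ''q'')) (NMul (Num 2) (nvar ''t''))) = d"
      using s1 s2 n q y by (simp add: fr1 d_def t_def)
    show "refines n f V (Seq (nset ''d'' (NSub (NMul (nvar ''n'') (nvar ''q'')) (NMul (Num 2) (nvar ''t''))))
      (Seq (loop ''u'' (nvar ''n'') ?c) (Seq ?e Skip))) s2 (return_pmf ()) ?R"
    proof (rule refines_NAssign[OF m2], unfold d2, rule dV)
      fix s3 assume s3: "nmem s3 = (nmem s2)(''d'' := (nmem s2 ''d'')(nval s2 (Num 0) := d))" and m3: "mem_le V s3"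
      \<comment> \<open>The array is overwritten in place, so positions from \<open>j\<close> on
        must still hold \<open>Y\<close>. \<open>''q''\<close> is absent from the written names
        because the body reads the old denominator.\<close>
      let ?I = "\<lambda>j N (M :: vname \<Rightarrow> nat \<Rightarrow> real). eq_off {''t'', ''u'', ''p'', ''d'', ''y''} N (nmem s) \<and> N ''p'' 0 = p \<and> N ''d'' 0 = d \<and>
        (\<forall>u<j. N ''y'' u = mix_num n k Q Y u) \<and> (\<forall>u\<ge>j. N ''y'' u = Y u)"
      have e3: "eq_off {''t'', ''u'', ''p'', ''d'', ''y''} (nmem s3) (nmem s)"
        using s1 unfolding s2 s3 eq_off_def by simp
      have y3: "nmem s3 ''y'' = Y" "nmem s3 ''p'' 0 = p" "nmem s3 ''d'' 0 = d"
        unfolding s2 s3 using y by (simp_all add: fr1)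
      show "refines n f V (Seq (loop ''u'' (nvar ''n'') ?c) (Seq ?e Skip)) s3 (return_pmf ()) ?R"
      proof (rule refines_Seq_det[OF refines_loop_det[OF m3, where L = n and I = ?I]])
        show "?I 0 ((nmem s3)(''u'' := (nmem s3 ''u'')(0 := 0))) (rmem s3)"
          using e3 y3 by simp
        fix j s' assume j: "j < n" and I: "?I j (nmem s') (rmem s')" and u: "nmem s' ''u'' 0 = j" and ms: "mem_le V s'"
        note fr = eq_offD[OF conjunct1[OF I]]
        have "mix_num n k Q Y j \<le> mix_den n Q Y"
          by (rule mix_num_le) (use Y Q k n0 tot j in auto)
        then have "mix_num n k Q Y j \<le> V" using denV by linarith
        then have jV: "2 * (d - p) * Y j + p * Q \<le> V" by (simp add: num)
        show "refines n f V ?c s' (return_pmf ()) (\<lambda>_ N M. N ''u'' 0 = j \<and> ?I (Suc j) (N(''u'' := (N ''u'')(0 := Suc j))) M)"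
          using I u q jV by (intro refines_NAssign ms refines_Skip) (auto simp: fr num less_Suc_eq)
      next
        fix s4 assume I: "?I n (nmem s4) (rmem s4)" and m4: "mem_le V s4"
        note fr = eq_offD[OF conjunct1[OF I]]
        have "eq_off {''t'', ''u'', ''p'', ''d'', ''y'', ''q''} (nmem s4) (nmem s)"
          using I unfolding eq_off_def by simp
        then show "refines n f V (Seq ?e Skip) s4 (return_pmf ()) ?R"
          using I q den denV by (intro refines_NAssign m4 refines_Skip) (auto simp: fr)
      qed (use n V in \<open>auto simp: eq_off_def\<close>)
    qed
  qed
qed

definition pipage_prog :: com where
  "pipage_prog = seq [nset ''c'' (Num 0), loop ''u'' (NSub (nvar ''n'') (Num 1)) (seq [
     nset ''v'' (NAdd (nvar ''u'') (Num 1)),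
     nset ''t'' (NAdd (nget ''y'' ''c'') (nget ''y'' ''v'')),
     Cond (NLess (nvar ''q'') (nvar ''t''))
       (seq [Random ''a'' (NSub (NSub (NMul (Num 2) (nvar ''q'')) (nvar ''t'')) (Num 1)),
          Cond (NLess (nvar ''a'') (NSub (nvar ''q'') (nget ''y'' ''v'')))
            (seq [NAssign ''y'' (nvar ''c'') (nvar ''q''), NAssign ''y'' (nvar ''v'') (NSub (nvar ''t'') (nvar ''q'')), nset ''c'' (nvar ''v'')])
            (seq [NAssign ''y'' (nvar ''c'') (NSub (nvar ''t'') (nvar ''q'')), NAssign ''y'' (nvar ''v'') (nvar ''q'')])])
       (seq [Random ''a'' (NSub (nvar ''t'') (Num 1)),
          Cond (NLess (nvar ''a'') (nget ''y'' ''c''))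
            (seq [NAssign ''y'' (nvar ''c'') (nvar ''t''), NAssign ''y'' (nvar ''v'') (Num 0)])
            (seq [NAssign ''y'' (nvar ''c'') (Num 0), NAssign ''y'' (nvar ''v'') (nvar ''t''), nset ''c'' (nvar ''v'')])])])]"

lemma refines_pipage:
  assumes s: "mem_le V s" and n: "nmem s ''n'' 0 = n" and q: "nmem s ''q'' 0 = Q"
    and y: "\<And>u. u < n \<Longrightarrow> nmem s ''y'' u = Y u"
    and Y: "\<And>u. u < n \<Longrightarrow> Y u \<le> Q" and n0: "0 < n" and V: "n \<le> V" "2 * Q \<le> V"
  shows "refines n f V pipage_prog s (pipage n Q Y) (\<lambda>x N M.
    eq_off {''t'', ''u'', ''v'', ''a'', ''c'', ''y''} N (nmem s) \<and> (\<forall>u<n. N ''y'' u = fst x u))"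
  unfolding pipage_prog_def seq.simps
proof (rule refines_NAssign[OF s], simp)
  fix s0 assume s0: "nmem s0 = (nmem s)(''c'' := (nmem s ''c'')(nval s (Num 0) := nval s (Num 0)))" and m0: "mem_le V s0"
  let ?A = "{''t'', ''u'', ''v'', ''a'', ''c'', ''y''}"
  let ?K = "\<Sum>u<n. Y u"
  let ?J = "\<lambda>x N. eq_off ?A N (nmem s) \<and> N ''c'' 0 = snd x \<and> (\<forall>u<n. N ''y'' u = fst x u)"
  let ?I = "\<lambda>j x N (M :: vname \<Rightarrow> nat \<Rightarrow> real). ?J x N \<and> pipage_inv n Q ?K j x"
  let ?h1 = "Seq (NAssign ''y'' (nvar ''c'') (nvar ''q'')) (Seq (NAssign ''y'' (nvar ''v'') (NSub (nvar ''t'') (nvar ''q''))) (Seq (nset ''c'' (nvar ''v'')) Skip))"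
  let ?h2 = "Seq (NAssign ''y'' (nvar ''c'') (NSub (nvar ''t'') (nvar ''q''))) (Seq (NAssign ''y'' (nvar ''v'') (nvar ''q'')) Skip)"
  let ?l1 = "Seq (NAssign ''y'' (nvar ''c'') (nvar ''t'')) (Seq (NAssign ''y'' (nvar ''v'') (Num 0)) Skip)"
  let ?l2 = "Seq (NAssign ''y'' (nvar ''c'') (Num 0)) (Seq (NAssign ''y'' (nvar ''v'') (nvar ''t'')) (Seq (nset ''c'' (nvar ''v'')) Skip))"
  let ?hi = "Seq (Random ''a'' (NSub (NSub (NMul (Num 2) (nvar ''q'')) (nvar ''t'')) (Num 1)))
     (Seq (Cond (NLess (nvar ''a'') (NSub (nvar ''q'') (nget ''y'' ''v''))) ?h1 ?h2) Skip)"
  let ?lo = "Seq (Random ''a'' (NSub (nvar ''t'') (Num 1))) (Seq (Cond (NLess (nvar ''a'') (nget ''y'' ''c'')) ?l1 ?l2) Skip)"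
  let ?c = "Seq (nset ''v'' (NAdd (nvar ''u'') (Num 1))) (Seq (nset ''t'' (NAdd (nget ''y'' ''c'') (nget ''y'' ''v'')))
     (Seq (Cond (NLess (nvar ''q'') (nvar ''t'')) ?hi ?lo) Skip))"
  have "refines n f V (loop ''u'' (NSub (nvar ''n'') (Num 1)) ?c) s0 (pipage n Q Y) (?I (n - 1))"
    unfolding pipage_def
  proof (rule refines_loop[OF m0, where I = ?I])
    show "n - 1 \<le> V" using V by simp
    show "?I 0 (Y, 0) ((nmem s0)(''u'' := (nmem s0 ''u'')(0 := 0))) (rmem s0)"
      using s0 y pipage_start[of n Y Q ?K] Y by simp
    show "nval s' (NSub (nvar ''n'') (Num 1)) = n - 1" if "?I j x (nmem s') (rmem s')" for j x s'
      using that n by (simp add: eq_off_def)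
    fix j x s' assume j: "j < n - 1" and I: "?I j x (nmem s') (rmem s')" and u: "nmem s' ''u'' 0 = j" and ms: "mem_le V s'"
    note fr = eq_offD[OF conjunct1[OF conjunct1[OF I]]]
    obtain Z c where x: "x = (Z, c)" by (cases x)
    define v where "v = Suc j"
    define t where "t = Z c + Z v"
    have cj: "c \<le> j" and Zle: "\<And>u. u < n \<Longrightarrow> Z u \<le> Q" using I by (auto simp: pipage_inv_def x)
    have cv: "c < n" "v < n" "c \<noteq> v" using cj j by (auto simp: v_def)
    have Zc: "nmem s' ''c'' 0 = c" "nmem s' ''y'' c = Z c" "nmem s' ''y'' v = Z v" "\<forall>u<n. nmem s' ''y'' u = Z u"
      using I cv by (auto simp: x)
    have tV: "t \<le> V" unfolding t_def using Zle[OF cv(1)] Zle[OF cv(2)] V(2) by linarith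
    have QV: "Q \<le> V" using V by simp
    have vV: "v \<le> V" using cv V by simp
    have q': "nmem s' ''q'' 0 = Q" using q by (simp add: fr)
    let ?R = "\<lambda>x' N M. N ''u'' 0 = j \<and> ?J x' N"
    let ?N = "\<lambda>a. (nmem s')(''v'' := (nmem s' ''v'')(0 := v), ''t'' := (nmem s' ''t'')(0 := t), ''a'' := (nmem s' ''a'')(0 := a))"
    let ?ret1 = "\<lambda>a. return_pmf (if a < Q - Z v then (Z(c := Q, v := t - Q), v) else (Z(c := t - Q, v := Q), c))"
    let ?ret2 = "\<lambda>a. return_pmf (if a < Z c then (Z(c := t, v := 0), c) else (Z(c := 0, v := t), v))"
    let ?b1 = "NLess (nvar ''a'') (NSub (nvar ''q'') (nget ''y'' ''v''))" and ?b2 = "NLess (nvar ''a'') (nget ''y'' ''c'')"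
    let ?b = "NLess (nvar ''q'') (nvar ''t'')" and ?t = "NAdd (nget ''y'' ''c'') (nget ''y'' ''v'')"
    have "refines n f V ?c s' (pipage_step Q v x) ?R"
    proof (rule refines_NAssign[OF ms])
      show "nval s' (NAdd (nvar ''u'') (Num 1)) \<le> V" using u vV by (simp add: v_def)
      fix s1 assume s1: "nmem s1 = (nmem s')(''v'' := (nmem s' ''v'')(nval s' (Num 0) := nval s' (NAdd (nvar ''u'') (Num 1))))"
        and m1: "mem_le V s1"
      show "refines n f V (Seq (nset ''t'' ?t) (Seq (Cond ?b ?hi ?lo) Skip))
        s1 (pipage_step Q v x) ?R"
      proof (rule refines_NAssign[OF m1])
        have t1: "nval s1 ?t = t"
          using Zc u by (simp add: s1 t_def v_def)
        then show "nval s1 ?t \<le> V" using tV by simp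
        fix s2 assume "nmem s2 = (nmem s1)(''t'' := (nmem s1 ''t'')(nval s1 (Num 0) := nval s1 ?t))"
          and m2: "mem_le V s2"
        then have s2: "nmem s2 = (nmem s')(''v'' := (nmem s' ''v'')(0 := v), ''t'' := (nmem s' ''t'')(0 := t))"
          unfolding t1 using u by (simp add: s1 v_def)
        show "refines n f V (Seq (Cond ?b ?hi ?lo) Skip) s2 (pipage_step Q v x) ?R"
        proof (rule refines_Cond[OF m2])
          fix s3 assume b: "bval s2 ?b" and s3: "nmem s3 = nmem s2" and m3: "mem_le V s3"
          have tQ: "\<not> t \<le> Q" using b q' by (simp add: s2)
          have p: "pipage_step Q v x = map_pmf (\<lambda>a. if a < Q - Z v then (Z(c := Q, v := t - Q), v) else (Z(c := t - Q, v := Q), c))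
              (pmf_of_set {0..2 * Q - t - 1})"
            using tQ unfolding x pipage_step_def Let_def t_def fst_conv snd_conv by simp
          show "refines n f V (Seq ?hi Skip) s3 (pipage_step Q v x) ?R"
            unfolding p
          proof (rule refines_Seq_assoc, rule refines_Random_map[OF m3])
            show "nval s3 (NSub (NSub (NMul (Num 2) (nvar ''q'')) (nvar ''t'')) (Num 1)) = 2 * Q - t - 1"
              using q' by (simp add: s3 s2)
            show "2 * Q - t - 1 \<le> V" using V by simp
            fix a s4 assume s4: "nmem s4 = (nmem s3)(''a'' := (nmem s3 ''a'')(0 := a))" and m4: "mem_le V s4"
            have N4: "nmem s4 = ?N a"
              by (simp add: s4 s3 s2)
            show "refines n f V (Seq (Seq (Cond ?b1 ?h1 ?h2) Skip) Skip) s4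
              (?ret1 a) ?R"
            proof (rule refines_Seq_assoc, rule refines_Cond[OF m4])
              fix s5 assume b5: "bval s4 ?b1" and s5: "nmem s5 = nmem s4" and m5: "mem_le V s5"
              have a: "a < Q - Z v" using b5 q' Zc by (simp add: N4)
              show "refines n f V (Seq ?h1 (Seq Skip Skip)) s5
                (?ret1 a) ?R"
                using a I u Zc q' tV QV vV cv
                by (intro refines_Seq_assoc refines_NAssign m5 refines_Skip_Seq refines_Skip) (auto simp: s5 N4)
            next
              fix s5 assume b5: "\<not> bval s4 ?b1" and s5: "nmem s5 = nmem s4" and m5: "mem_le V s5"
              have a: "\<not> a < Q - Z v" using b5 q' Zc by (simp add: N4)
              show "refines n f V (Seq ?h2 (Seq Skip Skip)) s5
                (?ret1 a) ?R"
                using a I u Zc q' tV QV vV cv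
                by (intro refines_Seq_assoc refines_NAssign m5 refines_Skip_Seq refines_Skip) (auto simp: s5 N4)
            qed
          qed
        next
          fix s3 assume b: "\<not> bval s2 ?b" and s3: "nmem s3 = nmem s2" and m3: "mem_le V s3"
          have tQ: "t \<le> Q" using b q' by (simp add: s2)
          have p: "pipage_step Q v x = map_pmf (\<lambda>a. if a < Z c then (Z(c := t, v := 0), c) else (Z(c := 0, v := t), v))
              (pmf_of_set {0..t - 1})"
            using tQ unfolding x pipage_step_def Let_def t_def fst_conv snd_conv by simp
          show "refines n f V (Seq ?lo Skip) s3 (pipage_step Q v x) ?R"
            unfolding p
          proof (rule refines_Seq_assoc, rule refines_Random_map[OF m3])
            show "nval s3 (NSub (nvar ''t'') (Num 1)) = t - 1" by (simp add: s3 s2)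
            show "t - 1 \<le> V" using tV by simp
            fix a s4 assume s4: "nmem s4 = (nmem s3)(''a'' := (nmem s3 ''a'')(0 := a))" and m4: "mem_le V s4"
            have N4: "nmem s4 = ?N a"
              by (simp add: s4 s3 s2)
            show "refines n f V (Seq (Seq (Cond ?b2 ?l1 ?l2) Skip) Skip) s4
              (?ret2 a) ?R"
            proof (rule refines_Seq_assoc, rule refines_Cond[OF m4])
              fix s5 assume b5: "bval s4 ?b2" and s5: "nmem s5 = nmem s4" and m5: "mem_le V s5"
              have a: "a < Z c" using b5 q' Zc by (simp add: N4)
              show "refines n f V (Seq ?l1 (Seq Skip Skip)) s5
                (?ret2 a) ?R"
                using a I u Zc q' tV QV vV cv
                by (intro refines_Seq_assoc refines_NAssign m5 refines_Skip_Seq refines_Skip) (auto simp: s5 N4)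
            next
              fix s5 assume b5: "\<not> bval s4 ?b2" and s5: "nmem s5 = nmem s4" and m5: "mem_le V s5"
              have a: "\<not> a < Z c" using b5 q' Zc by (simp add: N4)
              show "refines n f V (Seq ?l2 (Seq Skip Skip)) s5
                (?ret2 a) ?R"
                using a I u Zc q' tV QV vV cv
                by (intro refines_Seq_assoc refines_NAssign m5 refines_Skip_Seq refines_Skip) (auto simp: s5 N4)
            qed
          qed
        qed
      qed
    qed
    \<comment> \<open>Execution only delivers the memory contents; \<open>pipage_inv\<close> for the
      new state comes from the support of \<open>pipage_step\<close>.\<close>
    then show "refines n f V ?c s' (pipage_step Q (Suc j) x) (\<lambda>x' N M. N ''u'' 0 = j \<and> ?I (Suc j) x' (N(''u'' := (N ''u'')(0 := Suc j))) M)"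
      unfolding v_def
    proof (rule refines_mono)
      fix x' N and M :: "vname \<Rightarrow> nat \<Rightarrow> real"
      assume x': "x' \<in> set_pmf (pipage_step Q (Suc j) x)" and N: "N ''u'' 0 = j \<and> ?J x' N"
      have "pipage_inv n Q ?K (Suc j) x'"
        by (rule pipage_step_inv[OF _ _ x']) (use I j in auto)
      then show "N ''u'' 0 = j \<and> ?I (Suc j) x' (N(''u'' := (N ''u'')(0 := Suc j))) M"
        using N by auto
    qed
  qed
  then have "refines n f V (Seq (loop ''u'' (NSub (nvar ''n'') (Num 1)) ?c) Skip) s0 (pipage n Q Y) (?I (n - 1))"
    by (rule refines_Seq_Skip)
  then show "refines n f V (Seq (loop ''u'' (NSub (nvar ''n'') (Num 1)) ?c) Skip) s0 (pipage n Q Y)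
      (\<lambda>x N M. eq_off ?A N (nmem s) \<and> (\<forall>u<n. N ''y'' u = fst x u))"
    by (rule refines_mono) auto
qed

text \<open>After rounding, entries are 0 or the denominator; truncated subtraction from 1 swaps
  zero and nonzero, which is all that membership looks at.\<close>

definition output_prog :: com where
  "output_prog = loop ''u'' (nvar ''n'') (seq [Cond (NLess (nvar ''n'') (NMul (Num 2) (nvar ''k'')))
     (NAssign ''out'' (nvar ''u'') (NSub (Num 1) (nget ''y'' ''u'')))
     (NAssign ''out'' (nvar ''u'') (nget ''y'' ''u''))])"

lemma refines_output:
  assumes s: "mem_le V s" and n: "nmem s ''n'' 0 = n" and k: "nmem s ''k'' 0 = k" and V: "n \<le> V" "1 \<le> V"
  shows "refines n f V output_prog s (return_pmf ()) (\<lambda>_ N M.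
    \<forall>u<n. (N ''out'' u \<noteq> 0) = (if n < 2 * k then nmem s ''y'' u = 0 else nmem s ''y'' u \<noteq> 0))"
proof -
  let ?I = "\<lambda>j N (M :: vname \<Rightarrow> nat \<Rightarrow> real). eq_off {''u'', ''out''} N (nmem s) \<and>
    (\<forall>u<j. (N ''out'' u \<noteq> 0) = (if n < 2 * k then nmem s ''y'' u = 0 else nmem s ''y'' u \<noteq> 0))"
  have "refines n f V output_prog s (return_pmf ()) (\<lambda>_. ?I n)"
    unfolding output_prog_def seq.simps
  proof (rule refines_loop_det[OF s V(1), where I = ?I])
    fix j s' assume j: "j < n" and I: "?I j (nmem s') (rmem s')" and u: "nmem s' ''u'' 0 = j" and m: "mem_le V s'"
    note fr = eq_offD[OF conjunct1[OF I]]
    have "nmem s' ''y'' j \<le> V" using m by (simp add: mem_le_def)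
    then have yV: "nmem s ''y'' j \<le> V" by (simp add: fr)
    show "refines n f V (Seq (Cond (NLess (nvar ''n'') (NMul (Num 2) (nvar ''k'')))
       (NAssign ''out'' (nvar ''u'') (NSub (Num 1) (nget ''y'' ''u'')))
       (NAssign ''out'' (nvar ''u'') (nget ''y'' ''u''))) Skip) s' (return_pmf ())
      (\<lambda>_ N M. N ''u'' 0 = j \<and> ?I (Suc j) (N(''u'' := (N ''u'')(0 := Suc j))) M)"
      by (intro refines_Cond refines_NAssign m refines_Skip; (assumption | use I u n k V yV in \<open>auto simp: fr less_Suc_eq\<close>))
  qed (use n in \<open>auto simp: eq_off_def\<close>)
  then show ?thesis by (rule refines_mono) auto
qed

section \<open>The complete program and its memory bound\<close>

definition algorithm :: com where
  "algorithm = seq [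
     Cond (NLess (nvar ''n'') (NMul (Num 2) (nvar ''k'')))
       (nset ''m'' (NSub (nvar ''n'') (nvar ''k''))) (nset ''m'' (nvar ''k'')),
     nset ''w'' (NMul (NMul (nvar ''n'') (nvar ''n'')) (nvar ''n'')),
     nset ''q'' (NMul (nvar ''w'') (nvar ''w'')),
     greedy_prog, mix_prog, pipage_prog, output_prog]"

text \<open>By symmetry, the sizes \<open>k\<close> and \<open>n - k\<close> have the same optimum.
  The degenerate value 0 arises for \<open>k = n\<close>.\<close>

definition small_side :: "nat \<Rightarrow> nat \<Rightarrow> nat" where
  "small_side n k = (if n < 2 * k then n - k else k)"

lemma small_side_le: "k \<le> n \<Longrightarrow> 2 * small_side n k \<le> n"
  by (auto simp: small_side_def)

text \<open>The largest requirement is twice the mixing denominator, at most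
  \<open>4 * n * Q^2\<close> on the grid \<open>Q = w^2 = n^6\<close>.\<close>

definition memory_bound :: "nat \<Rightarrow> nat" where
  "memory_bound n = 4 * n ^ 13"

lemma memory_bounds:
  fixes n w :: nat
  assumes "0 < n" "w = n * n * n"
  shows "n \<le> memory_bound n" "1 \<le> memory_bound n" "w \<le> memory_bound n" "w * w \<le> memory_bound n"
    "w * w * w \<le> memory_bound n" "n * (w * w) \<le> memory_bound n"
    "2 * n * w \<le> memory_bound n" "4 * (n * (w * w)) * (w * w) \<le> memory_bound n"
proof -
  have p: "n ^ a \<le> n ^ 13" if "a \<le> 13" for a
    using assms that by (intro power_increasing) auto
  have w: "w = n ^ 3" by (simp add: assms power3_eq_cube)
  have e: "w * w = n ^ 6" "w * w * w = n ^ 9" "n * (w * w) = n ^ 7" "2 * n * w = 2 * n ^ 4"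
    "4 * (n * (w * w)) * (w * w) = 4 * n ^ 13"
    unfolding w by (simp_all flip: power_add power_Suc add: mult.assoc) 
  have q: "n \<le> n ^ 13" "1 \<le> n ^ 13" "n ^ 3 \<le> n ^ 13" "n ^ 6 \<le> n ^ 13" "n ^ 9 \<le> n ^ 13" "n ^ 7 \<le> n ^ 13" "n ^ 4 \<le> n ^ 13"
    using p[of 1] p[of 0] p[of 3] p[of 6] p[of 9] p[of 7] p[of 4] by simp_all
  show "n \<le> memory_bound n" "1 \<le> memory_bound n"
    unfolding memory_bound_def using q by linarith+
  show "w \<le> memory_bound n" unfolding memory_bound_def w using q by linarith
  show "w * w \<le> memory_bound n" unfolding memory_bound_def e(1) using q by linarith
  show "w * w * w \<le> memory_bound n" unfolding memory_bound_def e(2) using q by linarith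
  show "n * (w * w) \<le> memory_bound n" unfolding memory_bound_def e(3) using q by linarith
  show "2 * n * w \<le> memory_bound n" unfolding memory_bound_def e(4) using q by linarith
  show "4 * (n * (w * w)) * (w * w) \<le> memory_bound n" unfolding memory_bound_def e(5) ..
qed

context symmetric_submodular
begin

lemma refines_algorithm:
  assumes n: "0 < n" and k: "k \<le> n"
  shows "refines n f (memory_bound n) algorithm (init_state n k) (solve (small_side n k))
    (\<lambda>S N M. {u. u < n \<and> N ''out'' u \<noteq> 0} = (if n < 2 * k then {..<n} - S else S))"
proof -
  define V where "V = memory_bound n"
  define w where "w = n * n * n"
  define l where "l = small_side n k"
  note V = memory_bounds[OF n w_def, folded V_def]
  have w0: "0 < w" using n by (simp add: w_def)
  have l: "2 * l \<le> n" unfolding l_def by (rule small_side_le[OF k])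
  have init: "nmem (init_state n k) = (\<lambda>_ _. 0)(''k'' := (\<lambda>_. 0)(0 := k), ''n'' := (\<lambda>_. 0)(0 := n))"
    by (simp add: init_state_def)
  have m: "mem_le V (init_state n k)"
    using V(1) k by (auto simp: mem_le_def init)
  let ?R = "\<lambda>S N (M :: vname \<Rightarrow> nat \<Rightarrow> real). {u. u < n \<and> N ''out'' u \<noteq> 0} = (if n < 2 * k then {..<n} - S else S)"
  let ?end = "Seq greedy_prog (Seq mix_prog (Seq pipage_prog (Seq output_prog Skip)))"
  let ?mid = "Seq (nset ''w'' (NMul (NMul (nvar ''n'') (nvar ''n'')) (nvar ''n''))) (Seq (nset ''q'' (NMul (nvar ''w'') (nvar ''w''))) ?end)"
  \<comment> \<open>\<open>''y''\<close> is never cleared: the initial memory already holds the zero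
    vector from which the greedy phase starts.\<close>
  have E: "refines n f V ?end s (solve l) ?R"
    if ms: "mem_le V s" and sn: "nmem s ''n'' 0 = n" and sk: "nmem s ''k'' 0 = k" and sm: "nmem s ''m'' 0 = l"
      and sw: "nmem s ''w'' 0 = w" and sq: "nmem s ''q'' 0 = w * w" and sy: "nmem s ''y'' = (\<lambda>_. 0)" for s
    unfolding solve_def Let_def w_def[symmetric]
  proof (rule refines_Seq[OF refines_greedy[OF ms sn sq sy sw sm n w0 V(1,2,5,6,7)]])
    fix Y s1
    assume s1: "eq_off {''t'', ''u'', ''a'', ''s'', ''o'', ''r'', ''b'', ''c'', ''y'', ''i''} (nmem s1) (nmem s) \<and> nmem s1 ''y'' = Y \<and>
       (\<forall>u<n. Y u \<le> w * w) \<and> ((\<Sum>u<n. Y u) = 0 \<or> (\<Sum>u<n. Y u) < l * (w * w))" and m1: "mem_le V s1"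
    note fr1 = eq_offD[OF conjunct1[OF s1]]
    have ww: "0 < w * w" using w0 by simp
    have Y: "Y u \<le> w * w" if "u < n" for u using s1 that by simp
    have tot: "(\<Sum>u<n. Y u) = 0 \<or> (\<Sum>u<n. Y u) < l * (w * w)" using s1 by simp
    have V2: "2 * (n * (w * w)) * (w * w) \<le> V" using V(8) by linarith
    have denV: "2 * mix_den n (w * w) Y \<le> V"
    proof -
      have "mix_den n (w * w) Y \<le> 2 * (n * (w * w)) * (w * w)"
        unfolding mix_den_def by (intro mult_le_mono) auto
      then show ?thesis using V(8) by linarith
    qed
    show "refines n f V (Seq mix_prog (Seq pipage_prog (Seq output_prog Skip))) s1
        (map_pmf (\<lambda>x. {u. u < n \<and> fst x u \<noteq> 0}) (pipage n (mix_den n (w * w) Y) (mix_num n l (w * w) Y))) ?R"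
    proof (rule refines_Seq_det[OF refines_mix[OF m1]])
      fix s2
      assume s2: "eq_off {''t'', ''u'', ''p'', ''d'', ''y'', ''q''} (nmem s2) (nmem s1) \<and> nmem s2 ''q'' 0 = mix_den n (w * w) Y \<and>
        (\<forall>u<n. nmem s2 ''y'' u = mix_num n l (w * w) Y u)" and m2: "mem_le V s2"
      note fr2 = eq_offD[OF conjunct1[OF s2]]
      show "refines n f V (Seq pipage_prog (Seq output_prog Skip)) s2
        (map_pmf (\<lambda>x. {u. u < n \<and> fst x u \<noteq> 0}) (pipage n (mix_den n (w * w) Y) (mix_num n l (w * w) Y))) ?R"
      proof (rule refines_Seq_map[OF refines_pipage[OF m2]])
        show "mix_num n l (w * w) Y u \<le> mix_den n (w * w) Y" if "u < n" for u
          by (rule mix_num_le) (use Y ww l n tot that in auto)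
        fix x s3
        assume s3: "eq_off {''t'', ''u'', ''v'', ''a'', ''c'', ''y''} (nmem s3) (nmem s2) \<and> (\<forall>u<n. nmem s3 ''y'' u = fst x u)"
          and m3: "mem_le V s3"
        note fr3 = eq_offD[OF conjunct1[OF s3]]
        show "refines n f V (Seq output_prog Skip) s3 (return_pmf {u. u < n \<and> fst x u \<noteq> 0}) ?R"
        proof (rule refines_Seq_det[OF refines_output[OF m3 _ _ V(1,2)]])
          show "nmem s3 ''n'' 0 = n" "nmem s3 ''k'' 0 = k"
            using sn sk by (simp_all add: fr1 fr2 fr3)
          fix s4 assume s4: "\<forall>u<n. (nmem s4 ''out'' u \<noteq> 0) = (if n < 2 * k then nmem s3 ''y'' u = 0 else nmem s3 ''y'' u \<noteq> 0)"
            and m4: "mem_le V s4"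
          have "?R {u. u < n \<and> fst x u \<noteq> 0} (nmem s4) (rmem s4)"
            using s4 s3 by (cases "n < 2 * k") auto
          with m4 show "refines n f V Skip s4 (return_pmf {u. u < n \<and> fst x u \<noteq> 0}) ?R"
            by (rule refines_Skip)
        qed
      qed (use s2 sn n V denV in \<open>auto simp: fr1 fr2\<close>)
    qed (use s1 sn sq sm n w0 l V V2 in \<open>auto simp: fr1\<close>)
  qed
  have M: "refines n f V ?mid s (solve l) ?R"
    if ms: "mem_le V s" and N: "nmem s = (nmem (init_state n k))(''m'' := (\<lambda>_. 0)(0 := l))" for s
  proof (rule refines_NAssign[OF ms])
    show "nval s (NMul (NMul (nvar ''n'') (nvar ''n'')) (nvar ''n'')) \<le> V"
      using V(3) by (simp add: N init w_def)
    fix s1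
    assume "nmem s1 = (nmem s)(''w'' := (nmem s ''w'')(nval s (Num 0) := nval s (NMul (NMul (nvar ''n'') (nvar ''n'')) (nvar ''n''))))"
      and m1: "mem_le V s1"
    then have N1: "nmem s1 = (nmem s)(''w'' := (nmem s ''w'')(0 := w))" by (simp add: N init w_def)
    show "refines n f V (Seq (nset ''q'' (NMul (nvar ''w'') (nvar ''w''))) ?end) s1 (solve l) ?R"
    proof (rule refines_NAssign[OF m1])
      show "nval s1 (NMul (nvar ''w'') (nvar ''w'')) \<le> V" using V(4) by (simp add: N1)
      fix s2
      assume "nmem s2 = (nmem s1)(''q'' := (nmem s1 ''q'')(nval s1 (Num 0) := nval s1 (NMul (nvar ''w'') (nvar ''w''))))"
        and m2: "mem_le V s2"
      then have N2: "nmem s2 = (nmem s)(''w'' := (nmem s ''w'')(0 := w), ''q'' := (nmem s ''q'')(0 := w * w))"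
        by (simp add: N1)
      show "refines n f V ?end s2 (solve l) ?R"
        by (rule E[OF m2]) (simp_all add: N2 N init)
    qed
  qed
  have lV: "l \<le> V" using l V(1) by linarith
  show ?thesis
    unfolding algorithm_def seq.simps V_def[symmetric] l_def[symmetric]
    by (intro refines_Cond refines_NAssign M m; (assumption | use lV in \<open>auto simp: init l_def small_side_def fun_eq_iff\<close>))
qed

end


subsection \<open>Running time and approximation ratio\<close>

text \<open>Polynomial upper bounds are closed under sums and products, the only operations in the
  cost bounds.\<close>

definition poly_bounded :: "(nat \<Rightarrow> nat) \<Rightarrow> bool" where
  "poly_bounded g \<longleftrightarrow> (\<exists>p :: nat poly. \<forall>V. g V \<le> poly p V)"

lemma poly_bounded_const: "poly_bounded (\<lambda>_. c)"
  unfolding poly_bounded_def by (intro exI[of _ "[:c:]"]) simp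

lemma poly_bounded_id: "poly_bounded (\<lambda>V. V)"
  unfolding poly_bounded_def by (intro exI[of _ "[:0, 1:]"]) simp

lemma poly_bounded_add: "poly_bounded g \<Longrightarrow> poly_bounded h \<Longrightarrow> poly_bounded (\<lambda>V. g V + h V)"
  unfolding poly_bounded_def by (metis add_mono poly_add)

lemma poly_bounded_mult: "poly_bounded g \<Longrightarrow> poly_bounded h \<Longrightarrow> poly_bounded (\<lambda>V. g V * h V)"
  unfolding poly_bounded_def by (metis mult_le_mono poly_mult)

lemma poly_bounded_Suc: "poly_bounded g \<Longrightarrow> poly_bounded (\<lambda>V. Suc (g V))"
  using poly_bounded_add[OF poly_bounded_const[of 1]] by fastforce

lemmas poly_bounded_intros =
  poly_bounded_const poly_bounded_id poly_bounded_add poly_bounded_mult poly_bounded_Suc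

lemma poly_bounded_nval_bound: "poly_bounded (\<lambda>V. nval_bound V e)"
  by (induction e) (auto intro: poly_bounded_intros)

lemma poly_bounded_ncost_bound: "poly_bounded (\<lambda>V. ncost_bound V e)"
  by (induction e) (auto intro!: poly_bounded_intros poly_bounded_nval_bound)

lemma poly_bounded_rcost_bound: "poly_bounded (\<lambda>V. rcost_bound V e)"
  by (induction e) (auto intro!: poly_bounded_intros poly_bounded_ncost_bound)

lemma poly_bounded_bcost_bound: "poly_bounded (\<lambda>V. bcost_bound V e)"
  by (induction e) (auto intro!: poly_bounded_intros poly_bounded_ncost_bound poly_bounded_rcost_bound)

lemma poly_bounded_time_bound: "poly_bounded (\<lambda>V. time_bound V c)"
  by (induction c) (auto intro!: poly_bounded_intros poly_bounded_ncost_bound poly_bounded_rcost_bound poly_bounded_bcost_bound)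

lemma poly_bounded_clock: "\<exists>p :: nat poly. \<forall>n. time_bound (memory_bound n) c \<le> poly p n"
proof -
  obtain p :: "nat poly" where p: "\<And>V. time_bound V c \<le> poly p V"
    using poly_bounded_time_bound[of c] unfolding poly_bounded_def by blast
  have "time_bound (memory_bound n) c \<le> poly (pcompose p (monom 4 13)) n" for n
    using p by (simp add: poly_pcompose poly_monom memory_bound_def)
  then show ?thesis by blast
qed

section \<open>Transfer of the guarantees to runs of the program\<close>

lemma symmetric_submodular_of_instance:
  assumes "sym_instance n k f"
  shows "symmetric_submodular n f"
proof
  show "0 \<le> f S" if "S \<subseteq> {..<n}" for S
    using assms that unfolding sym_instance_def nonneg_on_def by blast
  show "f ({..<n} - S) = f S" if "S \<subseteq> {..<n}" for S
    using assms that unfolding sym_instance_def symmetric_on_def by metis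
  show "submodular_on {..<n} f"
    using assms unfolding sym_instance_def by blast
qed

text \<open>All three facts are read off one joint distribution whose first marginal is the abstract
  solution and whose second is the run of the program.\<close>

lemma run_algorithm:
  assumes "sym_instance n k f"
  defines "h \<equiv> \<lambda>S. if n < 2 * k then {..<n} - S else S"
  shows "lossless_spmf (run algorithm n k f)"
    and "\<And>s. s \<in> set_spmf (run algorithm n k f) \<Longrightarrow> clock s \<le> time_bound (memory_bound n) algorithm"
    and "map_spmf (out_set n) (run algorithm n k f) =
      spmf_of_pmf (map_pmf h (symmetric_submodular.solve n f (small_side n k)))"
proof -
  interpret symmetric_submodular n f
    by (rule symmetric_submodular_of_instance[OF assms(1)])
  have "0 < n" "k \<le> n" using assms(1) by (auto simp: sym_instance_def)
  then have "refines n f (memory_bound n) algorithm (init_state n k) (solve (small_side n k))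
    (\<lambda>S N M. {u. u < n \<and> N ''out'' u \<noteq> 0} = h S)"
    unfolding h_def by (rule refines_algorithm)
  then have r: "rel_spmf (\<lambda>S s. out_set n s = h S \<and> clock s \<le> time_bound (memory_bound n) algorithm)
      (spmf_of_pmf (solve (small_side n k))) (run algorithm n k f)"
    unfolding refines_def run_def
    by (rule rel_spmf_mono) (simp add: out_set_def set_at_def init_state_def nupd_def)
  then obtain pq where pq: "spmf_of_pmf (solve (small_side n k)) = map_spmf fst pq" "run algorithm n k f = map_spmf snd pq"
      "\<And>S s. (S, s) \<in> set_spmf pq \<Longrightarrow> out_set n s = h S \<and> clock s \<le> time_bound (memory_bound n) algorithm"
    by (rule rel_spmfE) auto
  have "lossless_spmf (spmf_of_pmf (solve (small_side n k)))" by simp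
  then show "lossless_spmf (run algorithm n k f)" unfolding pq(1,2) by simp
  show "clock s \<le> time_bound (memory_bound n) algorithm" if "s \<in> set_spmf (run algorithm n k f)" for s
  proof -
    obtain S where "(S, s) \<in> set_spmf pq" using \<open>s \<in> set_spmf (run algorithm n k f)\<close> unfolding pq(2) by auto
    then show ?thesis using pq(3) by blast
  qed
  have "map_spmf (out_set n) (run algorithm n k f) = map_spmf (\<lambda>x. h (fst x)) pq"
    unfolding pq(2) spmf.map_comp by (rule map_spmf_cong[OF refl]) (use pq(3) in fastforce)
  also have "\<dots> = spmf_of_pmf (map_pmf h (solve (small_side n k)))"
    unfolding map_spmf_of_pmf[symmetric] pq(1) by (simp add: spmf.map_comp o_def)
  finally show "map_spmf (out_set n) (run algorithm n k f) = spmf_of_pmf (map_pmf h (solve (small_side n k)))" .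
qed

lemma polynomial_time_algorithm: "polynomial_time algorithm"
proof -
  obtain p :: "nat poly" where p: "\<And>n. time_bound (memory_bound n) algorithm \<le> poly p n"
    using poly_bounded_clock[of algorithm] by blast
  show ?thesis
    unfolding polynomial_time_def
    using run_algorithm(1,2) p by (blast intro: le_trans)
qed

lemma feasible_iff: "S \<in> feasible n k \<longleftrightarrow> S \<subseteq> {..<n} \<and> card S = k"
  by (simp add: feasible_def)

lemma finite_feasible: "finite (feasible n k)"
  by (rule finite_subset[of _ "Pow {..<n}"]) (auto simp: feasible_def)

lemma achieves_ratio_algorithm:
  assumes "sym_instance n k f"
  defines "l \<equiv> small_side n k"
  shows "achieves_ratio algorithm n k f
    (1/2 * (1 - (1 - real l / real n) powr (2 * real n / real l)) - 28 / real n)"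
proof -
  interpret symmetric_submodular n f
    by (rule symmetric_submodular_of_instance[OF assms(1)])
  define h where "h = (\<lambda>S. if n < 2 * k then {..<n} - S else S)"
  have n: "0 < n" and k: "k \<le> n" "1 \<le> k" using assms(1) by (auto simp: sym_instance_def)
  have l: "2 * l \<le> n" unfolding l_def by (rule small_side_le[OF k(1)])
  note run = run_algorithm[OF assms(1), folded h_def l_def]
  have fh: "f (h S) = f S" if "S \<subseteq> {..<n}" for S
    using symm[OF that] by (simp add: h_def)
  have hf: "h S \<in> feasible n k" if "S \<subseteq> {..<n}" "card S = l" for S
  proof -
    have "finite S" using that(1) finite_subset by blast
    then have "card ({..<n} - S) = n - l" using that by (simp add: card_Diff_subset)
    then show ?thesis using that k by (auto simp: feasible_iff h_def l_def small_side_def)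
  qed
  have sol: "S \<subseteq> {..<n}" "card S = l" if "S \<in> set_pmf (solve l)" for S
    using solve_feasible[OF n l that] by auto
  have feas: "out_set n s \<in> feasible n k" if "s \<in> set_spmf (run algorithm n k f)" for s
  proof -
    have "out_set n s \<in> set_spmf (map_spmf (out_set n) (run algorithm n k f))" using that by auto
    then show ?thesis unfolding run(3) using sol hf by auto
  qed
  have "integral\<^sup>L (measure_spmf (run algorithm n k f)) (\<lambda>s. f (out_set n s))
      = integral\<^sup>L (measure_spmf (map_spmf (out_set n) (run algorithm n k f))) f"
    unfolding measure_map_spmf_conv_distr by (subst integral_distr) auto
  also have "\<dots> = EE (solve l) (\<lambda>S. f (h S))"
    unfolding run(3) by simp
  also have "\<dots> = EE (solve l) f"
    using sol fh by (intro integral_cong_AE) (auto simp: AE_measure_pmf_iff)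
  finally have val: "integral\<^sup>L (measure_spmf (run algorithm n k f)) (\<lambda>s. f (out_set n s)) = EE (solve l) f" .
  have "{..<k} \<in> feasible n k" using k by (auto simp: feasible_iff)
  then have "opt n k f \<in> f ` feasible n k"
    unfolding opt_def using finite_feasible by (intro Max_in) auto
  then obtain T' where T': "T' \<in> feasible n k" "f T' = opt n k f" by auto
  have opt0: "0 \<le> opt n k f" using T' nonneg[of T'] by (auto simp: feasible_iff)
  \<comment> \<open>Complementing, if necessary, turns an optimal set of size \<open>k\<close> into
    one of size \<open>l\<close> with the same value.\<close>
  define T where "T = h T'"
  have "finite T'" using T'(1) finite_subset by (auto simp: feasible_iff)
  then have T: "T \<subseteq> {..<n}" "card T = l" "f T = opt n k f"
    using T' fh[of T'] by (auto simp: T_def h_def feasible_iff l_def small_side_def card_Diff_subset split: if_splits)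
  have opt: "f X \<le> f T" if "X \<subseteq> {..<n}" "card X = l" for X
    unfolding T(3) opt_def fh[OF that(1), symmetric] using hf[OF that] finite_feasible by (intro Max_ge) auto
  have "(1/2 * (1 - (1 - real l / real n) powr (2 * real n / real l)) - 28 / real n) * opt n k f \<le> EE (solve l) f"
  proof (cases "l = 0")
    \<comment> \<open>Here \<open>k = n\<close>: division by zero makes the exponent 0 and the power
      1, so the claimed factor is negative and nonnegativity of \<open>f\<close> suffices.\<close>
    case True
    have "0 \<le> EE (solve l) f"
      using sol nonneg by (intro integral_nonneg_AE) (auto simp: AE_measure_pmf_iff)
    moreover have "- (28 / real n) * opt n k f \<le> 0" using opt0 by simp
    ultimately show ?thesis by (simp add: True)
  next
    case False
    show ?thesis
      unfolding T(3)[symmetric] by (rule solve_value[OF T(1,2) _ l]) (use False opt in auto)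
  qed
  then show ?thesis unfolding achieves_ratio_def val using feas by auto
qed

theorem theorem1p2:
  shows "\<exists>P :: com. polynomial_time P \<and>
    (\<exists>\<epsilon> :: nat \<Rightarrow> real. \<epsilon> \<longlonglongrightarrow> 0 \<and>
      (\<forall>(n::nat) (k::nat) (f :: nat set \<Rightarrow> real). sym_instance n k f \<longrightarrow>
        (real k \<le> real n / 2 \<longrightarrow>
           achieves_ratio P n k f
             (1/2 * (1 - (1 - real k / real n) powr (2 * real n / real k)) - \<epsilon> n)) \<and>
        (real k > real n / 2 \<longrightarrow>
           achieves_ratio P n k f
             (1/2 * (1 - (1 - real (n - k) / real n) powr (2 * real n / real (n - k))) - \<epsilon> n))))"
proof (intro exI[of _ algorithm] exI[of _ "\<lambda>n. 28 / real n"] conjI allI impI)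
  show "polynomial_time algorithm" by (rule polynomial_time_algorithm)
  show "(\<lambda>n. 28 / real n) \<longlonglongrightarrow> 0" by (rule lim_const_over_n)
  fix n k :: nat and f :: "nat set \<Rightarrow> real"
  assume inst: "sym_instance n k f"
  show "achieves_ratio algorithm n k f (1/2 * (1 - (1 - real k / real n) powr (2 * real n / real k)) - 28 / real n)"
    if "real k \<le> real n / 2"
    using achieves_ratio_algorithm[OF inst] that by (simp add: small_side_def)
  show "achieves_ratio algorithm n k f
      (1/2 * (1 - (1 - real (n - k) / real n) powr (2 * real n / real (n - k))) - 28 / real n)"
    if "real k > real n / 2"
    using achieves_ratio_algorithm[OF inst] that by (simp add: small_side_def)
qed

end
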